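(* Let $\ell\ge2$ and $1\le m\le\ell$ be integers, let $g=Y_\ell^m$, let $B_\varepsilon$ be the homogeneous body with radial boundary $r(u)=1+\varepsilon g(u)$, $u\in S^2$, and let $\rho(u)=|r(u)u-\mathbf{c}|^2$ be the squared distance from its centroid $\mathbf{c}=\mathbf{c}(\varepsilon)$ to its boundary point in direction $u$. (i) If $m\ge2$, then $\rho(u)=\big(1+\varepsilon g(u)\big)^2$ exactly, and for every $\varepsilon$ in the convex range the equilibria of $B_\varepsilon$ are in bijection with the critical points of $g$ on $S^2$, the bijection preserving both the type (local minimum, local maximum, saddle) and the index at every critical point, the poles included. (ii) If $m=1$, then $\rho(u)=1+2\varepsilon g(u)+O(\varepsilon^2)$ as $\varepsilon\to0$, and there is a threshold $\varepsilon_0>0$ (depending on $\ell$) such that for all $0<\varepsilon<\varepsilon_0$ the equilibria of $B_\varepsilon$ are in bijection with the critical points of $g$ on $S^2$, the bijection preserving type and index. In both cases, minima of $g$ correspond to stable equilibria and maxima of $g$ correspond to unstable equilibria.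
   Context: $(\theta,\phi)$ are spherical coordinates on $S^2\subset\mathbb{R}^3$, with colatitude $\theta\in[0,\pi]$ and longitude $\phi$; the poles are $\theta=0,\pi$. For $1\le m\le\ell$, $Y_\ell^m(\theta,\phi)=P_\ell^m(\cos\theta)\cos(m\phi)$, where $P_\ell^m(x)=(1-x^2)^{m/2}\,\frac{d^m}{dx^m}P_\ell(x)$ and $P_\ell$ is the Legendre polynomial of degree $\ell$. For $\varepsilon$ with $1+\varepsilon g>0$ on $S^2$, $B_\varepsilon=\{t\,u:u\in S^2,\ 0\le t\le 1+\varepsilon g(u)\}$, taken with uniform mass density, and $\mathbf{c}(\varepsilon)$ is its centroid. The convex range is the set of $\varepsilon>0$ such that $1+\varepsilon g>0$ on $S^2$ and $B_\varepsilon$ is convex. The static equilibria of $B_\varepsilon$ are the critical points $u\in S^2$ of $\rho$; local minima of $\rho$ are stable equilibria, local maxima are unstable equilibria, and the other ones are of saddle type. The index of an isolated critical point is the Poincaré–Hopf index of the gradient vector field there. *)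

theory Defs
  imports "HOL-Analysis.Analysis" "HOL-Complex_Analysis.Winding_Numbers"
    "HOL-Computational_Algebra.Polynomial"
begin

abbreviation S2 :: "(real^3) set"
  where "S2 \<equiv> sphere 0 1"

abbreviation north_pole :: "real^3"
  where "north_pole \<equiv> vector [0, 0, 1]"

abbreviation south_pole :: "real^3"
  where "south_pole \<equiv> vector [0, 0, -1]"


section \<open>Spherical harmonics as functions on the sphere\<close>

text \<open>Rodrigues' formula.\<close>

definition legendre_poly :: "nat \<Rightarrow> real poly"
  where "legendre_poly l = smult (1 / (2 ^ l * fact l)) ((pderiv ^^ l) ([:-1, 0, 1:] ^ l))"

definition assoc_legendre :: "nat \<Rightarrow> nat \<Rightarrow> real \<Rightarrow> real"
  where "assoc_legendre l m x =
    (1 - x\<^sup>2) powr (real m / 2) * poly ((pderiv ^^ m) (legendre_poly l)) x"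

definition colatitude :: "real^3 \<Rightarrow> real"
  where "colatitude u = arccos (u $ 3)"

text \<open>
  At the poles, where the longitude is undefined, \<open>Arg 0 = 0\<close>; this is harmless below, since
  \<open>assoc_legendre l m\<close> vanishes at \<open>1\<close> and \<open>-1\<close> for \<open>m \<ge> 1\<close>.
\<close>

definition longitude :: "real^3 \<Rightarrow> real"
  where "longitude u = Arg (Complex (u $ 1) (u $ 2))"

text \<open>Only the values on \<^term>\<open>S2\<close> are meaningful.\<close>

definition sph_harm :: "nat \<Rightarrow> nat \<Rightarrow> real^3 \<Rightarrow> real"
  where "sph_harm l m u = assoc_legendre l m (cos (colatitude u)) * cos (real m * longitude u)"

lemma spherical_coordinates:
  assumes "u \<in> S2"
  shows "u = vector [sin (colatitude u) * cos (longitude u),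
                     sin (colatitude u) * sin (longitude u),
                     cos (colatitude u)]"
proof -
  have n: "(u$1)\<^sup>2 + (u$2)\<^sup>2 + (u$3)\<^sup>2 = 1"
    using assms by (simp add: norm_vec_def L2_set_def sum_3)
  then have z2: "(u$3)\<^sup>2 \<le> 1"
    using sum_power2_ge_zero[of "u$1" "u$2"] by linarith
  have z: "\<bar>u$3\<bar> \<le> 1"
    using z2 by (simp add: abs_square_le_1)
  have s: "sin (arccos (u$3)) = norm (Complex (u$1) (u$2))"
    using n z by (simp add: sin_arccos_abs cmod_def algebra_simps)
  have "Complex (u$1) (u$2) = rcis (norm (Complex (u$1) (u$2))) (Arg (Complex (u$1) (u$2)))"
    by (simp add: rcis_cmod_Arg)
  then have "u$1 = norm (Complex (u$1) (u$2)) * cos (Arg (Complex (u$1) (u$2)))"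
    and "u$2 = norm (Complex (u$1) (u$2)) * sin (Arg (Complex (u$1) (u$2)))"
    by (metis Re_rcis complex.sel(1), metis Im_rcis complex.sel(2))
  then show ?thesis
    using z s by (simp add: vec_eq_iff forall_3 colatitude_def longitude_def cos_arccos_abs)
qed

lemma sph_harm_spherical:
  assumes "0 \<le> \<theta>" "\<theta> \<le> pi" "1 \<le> m"
  shows "sph_harm l m (vector [sin \<theta> * cos \<phi>, sin \<theta> * sin \<phi>, cos \<theta>])
       = assoc_legendre l m (cos \<theta>) * cos (real m * \<phi>)"
proof (cases "sin \<theta> = 0")
  case True
  then have "(cos \<theta>)\<^sup>2 = 1"
    using sin_cos_squared_add[of \<theta>] by simp
  then show ?thesis
    using assms by (simp add: sph_harm_def colatitude_def assoc_legendre_def arccos_cos)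
next
  case False
  then have pos: "0 < sin \<theta>"
    using sin_ge_zero[OF assms(1,2)] by linarith
  define a where "a = Arg (Complex (sin \<theta> * cos \<phi>) (sin \<theta> * sin \<phi>))"
  have eq: "Complex (sin \<theta> * cos \<phi>) (sin \<theta> * sin \<phi>) = of_real (sin \<theta>) * cis \<phi>"
    by (simp add: complex_eq_iff)
  have "cis a = sgn (of_real (sin \<theta>) * cis \<phi>)"
    unfolding a_def eq using False by (intro cis_Arg) (auto simp: cis_neq_zero)
  also have "\<dots> = cis \<phi>"
    using pos by (simp add: sgn_eq norm_mult)
  finally have "cis (real m * a) = cis (real m * \<phi>)"
    by (metis Complex.DeMoivre)
  then have "cos (real m * a) = cos (real m * \<phi>)"
    by (metis cis.sel(1))
  then show ?thesis
    using assms
    by (simp add: sph_harm_def colatitude_def longitude_def a_def[symmetric] arccos_cos)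
qed


section \<open>Critical points of functions on the sphere\<close>

text \<open>
  \<open>\<lambda>x. f (sgn x)\<close> is the extension of \<open>f\<close> from \<^term>\<open>S2\<close> that is constant along rays. Its
  gradient at a point \<open>u\<close> of the sphere is orthogonal to \<open>u\<close> and is the Riemannian gradient
  of \<open>f\<close> for the round metric.
\<close>

definition has_sphere_gradient :: "(real^3 \<Rightarrow> real) \<Rightarrow> real^3 \<Rightarrow> real^3 \<Rightarrow> bool"
  where "has_sphere_gradient f u D \<longleftrightarrow> u \<in> S2 \<and> (GDERIV (\<lambda>x. f (sgn x)) u :> D)"

definition sphere_gradient :: "(real^3 \<Rightarrow> real) \<Rightarrow> real^3 \<Rightarrow> real^3"
  where "sphere_gradient f u = (THE D. has_sphere_gradient f u D)"

lemma sphere_gradient_eqI: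
  assumes "has_sphere_gradient f u D"
  shows "sphere_gradient f u = D"
  unfolding sphere_gradient_def
proof (rule the_equality, rule assms)
  fix E
  assume "has_sphere_gradient f u E"
  then have "(\<lambda>h. h \<bullet> E) = (\<lambda>h. h \<bullet> D)"
    using assms unfolding has_sphere_gradient_def gderiv_def
    by (intro has_derivative_unique[of "\<lambda>x. f (sgn x)"]) simp_all
  then have "\<forall>h. h \<bullet> E = h \<bullet> D"
    by (simp add: fun_eq_iff)
  then show "E = D"
    by (simp only: vector_eq_ldot)
qed

definition critical_points :: "(real^3 \<Rightarrow> real) \<Rightarrow> (real^3) set"
  where "critical_points f = {u. has_sphere_gradient f u 0}"

definition local_min :: "(real^3 \<Rightarrow> real) \<Rightarrow> real^3 \<Rightarrow> bool"
  where "local_min f p \<longleftrightarrow> p \<in> S2 \<and> (\<forall>\<^sub>F x in at p within S2. f p \<le> f x)"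

definition local_max :: "(real^3 \<Rightarrow> real) \<Rightarrow> real^3 \<Rightarrow> bool"
  where "local_max f p \<longleftrightarrow> p \<in> S2 \<and> (\<forall>\<^sub>F x in at p within S2. f x \<le> f p)"

definition saddle :: "(real^3 \<Rightarrow> real) \<Rightarrow> real^3 \<Rightarrow> bool"
  where "saddle f p \<longleftrightarrow> p \<in> critical_points f \<and> \<not> local_min f p \<and> \<not> local_max f p"

definition tangent_frame :: "real^3 \<Rightarrow> real^3 \<Rightarrow> real^3 \<Rightarrow> bool"
  where "tangent_frame p e1 e2 \<longleftrightarrow>
    norm e1 = 1 \<and> norm e2 = 1 \<and> e1 \<bullet> e2 = 0 \<and> cross3 e1 e2 = p"

text \<open>
  \<open>x \<mapsto> (x \<bullet> e1, x \<bullet> e2)\<close> is an oriented chart of the sphere around \<open>p\<close>, and it pushes a tangent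
  vector \<open>X\<close> forward to \<open>(X \<bullet> e1, X \<bullet> e2)\<close>. The following is the gradient field in this chart,
  taken along the circle of radius \<open>sin s\<close> around the image of \<open>p\<close>.
\<close>

definition gradient_loop ::
    "(real^3 \<Rightarrow> real) \<Rightarrow> real^3 \<Rightarrow> real^3 \<Rightarrow> real^3 \<Rightarrow> real \<Rightarrow> real \<Rightarrow> complex"
  where "gradient_loop f p e1 e2 s t =
    (let x = cos s *\<^sub>R p + sin s *\<^sub>R (cos (2 * pi * t) *\<^sub>R e1 + sin (2 * pi * t) *\<^sub>R e2);
         X = sphere_gradient f x
     in Complex (X \<bullet> e1) (X \<bullet> e2))"

text \<open>
  The Poincare-Hopf index of the gradient field at an isolated zero: the degree, along all
  sufficiently small circles, of the field read in an oriented chart.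
\<close>

definition has_index :: "(real^3 \<Rightarrow> real) \<Rightarrow> real^3 \<Rightarrow> int \<Rightarrow> bool"
  where "has_index f p k \<longleftrightarrow>
    p isolated_in critical_points f \<and>
    (\<forall>e1 e2. tangent_frame p e1 e2 \<longrightarrow>
      (\<forall>\<^sub>F s in at_right 0. winding_number (gradient_loop f p e1 e2 s) 0 = of_int k))"


section \<open>The body and its equilibria\<close>

definition body :: "(real^3 \<Rightarrow> real) \<Rightarrow> real \<Rightarrow> (real^3) set"
  where "body g \<epsilon> = {t *\<^sub>R u | t u. u \<in> S2 \<and> 0 \<le> t \<and> t \<le> 1 + \<epsilon> * g u}"

definition centroid :: "(real^3) set \<Rightarrow> real^3"
  where "centroid B = (1 / measure lborel B) *\<^sub>R (LINT x:B|lborel. x)"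

definition positive_radius :: "(real^3 \<Rightarrow> real) \<Rightarrow> real \<Rightarrow> bool"
  where "positive_radius g \<epsilon> \<longleftrightarrow> (\<forall>u\<in>S2. 1 + \<epsilon> * g u > 0)"

definition convex_range :: "(real^3 \<Rightarrow> real) \<Rightarrow> real set"
  where "convex_range g = {\<epsilon>. \<epsilon> > 0 \<and> positive_radius g \<epsilon> \<and> convex (body g \<epsilon>)}"

definition sq_dist :: "(real^3 \<Rightarrow> real) \<Rightarrow> real \<Rightarrow> real^3 \<Rightarrow> real"
  where "sq_dist g \<epsilon> u = (norm ((1 + \<epsilon> * g u) *\<^sub>R u - centroid (body g \<epsilon>)))\<^sup>2"

definition equilibria :: "(real^3 \<Rightarrow> real) \<Rightarrow> real \<Rightarrow> (real^3) set"
  where "equilibria g \<epsilon> = critical_points (sq_dist g \<epsilon>)"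

definition stable_equilibrium :: "(real^3 \<Rightarrow> real) \<Rightarrow> real \<Rightarrow> real^3 \<Rightarrow> bool"
  where "stable_equilibrium g \<epsilon> p \<longleftrightarrow> p \<in> equilibria g \<epsilon> \<and> local_min (sq_dist g \<epsilon>) p"

definition unstable_equilibrium :: "(real^3 \<Rightarrow> real) \<Rightarrow> real \<Rightarrow> real^3 \<Rightarrow> bool"
  where "unstable_equilibrium g \<epsilon> p \<longleftrightarrow> p \<in> equilibria g \<epsilon> \<and> local_max (sq_dist g \<epsilon>) p"

definition saddle_equilibrium :: "(real^3 \<Rightarrow> real) \<Rightarrow> real \<Rightarrow> real^3 \<Rightarrow> bool"
  where "saddle_equilibrium g \<epsilon> p \<longleftrightarrow> p \<in> equilibria g \<epsilon> \<and>
    \<not> stable_equilibrium g \<epsilon> p \<and> \<not> unstable_equilibrium g \<epsilon> p"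

text \<open>
  The common index is asserted to exist, so the critical points of both functions are in
  particular isolated.
\<close>

definition equilibrium_correspondence ::
    "(real^3 \<Rightarrow> real) \<Rightarrow> real \<Rightarrow> (real^3 \<Rightarrow> real^3) \<Rightarrow> bool"
  where "equilibrium_correspondence g \<epsilon> F \<longleftrightarrow>
    bij_betw F (critical_points g) (equilibria g \<epsilon>) \<and>
    (\<forall>p\<in>critical_points g.
      (local_min g p \<longleftrightarrow> stable_equilibrium g \<epsilon> (F p)) \<and>
      (local_max g p \<longleftrightarrow> unstable_equilibrium g \<epsilon> (F p)) \<and>
      (saddle g p \<longleftrightarrow> saddle_equilibrium g \<epsilon> (F p)) \<and>
      (\<exists>k. has_index g p k \<and> has_index (sq_dist g \<epsilon>) (F p) k))"

end

theory Submission
  imports Defs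
begin

text \<open>
  On the sphere, \<open>g = Re ((x + i y)^m) * Q z\<close> with \<open>Q\<close> the \<open>m\<close>-th derivative of the Legendre
  polynomial. So all functions involved are restrictions of polynomials. The argument has two
  sides, one about the centroid and one about critical points.

  \<^emph>\<open>The centroid.\<close> It is fixed by every isometry that preserves \<open>g\<close>. The reflection in the
  horizontal plane, composed with a half period in longitude when \<open>l + m\<close> is odd, kills its
  vertical component (\<open>centroid_body_symmetry\<close>). For \<open>m \<ge> 2\<close> the rotation by \<open>2 pi / m\<close> kills the
  horizontal components too, so the centroid is the origin, the squared distance is
  \<open>(1 + \<epsilon> g)^2\<close>, an increasing function of \<open>g\<close>, and the identity is the bijection
  (\<open>correspondence_if_sq_dist_radial\<close>). For \<open>m = 1\<close> one component \<open>a\<close> survives. Radial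
  coordinates turn it into the integral of \<open>(1 + \<epsilon> g)^4 x\<close> over the sphere, up to a factor; the
  linear term is the integral of \<open>g x\<close>, which is zero because \<open>g\<close> has degree \<open>l \<ge> 2\<close>. Hence
  \<open>a = O(\<epsilon>^2)\<close> (\<open>centroid_quadratic\<close>), which gives the expansion of the squared distance.

  \<^emph>\<open>Critical points for \<open>m = 1\<close>.\<close> Up to the increasing affine map \<open>t \<mapsto> 1 + a^2 + 2 \<epsilon> t\<close>, the squared
  distance is \<open>g + (\<epsilon> / 2) g^2 - \<kappa> (1 + \<epsilon> g) x\<close> with \<open>\<kappa> = a / \<epsilon>\<close>, a member of a smooth
  two-parameter family whose member at \<open>(0, 0)\<close> is \<open>g\<close>; and \<open>\<kappa>\<close> tends to \<open>0\<close> with \<open>\<epsilon>\<close>. Now \<open>g\<close>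
  is a Morse function (\<open>sph_harm_1_nondegenerate\<close>). The only delicate case is that of a critical
  point on the meridian circle \<open>y = 0\<close>: there the second derivative could vanish only where
  \<open>(1 - z^2) l (l + 1) = 1\<close>, and a Sturm argument shows that \<open>g\<close> is strictly monotone along the
  meridian from the pole to that latitude (\<open>legendre_sturm\<close>). The critical points of a Morse
  function persist, with type and index, under small perturbations of the function together with its
  first two derivatives (\<open>critical_correspondence_persists\<close>): existence and uniqueness near each of
  them come from a contraction, compactness excludes others, the type is read off from the signs of
  the Hessian form, and the index is the winding number along a circle of fixed radius, which is
  continuous in the parameters and hence constant.

  The index exists at every isolated critical point of a function with continuous gradient, as
  changing the radius or the tangent frame is a homotopy of loops that avoid \<open>0\<close>
  (\<open>isolated_zero_has_index\<close>). For every \<open>m\<close> the critical points are isolated, since there are only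
  finitely many (\<open>finite_critical_points_sph_harm\<close>); this covers the degenerate ones at the poles for
  \<open>m \<ge> 3\<close>.
\<close>

section \<open>Derivatives of Legendre polynomials\<close>

text \<open>
  The power \<open>w = (x^2 - 1)^l\<close> satisfies \<open>(x^2 - 1) w' = 2 l x w\<close>; differentiating this \<open>k + 1\<close> times
  gives the recurrence. At \<open>k = l + m\<close> it is the differential equation of the \<open>m\<close>-th derivative of
  the Legendre polynomial.
\<close>

lemma legendre_tower_recurrence:
  fixes l k :: nat
  defines "w \<equiv> \<lambda>j. (pderiv ^^ j) ([:-1, 0, 1:] ^ l :: real poly)"
  shows "[:-1, 0, 1:] * w (k + 2) + smult (2 * real k + 2 - 2 * real l) ([:0, 1:] * w (k + 1))
         + smult ((real k + 1) * (real k - 2 * real l)) (w k) = 0"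
proof -
  have w_Suc: "w (Suc j) = pderiv (w j)" for j
    by (simp add: w_def)
  show ?thesis
  proof (induction k)
    case 0
    have base: "[:-1, 0, 1:] * w 1 = smult (2 * real l) ([:0, 1:] * w 0)"
    proof (cases l)
      case (Suc n)
      have *: "p * pderiv (p ^ Suc n) = smult (2 * real (Suc n)) (r * p ^ Suc n)"
        if "pderiv p = smult 2 r" for p r :: "real poly"
        unfolding pderiv_power_Suc that by (simp add: mult_ac)
      show ?thesis
        unfolding w_def Suc One_nat_def funpow.simps o_apply id_apply
        by (rule *) (simp add: pderiv_pCons)
    qed (simp add: w_def)
    have "pderiv ([:-1, 0, 1:] * w 1) = pderiv (smult (2 * real l) ([:0, 1:] * w 0))"
      using base by simp
    then have "[:-1, 0, 1:] * w 2 + [:0, 2:] * w 1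
        = smult (2 * real l) ([:0, 1:] * w 1 + w 0)"
      unfolding pderiv_mult pderiv_smult
      by (simp add: w_Suc numeral_2_eq_2 pderiv_pCons algebra_simps)
    then have "poly ([:-1, 0, 1:] * w 2 + [:0, 2:] * w 1) x
        = poly (smult (2 * real l) ([:0, 1:] * w 1 + w 0)) x" for x
      by simp
    then have "poly ([:-1, 0, 1:] * w 2 + smult (2 - 2 * real l) ([:0, 1:] * w 1)
         + smult (- 2 * real l) (w 0)) x = poly 0 x" for x
      by (simp add: algebra_simps)
    then show ?case
      unfolding poly_eq_poly_eq_iff[symmetric] by (auto simp: fun_eq_iff numeral_2_eq_2)
  next
    case (Suc k)
    from arg_cong[OF this, of pderiv]
    have "poly (pderiv ([:-1, 0, 1:] * w (k + 2)
        + smult (2 * real k + 2 - 2 * real l) ([:0, 1:] * w (k + 1))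
        + smult ((real k + 1) * (real k - 2 * real l)) (w k))) x = 0" for x
      by simp
    then have "poly ([:-1, 0, 1:] * w (Suc k + 2)
        + smult (2 * real (Suc k) + 2 - 2 * real l) ([:0, 1:] * w (Suc k + 1))
        + smult ((real (Suc k) + 1) * (real (Suc k) - 2 * real l)) (w (Suc k))) x = 0" for x
      unfolding pderiv_mult pderiv_smult pderiv_add
      by (simp add: w_Suc pderiv_pCons algebra_simps)
    then show ?case
      unfolding poly_eq_poly_eq_iff[symmetric] by (auto simp: fun_eq_iff)
  qed
qed

text \<open>
  Up to a constant this is the Gegenbauer polynomial of degree \<open>l - m\<close>: the factor of the
  associated Legendre function that is a polynomial in the height \<open>z\<close>.
\<close>

definition legendre_deriv :: "nat \<Rightarrow> nat \<Rightarrow> real poly"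
  where "legendre_deriv l m = (pderiv ^^ m) (legendre_poly l)"

lemma legendre_deriv_Suc: "legendre_deriv l (Suc m) = pderiv (legendre_deriv l m)"
  by (simp add: legendre_deriv_def)

lemma legendre_deriv_tower:
  "legendre_deriv l m = smult (1 / (2 ^ l * fact l)) ((pderiv ^^ (m + l)) ([:-1, 0, 1:] ^ l))"
  by (simp add: legendre_deriv_def legendre_poly_def higher_pderiv_smult funpow_add)

lemma legendre_deriv_ode:
  "(x\<^sup>2 - 1) * poly (legendre_deriv l (m + 2)) x
    + 2 * (real m + 1) * x * poly (legendre_deriv l (m + 1)) x
    = (real l - real m) * (real l + real m + 1) * poly (legendre_deriv l m) x"
proof -
  define w where "w j = (pderiv ^^ j) ([:-1, 0, 1:] ^ l :: real poly)" for j
  have "poly ([:-1, 0, 1:] * w (m + l + 2)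
      + smult (2 * real (m + l) + 2 - 2 * real l) ([:0, 1:] * w (m + l + 1))
      + smult ((real (m + l) + 1) * (real (m + l) - 2 * real l)) (w (m + l))) x = 0"
    unfolding w_def legendre_tower_recurrence by simp
  then have *: "(x\<^sup>2 - 1) * poly (w (m + l + 2)) x
      + 2 * (real m + 1) * x * poly (w (m + l + 1)) x
      = (real l - real m) * (real l + real m + 1) * poly (w (m + l)) x"
    by (simp add: power2_eq_square algebra_simps)
  have tower: "poly (legendre_deriv l j) x = (1 / (2 ^ l * fact l)) * poly (w (j + l)) x" for j
    by (simp add: legendre_deriv_tower w_def)
  define c where "c = 1 / (2 ^ l * fact l :: real)"
  have "(x\<^sup>2 - 1) * (c * poly (w (m + l + 2)) x)
      + 2 * (real m + 1) * x * (c * poly (w (m + l + 1)) x)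
      = c * ((x\<^sup>2 - 1) * poly (w (m + l + 2)) x
      + 2 * (real m + 1) * x * poly (w (m + l + 1)) x)"
    by (simp add: algebra_simps)
  also have "\<dots> = (real l - real m) * (real l + real m + 1) * (c * poly (w (m + l)) x)"
    unfolding * by simp
  finally show ?thesis
    unfolding tower c_def by (simp add: ac_simps)
qed

lemma legendre_deriv_top: "poly (legendre_deriv l l) x \<noteq> 0"
proof -
  define w where "w = (pderiv ^^ (l + l)) ([:-1, 0, 1:] ^ l :: real poly)"
  have deg: "degree ([:-1, 0, 1:] ^ l :: real poly) = 2 * l"
    by (simp add: degree_power_eq)
  have "lead_coeff ([:-1, 0, 1:] ^ l :: real poly) = 1"
    by (simp add: lead_coeff_power)
  then have "coeff ([:-1, 0, 1:] ^ l :: real poly) (l + l) = 1"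
    using deg by (simp add: mult_2)
  then have "coeff w 0 \<noteq> 0"
    unfolding w_def by (simp add: coeff_higher_pderiv pochhammer_eq_0_iff)
  moreover have "degree w = 0"
    unfolding w_def degree_higher_pderiv deg by simp
  ultimately have "poly w x \<noteq> 0"
    by (metis degree_0_id poly_0_coeff_0 poly_pCons mult_zero_right add_0_right poly_0)
  then show ?thesis
    by (simp add: legendre_deriv_tower w_def)
qed

text \<open>
  At \<open>x = 1\<close> and \<open>x = -1\<close> the leading coefficient of the differential equation vanishes, so the
  equation expresses each derivative by the preceding one. A zero would therefore propagate up to the
  \<open>l\<close>-th derivative, which is a nonzero constant.
\<close>

lemma legendre_deriv_at_pole:
  assumes "m \<le> l" "x\<^sup>2 = 1"
  shows "poly (legendre_deriv l m) x \<noteq> 0"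
  using assms(1)
proof (induction m rule: inc_induct)
  case base
  then show ?case by (rule legendre_deriv_top)
next
  case (step m)
  have "x \<noteq> 0"
    using assms(2) by auto
  then show ?case
    using legendre_deriv_ode[of x l m] step assms(2) by auto
qed

text \<open>
  At other points a double root would propagate in the same way, the equation giving the second
  derivative from the lower ones.
\<close>

lemma legendre_deriv_simple_roots:
  assumes "m \<le> l" "x\<^sup>2 \<noteq> 1" "poly (legendre_deriv l m) x = 0"
  shows "poly (legendre_deriv l (Suc m)) x \<noteq> 0"
  using assms(1,3)
proof (induction m rule: inc_induct)
  case base
  then show ?case using legendre_deriv_top by blast
next
  case (step m)
  then show ?case
    using legendre_deriv_ode[of x l m] assms(2) by auto
qed

lemma legendre_deriv_minus:
  "poly (legendre_deriv l m) (- x) = (-1) ^ (l + m) * poly (legendre_deriv l m) x"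
proof -
  define w where "w j = (pderiv ^^ j) ([:-1, 0, 1:] ^ l :: real poly)" for j
  have pc_pow: "pcompose (p ^ n) r = pcompose p r ^ n" for p r :: "real poly" and n
    by (induction n) (simp_all add: pcompose_mult one_pCons pcompose_pCons)
  have "pcompose (w j) [:0, -1:] = smult ((-1) ^ j) (w j)" for j
  proof (induction j)
    case 0
    show ?case by (simp add: w_def pcompose_pCons pc_pow)
  next
    case (Suc j)
    from arg_cong[OF this, of pderiv] show ?case
      by (simp add: w_def pderiv_pcompose pderiv_smult pderiv_pCons)
  qed
  from arg_cong[OF this, of "\<lambda>p. poly p x" "m + l"] show ?thesis
    by (simp add: legendre_deriv_tower w_def poly_pcompose add.commute)
qed

text \<open>
  With \<open>z = cos \<theta>\<close> and \<open>h \<theta> = sin \<theta> * Q (cos \<theta>)\<close>, \<open>Q\<close> the first derivative of the Legendre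
  polynomial, the claim is \<open>h' \<theta> \<noteq> 0\<close> where \<open>l (l + 1) sin\<^sup>2 \<theta> = 1\<close>. The Legendre equation reads
  \<open>(sin \<theta> h')' = (1 - l (l + 1) sin\<^sup>2 \<theta>) h / sin \<theta>\<close>. Up to the latitude in question the right hand
  side has the sign of \<open>h\<close>. So as long as \<open>h\<close> and \<open>h'\<close> keep the sign that they have near the pole,
  \<open>sin \<theta> h'\<close> moves away from its value \<open>0\<close> at the pole, and \<open>h'\<close> cannot be the first to vanish. Below,
  \<open>R\<close> is \<open>h'\<close> and \<open>s\<close> is \<open>sin \<theta>\<close>, both as functions of \<open>z\<close>, and \<open>\<sigma>\<close> is the sign near the pole.
\<close>

lemma legendre_sturm:
  assumes "2 \<le> l" "(1 - z\<^sup>2) * (real l * (real l + 1)) = 1"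
  shows "z * poly (legendre_deriv l 1) z \<noteq> (1 - z\<^sup>2) * poly (legendre_deriv l 2) z"
proof -
  define \<Lambda> where "\<Lambda> = real l * (real l + 1)"
  have \<Lambda>: "\<Lambda> \<ge> 6"
    using assms(1) mult_mono[of 2 "real l" 3 "real l + 1"] by (simp add: \<Lambda>_def)
  define Q where "Q x = poly (legendre_deriv l 1) x" for x
  define Q' where "Q' x = poly (legendre_deriv l 2) x" for x
  define Q'' where "Q'' x = poly (legendre_deriv l 3) x" for x
  have DQ: "(Q has_real_derivative Q' x) (at x)" for x
    using poly_DERIV[of "legendre_deriv l 1" x] legendre_deriv_Suc[of l 1]
    by (simp add: Q_def[abs_def] Q'_def numeral_2_eq_2)
  have DQ': "(Q' has_real_derivative Q'' x) (at x)" for x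
    using poly_DERIV[of "legendre_deriv l 2" x] legendre_deriv_Suc[of l 2]
    by (simp add: Q''_def Q'_def[abs_def] numeral_3_eq_3 numeral_2_eq_2)
  have three: "1 + 2 = (3::nat)" "1 + 1 = (2::nat)"
    by simp_all
  have ode: "(1 - x\<^sup>2) * Q'' x = 4 * x * Q' x - (\<Lambda> - 2) * Q x" for x
    using legendre_deriv_ode[of x l 1] unfolding three
    by (simp add: Q_def Q'_def Q''_def \<Lambda>_def one_add_one algebra_simps)
  define R where "R x = x * Q x - (1 - x\<^sup>2) * Q' x" for x
  define R' where "R' x = (\<Lambda> - 1) * Q x - x * Q' x" for x
  have DR: "(R has_real_derivative R' x) (at x)" for x
  proof -
    have "(R has_real_derivative (Q x + x * Q' x - ((- 2 * x) * Q' x + (1 - x\<^sup>2) * Q'' x))) (at x)"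
      unfolding R_def by (auto intro!: derivative_eq_intros DQ DQ')
    then show ?thesis
      unfolding ode R'_def by (simp add: algebra_simps)
  qed
  have contR: "continuous_on S R" for S
    using DR by (meson DERIV_isCont continuous_at_imp_continuous_on)
  have contQ: "continuous_on S Q" for S
    using DQ by (meson DERIV_isCont continuous_at_imp_continuous_on)
  have Q1: "Q 1 \<noteq> 0"
    unfolding Q_def using assms(1) by (intro legendre_deriv_at_pole) auto
  define \<sigma> where "\<sigma> = sgn (Q 1)"
  have \<sigma>: "\<sigma> * Q 1 > 0" "\<sigma> \<noteq> 0"
    using Q1 by (auto simp: \<sigma>_def sgn_if)
  have main: "R y \<noteq> 0" if y: "0 \<le> y" "(1 - y\<^sup>2) * \<Lambda> = 1" for y
  proof
    assume "R y = 0"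
    have y1: "y < 1"
    proof (rule ccontr)
      assume "\<not> y < 1"
      then have "(1 - y\<^sup>2) * \<Lambda> \<le> 0"
        using \<Lambda> by (intro mult_nonpos_nonneg) (auto simp: one_le_power)
      then show False
        using y(2) by simp
    qed
    \<comment> \<open>the zero of \<open>R\<close> nearest to the pole\<close>
    define Z where "Z = {x \<in> {y..1}. R x = 0}"
    have "compact Z"
    proof -
      have "closed Z"
        unfolding Z_def by (rule continuous_closed_preimage_constant[OF contR]) simp
      moreover have "{y..1} \<inter> Z = Z"
        by (auto simp: Z_def)
      ultimately show ?thesis
        using compact_Int_closed[OF compact_Icc[of y 1], of Z] by simp
    qed
    moreover have "y \<in> Z"
      using \<open>R y = 0\<close> y1 by (simp add: Z_def)
    ultimately obtain x1 where x1: "x1 \<in> Z" and max: "\<And>x. x \<in> Z \<Longrightarrow> x \<le> x1"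
      using compact_attains_sup[of Z] by blast
    have R1: "R 1 = Q 1" by (simp add: R_def)
    have x11: "y \<le> x1" "x1 < 1" "R x1 = 0"
      using x1 R1 Q1 by (auto simp: Z_def order_less_le)
    have Rpos: "\<sigma> * R x > 0" if "x1 < x" "x \<le> 1" for x
    proof (rule ccontr)
      assume "\<not> \<sigma> * R x > 0"
      have "\<exists>w\<ge>x. w \<le> 1 \<and> \<sigma> * R w = 0"
        by (rule IVT') (use \<open>\<not> \<sigma> * R x > 0\<close> that \<sigma> R1 in \<open>auto intro!: continuous_intros contR\<close>)
      then obtain w where "x \<le> w" "w \<le> 1" "\<sigma> * R w = 0"
        by blast
      then show False
        using max[of w] that \<sigma> x11 by (auto simp: Z_def)
    qed
    define s where "s x = sqrt (1 - x\<^sup>2)" for x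
    have spos: "s x > 0" "(s x)\<^sup>2 = 1 - x\<^sup>2" if "x1 \<le> x" "x < 1" for x
    proof -
      have "x\<^sup>2 < 1"
        using that x11 y(1) by (simp add: abs_square_less_1)
      then show "s x > 0" "(s x)\<^sup>2 = 1 - x\<^sup>2"
        by (simp_all add: s_def)
    qed
    have Ds: "(s has_real_derivative - x / s x) (at x)" if "x1 \<le> x" "x < 1" for x
      unfolding s_def using spos[OF that]
      by (auto intro!: derivative_eq_intros simp: s_def divide_simps)
    have conts: "continuous_on S s" for S
      unfolding s_def by (intro continuous_intros)
    have Qpos: "\<sigma> * Q x > 0" if "x1 \<le> x" "x < 1" for x
    proof -
      have "\<sigma> * (s 1 * Q 1) < \<sigma> * (s x * Q x)"
      proof (rule DERIV_neg_imp_decreasing_open[OF that(2), where f = "\<lambda>x. \<sigma> * (s x * Q x)"])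
        fix t assume t: "x < t" "t < 1"
        have "((\<lambda>x. \<sigma> * (s x * Q x)) has_real_derivative \<sigma> * (- t / s t * Q t + s t * Q' t)) (at t)"
          using that t by (auto intro!: derivative_eq_intros Ds DQ)
        moreover have "\<sigma> * (- t / s t * Q t + s t * Q' t) = - (\<sigma> * R t) / s t"
        proof -
          have "\<sigma> * (- t / s t * Q t + s t * Q' t) = \<sigma> * (- t * Q t + (s t)\<^sup>2 * Q' t) / s t"
            using spos[of t] that t by (simp add: field_simps power2_eq_square)
          also have "- t * Q t + (s t)\<^sup>2 * Q' t = - R t"
            using spos[of t] that t by (simp add: R_def)
          finally show ?thesis by simp
        qed
        ultimately show "\<exists>d. ((\<lambda>x. \<sigma> * (s x * Q x)) has_real_derivative d) (at t) \<and> d < 0"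
          using Rpos[of t] spos[of t] that t by auto
      qed (intro continuous_intros conts contQ)
      then show ?thesis
        using spos[OF that] by (simp add: s_def zero_less_mult_iff mult_less_0_iff)
    qed
    define b where "b = (x1 + 1) / 2"
    have b: "x1 < b" "b < 1" using x11 by (auto simp: b_def)
    have "\<sigma> * (s b * R b) \<le> \<sigma> * (s x1 * R x1)"
    proof (rule DERIV_nonpos_imp_nonincreasing[where f = "\<lambda>x. \<sigma> * (s x * R x)"])
      show "x1 \<le> b" using b by simp
      fix t assume t: "x1 \<le> t" "t \<le> b"
      have "((\<lambda>x. \<sigma> * (s x * R x)) has_real_derivative \<sigma> * (- t / s t * R t + s t * R' t)) (at t)"
        using b t by (auto intro!: derivative_eq_intros Ds DR)
      moreover have "\<sigma> * (- t / s t * R t + s t * R' t) = - ((1 - \<Lambda> * (1 - t\<^sup>2)) * (\<sigma> * Q t)) / s t"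
      proof -
        have "\<sigma> * (- t / s t * R t + s t * R' t) = \<sigma> * (- t * R t + (s t)\<^sup>2 * R' t) / s t"
          using spos[of t] b t by (simp add: field_simps power2_eq_square)
        also have "- t * R t + (s t)\<^sup>2 * R' t = - ((1 - \<Lambda> * (1 - t\<^sup>2)) * Q t)"
        proof -
          have s2: "(s t)\<^sup>2 = 1 - t\<^sup>2"
            using spos[of t] b t by simp
          show ?thesis
            unfolding s2 by (simp add: R_def R'_def algebra_simps power2_eq_square)
        qed
        finally show ?thesis by simp
      qed
      moreover have "\<Lambda> * (1 - t\<^sup>2) \<le> 1"
        using y t x11 \<Lambda> power_mono[of y t 2] mult_left_mono[of "1 - t\<^sup>2" "1 - y\<^sup>2" \<Lambda>]
            by (simp add: mult.commute)
      ultimately show "\<exists>d. ((\<lambda>x. \<sigma> * (s x * R x)) has_real_derivative d) (at t) \<and> d \<le> 0"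
        using Qpos[of t] spos[of t] b t by (auto intro!: divide_nonneg_nonneg mult_nonneg_nonneg)
    qed
    moreover have "\<sigma> * (s b * R b) > 0"
      using Rpos[of b] spos[of b] b by (metis less_imp_le mult.left_commute mult_pos_pos)
    ultimately show False
      using x11 by simp
  qed
  have "R (- z) = R z \<or> R (- z) = - R z"
    using legendre_deriv_minus[of l 1 z] legendre_deriv_minus[of l 2 z]
    by (cases "even l") (auto simp: R_def Q_def Q'_def)
  then have "R z \<noteq> 0"
    using main[of z] main[of "- z"] assms(2) by (cases "z \<ge> 0") (auto simp: \<Lambda>_def)
  then show ?thesis
    by (simp add: R_def Q_def Q'_def)
qed

section \<open>Gradients of functions on the sphere\<close>

lemma S2_nonzero: "u \<in> S2 \<Longrightarrow> u \<noteq> 0"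
  by auto

lemma sgn_S2 [simp]: "u \<in> S2 \<Longrightarrow> sgn u = u"
  by (simp add: sgn_div_norm)

lemma sgn_in_S2: "u \<noteq> 0 \<Longrightarrow> sgn u \<in> S2" for u :: "real^3"
  by (simp add: norm_sgn)

lemma eventually_at_nonzero: "u \<in> S2 \<Longrightarrow> \<forall>\<^sub>F x in at u. x \<noteq> 0"
  by (rule eventually_neq_at_within)

lemma has_derivative_sgn:
  fixes x :: "'a :: real_inner"
  assumes "x \<noteq> 0"
  shows "(sgn has_derivative (\<lambda>h. (h - (sgn x \<bullet> h) *\<^sub>R sgn x) /\<^sub>R norm x)) (at x)"
proof -
  have "((\<lambda>x. x /\<^sub>R norm x) has_derivative (\<lambda>h. (h - (sgn x \<bullet> h) *\<^sub>R sgn x) /\<^sub>R norm x)) (at x)"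
    using assms
    by (auto intro!: derivative_eq_intros has_derivative_norm
        simp: sgn_div_norm divide_simps power2_eq_square algebra_simps inner_commute)
  then show ?thesis
    by (simp add: sgn_div_norm[abs_def])
qed

text \<open>
  Differentiating \<open>f\<close> composed with \<^const>\<open>sgn\<close> involves only the values of \<open>f\<close> on the sphere, so
  these notions may be computed with any convenient extension.
\<close>

lemma has_derivative_sgn_cong:
  fixes f f' :: "real^3 \<Rightarrow> real"
  assumes "\<And>u. u \<in> S2 \<Longrightarrow> f u = f' u" and "u \<in> S2"
    and "((\<lambda>x. f (sgn x)) has_derivative D) (at u)"
  shows "((\<lambda>x. f' (sgn x)) has_derivative D) (at u)"
proof (rule has_derivative_transform_eventually[OF assms(3)])
  show "\<forall>\<^sub>F x in at u. f (sgn x) = f' (sgn x)"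
    using eventually_at_nonzero[OF assms(2)]
    by eventually_elim (rule assms(1), rule sgn_in_S2)
  show "f (sgn u) = f' (sgn u)"
    using assms(1,2) by simp
qed auto

text \<open>
  The Riemannian gradient of a restriction is the tangential part of the ambient gradient, because
  the derivative of \<^const>\<open>sgn\<close> at a point of the sphere is the projection to the tangent plane.
\<close>

lemma has_sphere_gradient_restrict:
  assumes "u \<in> S2" and "\<And>v. v \<in> S2 \<Longrightarrow> f v = F v" and "GDERIV F u :> D"
  shows "has_sphere_gradient f u (D - (D \<bullet> u) *\<^sub>R u)"
proof -
  have F: "(F has_derivative (\<lambda>h. h \<bullet> D)) (at (sgn u))"
    using assms by (simp add: gderiv_def)
  have "((\<lambda>x. F (sgn x)) has_derivative
      (\<lambda>h. ((h - (sgn u \<bullet> h) *\<^sub>R sgn u) /\<^sub>R norm u) \<bullet> D)) (at u)"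
    by (rule has_derivative_compose[OF has_derivative_sgn F]) (rule S2_nonzero[OF assms(1)])
  then have "((\<lambda>x. F (sgn x)) has_derivative (\<lambda>h. h \<bullet> (D - (D \<bullet> u) *\<^sub>R u))) (at u)"
    using assms(1)
    by (simp add: inner_diff_left inner_diff_right inner_commute mult.commute)
  then show ?thesis
    using assms(1,2) unfolding has_sphere_gradient_def gderiv_def
    by (auto intro: has_derivative_sgn_cong[of F f])
qed

text \<open>
  The extension is constant along rays.
\<close>

lemma has_sphere_gradient_orthogonal:
  assumes "has_sphere_gradient f u D"
  shows "D \<bullet> u = 0"
proof -
  from assms have u: "u \<in> S2" and d: "((\<lambda>x. f (sgn x)) has_derivative (\<lambda>h. h \<bullet> D)) (at u)"
    by (auto simp: has_sphere_gradient_def gderiv_def)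
  have "((\<lambda>t. t *\<^sub>R u) has_derivative (\<lambda>t. t *\<^sub>R u)) (at (1::real))"
    by (auto intro!: derivative_eq_intros)
  then have "((\<lambda>t. f (sgn (t *\<^sub>R u))) has_derivative (\<lambda>t. (t *\<^sub>R u) \<bullet> D)) (at (1::real))"
    by (rule has_derivative_compose[where g = "\<lambda>x. f (sgn x)"]) (use d in simp)
  moreover have "((\<lambda>t. f (sgn (t *\<^sub>R u))) has_derivative (\<lambda>t. 0)) (at (1::real))"
  proof (rule has_derivative_transform_eventually[of "\<lambda>t. f u"])
    have "\<forall>\<^sub>F t in at (1::real). t > 0"
      by (rule order_tendstoD) (auto intro!: tendsto_ident_at)
    then show "\<forall>\<^sub>F t in at (1::real). f u = f (sgn (t *\<^sub>R u))"
      by eventually_elim (use u in \<open>simp add: sgn_scaleR\<close>)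
  qed (use u in auto)
  ultimately have "(\<lambda>t. (t *\<^sub>R u) \<bullet> D) = (\<lambda>t::real. 0)"
    by (rule has_derivative_unique)
  from fun_cong[OF this, of 1] show ?thesis
    by (simp add: inner_commute)
qed

lemma has_sphere_gradient_comp:
  assumes r: "\<And>v. v \<in> S2 \<Longrightarrow> r v = \<psi> (f v)"
    and "(\<psi> has_real_derivative c) (at (f u))" and "has_sphere_gradient f u D"
  shows "has_sphere_gradient r u (c *\<^sub>R D)"
proof -
  from assms(3) have u: "u \<in> S2" and d: "((\<lambda>x. f (sgn x)) has_derivative (\<lambda>h. h \<bullet> D)) (at u)"
    by (auto simp: has_sphere_gradient_def gderiv_def)
  have "(\<psi> has_derivative (*) c) (at (f (sgn u)))"
    using assms(2) u by (simp add: has_field_derivative_def)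
  from has_derivative_compose[OF d this]
  have "((\<lambda>x. \<psi> (f (sgn x))) has_derivative (\<lambda>h. h \<bullet> (c *\<^sub>R D))) (at u)"
    by simp
  then have "((\<lambda>x. r (sgn x)) has_derivative (\<lambda>h. h \<bullet> (c *\<^sub>R D))) (at u)"
    using r by (intro has_derivative_sgn_cong[OF _ u, of "\<lambda>v. \<psi> (f v)" r]) auto
  then show ?thesis
    using u by (simp add: has_sphere_gradient_def gderiv_def)
qed

lemma critical_points_iff:
  assumes "has_sphere_gradient f u D"
  shows "u \<in> critical_points f \<longleftrightarrow> D = 0"
  unfolding critical_points_def using assms sphere_gradient_eqI by (metis mem_Collect_eq)

section \<open>The index of an isolated critical point\<close>

lemma tangent_frame_orthonormal:
  assumes "tangent_frame p e1 e2"
  shows "norm p = 1" "e1 \<bullet> e1 = 1" "e2 \<bullet> e2 = 1" "p \<bullet> e1 = 0" "p \<bullet> e2 = 0" "e1 \<bullet> e2 = 0"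
    "v = (v \<bullet> p) *\<^sub>R p + (v \<bullet> e1) *\<^sub>R e1 + (v \<bullet> e2) *\<^sub>R e2"
proof -
  have 1: "norm e1 = 1" "norm e2 = 1" "e1 \<bullet> e2 = 0" "cross3 e1 e2 = p"
    using assms by (auto simp: tangent_frame_def)
  show 2: "e1 \<bullet> e1 = 1" "e2 \<bullet> e2 = 1"
    using 1 by (auto simp: norm_eq_1)
  show "e1 \<bullet> e2 = 0" by fact
  show pe: "p \<bullet> e1 = 0" "p \<bullet> e2 = 0"
    using 1(4) by (auto simp: dot_cross_self inner_commute)
  have "(norm p)\<^sup>2 = 1"
    using norm_cross[of e1 e2] 1 by (simp add: norm_and_cross_eq_0)
  then show p: "norm p = 1"
    using power2_eq_iff_nonneg[of "norm p" 1] by simp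
  \<comment> \<open>the remainder \<open>w\<close> is orthogonal to \<open>e1\<close> and \<open>e2\<close>, hence parallel to \<open>p\<close>, and orthogonal to \<open>p\<close>\<close>
  define w where "w = v - ((v \<bullet> p) *\<^sub>R p + (v \<bullet> e1) *\<^sub>R e1 + (v \<bullet> e2) *\<^sub>R e2)"
  have pp: "p \<bullet> p = 1" using p by (simp add: norm_eq_1)
  have w: "w \<bullet> p = 0" "w \<bullet> e1 = 0" "w \<bullet> e2 = 0"
    using 2 pe pp 1(3)
    by (simp_all add: w_def inner_diff_left inner_diff_right inner_add_left inner_add_right inner_commute)
  have "cross3 w p = cross3 w (cross3 e1 e2)"
    by (simp add: 1)
  also have "\<dots> = 0"
    using w by (simp add: Lagrange)
  finally have "cross3 w p = 0" .
  moreover have "norm (cross3 w p) ^ 2 = (norm w)\<^sup>2 * (norm p)\<^sup>2 - (w \<bullet> p)\<^sup>2"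
    using norm_cross_dot[of w p] by (simp add: power_mult_distrib)
  ultimately have "w = 0"
    using w p by simp
  then show "v = (v \<bullet> p) *\<^sub>R p + (v \<bullet> e1) *\<^sub>R e1 + (v \<bullet> e2) *\<^sub>R e2"
    by (simp add: w_def)
qed

text \<open>
  The geodesic circle of radius \<open>s\<close> around \<open>p\<close>, with \<open>t\<close> running once around it over the unit
  interval.
\<close>

definition frame_circle :: "real^3 \<Rightarrow> real^3 \<Rightarrow> real^3 \<Rightarrow> real \<Rightarrow> real \<Rightarrow> real^3"
  where "frame_circle p e1 e2 s t =
    cos s *\<^sub>R p + sin s *\<^sub>R (cos (2 * pi * t) *\<^sub>R e1 + sin (2 * pi * t) *\<^sub>R e2)"

lemma gradient_loop_alt:
  "gradient_loop f p e1 e2 s t = (let X = sphere_gradient f (frame_circle p e1 e2 s t)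
     in Complex (X \<bullet> e1) (X \<bullet> e2))"
  by (simp add: gradient_loop_def frame_circle_def)

lemma frame_circle_S2:
  assumes "tangent_frame p e1 e2"
  shows "frame_circle p e1 e2 s t \<in> S2"
proof -
  note fr = tangent_frame_orthonormal[OF assms]
  have pp: "p \<bullet> p = 1" using fr(1) by (simp add: norm_eq_1)
  have "frame_circle p e1 e2 s t \<bullet> frame_circle p e1 e2 s t
      = (cos s)\<^sup>2 + (sin s)\<^sup>2 * ((cos (2 * pi * t))\<^sup>2 + (sin (2 * pi * t))\<^sup>2)"
    using fr(2-6) pp by (simp add: frame_circle_def inner_add_left inner_add_right inner_commute
        power2_eq_square distrib_left)
  then show ?thesis
    by (simp add: norm_eq_1)
qed

lemma frame_circle_inner:
  assumes "tangent_frame p e1 e2"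
  shows "frame_circle p e1 e2 s t \<bullet> p = cos s"
  using tangent_frame_orthonormal(1-6)[OF assms]
  by (simp add: frame_circle_def inner_add_left inner_add_right inner_commute norm_eq_1)

lemma frame_circle_dist:
  assumes "tangent_frame p e1 e2"
  shows "dist (frame_circle p e1 e2 s t) p \<le> \<bar>s\<bar>"
proof -
  define x where "x = frame_circle p e1 e2 s t"
  have "x \<bullet> x = 1" "p \<bullet> p = 1" "x \<bullet> p = cos s"
    using frame_circle_S2[OF assms] tangent_frame_orthonormal(1)[OF assms] frame_circle_inner[OF assms]
    by (auto simp: x_def norm_eq_1)
  then have "(dist x p)\<^sup>2 = 2 - 2 * cos s"
    by (simp add: dist_norm power2_norm_eq_inner inner_diff_left inner_diff_right inner_commute)
  also have "\<dots> = (2 * sin (s / 2))\<^sup>2"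
    using cos_double_sin[of "s / 2"] by (simp add: power_mult_distrib)
  also have "\<dots> \<le> \<bar>s\<bar>\<^sup>2"
    using abs_sin_x_le_abs_x[of "s / 2"] by (intro power2_le_iff_abs_le[THEN iffD2]) auto
  finally show ?thesis
    unfolding x_def by (rule power2_le_imp_le) simp
qed

lemma tangent_frame_cross:
  assumes "tangent_frame p e1 e2"
  shows "cross3 p e1 = e2" "cross3 p e2 = - e1"
proof -
  have "e1 \<bullet> e1 = 1" "e2 \<bullet> e2 = 1" "e1 \<bullet> e2 = 0" "cross3 e1 e2 = p"
    using tangent_frame_orthonormal[OF assms] assms by (auto simp: tangent_frame_def)
  then show "cross3 p e1 = e2" "cross3 p e2 = - e1"
    using Lagrange[of e1 e1 e2] Lagrange[of e2 e1 e2] cross_skew[of p]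
    by (auto simp: inner_commute)
qed

lemma tangent_frame_cross_exists:
  assumes "norm p = 1" "norm e = 1" "p \<bullet> e = 0"
  shows "tangent_frame p e (cross3 p e)"
proof -
  have "(norm (cross3 p e))\<^sup>2 = 1"
    using norm_cross_dot[of p e] assms by simp
  then have "norm (cross3 p e) = 1"
    using power2_eq_iff_nonneg[of "norm (cross3 p e)" 1] by simp
  moreover have "cross3 e (cross3 p e) = p"
    using assms Lagrange[of e p e] by (simp add: norm_eq_1 inner_commute)
  ultimately show ?thesis
    using assms by (auto simp: tangent_frame_def dot_cross_self)
qed

lemma tangent_frame_exists:
  assumes "norm p = 1"
  obtains e1 e2 where "tangent_frame p e1 e2"
proof -
  obtain y where "y \<noteq> 0" "orthogonal p y"
    using orthogonal_to_vector_exists[of p] by auto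
  then have "norm (sgn y) = 1" "p \<bullet> sgn y = 0"
    by (auto simp: norm_sgn orthogonal_def sgn_div_norm)
  then show ?thesis
    using tangent_frame_cross_exists[OF assms] that by blast
qed

definition rotate_frame :: "real \<Rightarrow> real^3 \<Rightarrow> real^3 \<Rightarrow> real^3"
  where "rotate_frame \<alpha> a b = cos \<alpha> *\<^sub>R a + sin \<alpha> *\<^sub>R b"

lemma tangent_frame_rotate:
  assumes "tangent_frame p e1 e2"
  shows "tangent_frame p (rotate_frame \<alpha> e1 e2) (rotate_frame \<alpha> e2 (- e1))"
proof -
  note fr = tangent_frame_orthonormal(1-6)[OF assms]
  have "norm (rotate_frame \<alpha> e1 e2) = 1"
    using fr(2-6) by (simp add: rotate_frame_def norm_eq_1 inner_add_left inner_add_right inner_commute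
        flip: power2_eq_square)
  moreover have "p \<bullet> rotate_frame \<alpha> e1 e2 = 0"
    using fr by (simp add: rotate_frame_def inner_add_right)
  moreover have "cross3 p (rotate_frame \<alpha> e1 e2) = rotate_frame \<alpha> e2 (- e1)"
    by (simp add: rotate_frame_def cross_add_right cross_mult_right tangent_frame_cross[OF assms])
  ultimately show ?thesis
    using tangent_frame_cross_exists[OF fr(1)] by metis
qed

text \<open>
  Both frames are oriented by the same outer normal, so they differ by a rotation and not by a
  reflection. This is why the index does not depend on the frame.
\<close>

lemma tangent_frames_rotation:
  assumes "tangent_frame p e1 e2" "tangent_frame p e1' e2'"
  obtains \<alpha> where "e1' = rotate_frame \<alpha> e1 e2" "e2' = rotate_frame \<alpha> e2 (- e1)"
proof -
  note fr = tangent_frame_orthonormal[OF assms(1)] and fr' = tangent_frame_orthonormal[OF assms(2)]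
  define a b where "a = e1' \<bullet> e1" and "b = e1' \<bullet> e2"
  have e1': "e1' = a *\<^sub>R e1 + b *\<^sub>R e2"
    using fr(7)[of e1'] fr'(4) by (simp add: a_def b_def inner_commute)
  have "a\<^sup>2 + b\<^sup>2 = e1' \<bullet> e1'"
    unfolding e1' using fr(2,3,6)
    by (simp add: inner_add_left inner_add_right inner_commute power2_eq_square)
  then obtain \<alpha> where "a = cos \<alpha>" "b = sin \<alpha>"
    using sincos_total_2pi[of a b] fr'(2) by auto
  then have 1: "e1' = rotate_frame \<alpha> e1 e2"
    by (simp add: e1' rotate_frame_def)
  have "e2' = cross3 p e1'"
    using tangent_frame_cross[OF assms(2)] by simp
  also have "\<dots> = rotate_frame \<alpha> e2 (- e1)"
    by (simp add: 1 rotate_frame_def cross_add_right cross_mult_right tangent_frame_cross[OF assms(1)])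
  finally show ?thesis
    using that 1 by blast
qed

lemma continuous_on_frame_circle [continuous_intros]:
  fixes S :: "'a :: t2_space set"
  assumes "continuous_on S p" "continuous_on S e1" "continuous_on S e2" "continuous_on S s"
      "continuous_on S t"
  shows "continuous_on S (\<lambda>x. frame_circle (p x) (e1 x) (e2 x) (s x) (t x))"
  unfolding frame_circle_def
  by (intro continuous_intros assms)

lemma continuous_on_rotate_frame [continuous_intros]:
  fixes S :: "'a :: t2_space set"
  assumes "continuous_on S \<alpha>"
  shows "continuous_on S (\<lambda>x. rotate_frame (\<alpha> x) a b)"
  unfolding rotate_frame_def
  by (intro continuous_intros assms)

text \<open>
  The loop records the components of the gradient along the plane spanned by the frame at \<open>p\<close>, not
  along the tangent plane at the point \<open>x\<close> of the circle. A gradient with both components zero is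
  parallel to \<open>p\<close>; it is also orthogonal to \<open>x\<close>, and \<open>x \<bullet> p = cos s > 0\<close>.
\<close>

lemma gradient_loop_nonzero:
  assumes fr: "tangent_frame p e1 e2" and "0 < s" "s < pi / 2"
    and X: "\<And>u. u \<in> S2 \<Longrightarrow> has_sphere_gradient f u (X u)"
    and "X (frame_circle p e1 e2 s t) \<noteq> 0"
  shows "gradient_loop f p e1 e2 s t \<noteq> 0"
proof
  define x where "x = frame_circle p e1 e2 s t"
  assume "gradient_loop f p e1 e2 s t = 0"
  moreover have x: "x \<in> S2"
    unfolding x_def by (rule frame_circle_S2[OF fr])
  ultimately have "X x \<bullet> e1 = 0" "X x \<bullet> e2 = 0"
    using sphere_gradient_eqI[OF X[OF x]]
    by (auto simp: gradient_loop_alt Let_def x_def[symmetric] complex_eq_iff)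
  then have *: "X x = (X x \<bullet> p) *\<^sub>R p"
    using tangent_frame_orthonormal(7)[OF fr, of "X x"] by simp
  have "0 = X x \<bullet> x"
    using has_sphere_gradient_orthogonal[OF X[OF x]] by simp
  also have "\<dots> = (X x \<bullet> p) * cos s"
    by (subst *) (simp add: x_def frame_circle_inner[OF fr] inner_commute[of p])
  finally have "X x \<bullet> p = 0"
    using cos_gt_zero_pi[of s] assms(2,3) by auto
  then show False
    using * assms(5) by (simp add: x_def)
qed

text \<open>
  Rotate the first frame into the second one while moving the radius from \<open>s\<close> to \<open>s'\<close>. As long as the
  circles stay in a cap where \<open>p\<close> is the only zero, the loops in between avoid \<open>0\<close>.
\<close>

lemma homotopic_gradient_loops:
  assumes fr: "tangent_frame p e1 e2" and fr': "tangent_frame p e1' e2'"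
    and X: "\<And>u. u \<in> S2 \<Longrightarrow> has_sphere_gradient f u (X u)" and cont: "continuous_on S2 X"
    and s: "0 < s" "s \<le> r" "0 < s'" "s' \<le> r" and "r < pi / 2"
    and nz: "\<And>x. x \<in> S2 \<Longrightarrow> x \<noteq> p \<Longrightarrow> dist x p \<le> r \<Longrightarrow> X x \<noteq> 0"
  shows "homotopic_loops (-{0}) (gradient_loop f p e1 e2 s) (gradient_loop f p e1' e2' s')"
proof -
  obtain \<alpha> where \<alpha>: "e1' = rotate_frame \<alpha> e1 e2" "e2' = rotate_frame \<alpha> e2 (- e1)"
    using tangent_frames_rotation[OF fr fr'] .
  define a b \<sigma> where "a \<tau> = rotate_frame (\<tau> * \<alpha>) e1 e2" and "b \<tau> = rotate_frame (\<tau> * \<alpha>) e2 (- e1)"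
    and "\<sigma> \<tau> = (1 - \<tau>) * s + \<tau> * s'" for \<tau>
  have frs: "tangent_frame p (a \<tau>) (b \<tau>)" for \<tau>
    unfolding a_def b_def by (rule tangent_frame_rotate[OF fr])
  define x where "x z = frame_circle p (a (fst z)) (b (fst z)) (\<sigma> (fst z)) (snd z)" for z
  have xS: "x z \<in> S2" for z
    unfolding x_def by (rule frame_circle_S2[OF frs])
  define H where "H z = gradient_loop f p (a (fst z)) (b (fst z)) (\<sigma> (fst z)) (snd z)" for z
  have H: "H z = Complex (X (x z) \<bullet> a (fst z)) (X (x z) \<bullet> b (fst z))" for z
    using sphere_gradient_eqI[OF X[OF xS]] by (simp add: H_def gradient_loop_alt Let_def x_def)
  have contH: "continuous_on S H" for S
    unfolding H x_def a_def b_def \<sigma>_def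
    by (intro continuous_intros continuous_on_compose2[OF cont])
      (use frame_circle_S2[OF tangent_frame_rotate[OF fr]] in auto)
  have \<sigma>: "0 < \<sigma> \<tau>" "\<sigma> \<tau> \<le> r" if "\<tau> \<in> {0..1}" for \<tau>
  proof -
    have "min s s' \<le> \<sigma> \<tau>" "\<sigma> \<tau> \<le> max s s'"
      unfolding \<sigma>_def using that convex_bound_le[of s "max s s'" s' "1 - \<tau>" \<tau>]
        convex_bound_le[of "- s" "- min s s'" "- s'" "1 - \<tau>" \<tau>] by auto
    then show "0 < \<sigma> \<tau>" "\<sigma> \<tau> \<le> r"
      using s by auto
  qed
  have nzH: "H (\<tau>, t) \<noteq> 0" if "\<tau> \<in> {0..1}" for \<tau> t
    unfolding H_def
  proof (rule gradient_loop_nonzero[OF frs _ _ X])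
    have "x (\<tau>, t) \<bullet> p < 1"
      using \<sigma>[OF that] \<open>r < pi / 2\<close> cos_monotone_0_pi[of 0 "\<sigma> \<tau>"]
      by (simp add: x_def frame_circle_inner[OF frs])
    then have "x (\<tau>, t) \<noteq> p"
      using tangent_frame_orthonormal(1)[OF fr] by (auto simp: norm_eq_1)
    moreover have "dist (x (\<tau>, t)) p \<le> r"
      using frame_circle_dist[OF frs, of \<tau> "\<sigma> \<tau>" t] \<sigma>[OF that] by (simp add: x_def)
    ultimately show "X (frame_circle p (a (fst (\<tau>, t))) (b (fst (\<tau>, t))) (\<sigma> (fst (\<tau>, t))) (snd (\<tau>, t))) \<noteq> 0"
      using nz[OF xS[of "(\<tau>, t)"]] by (simp add: x_def)
  qed (use \<sigma>[OF that] \<open>r < pi / 2\<close> in auto)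
  show ?thesis
    unfolding homotopic_loops
  proof (intro exI[of _ H] conjI ballI)
    show "H \<in> {0..1} \<times> {0..1} \<rightarrow> - {0}"
      using nzH by auto
    show "pathfinish (H \<circ> Pair \<tau>) = pathstart (H \<circ> Pair \<tau>)" for \<tau>
      by (simp add: pathfinish_def pathstart_def H_def gradient_loop_def)
  qed (rule contH, simp_all add: H_def a_def b_def \<sigma>_def \<alpha> rotate_frame_def[of 0])
qed

text \<open>
  The winding number is the same for all frames and all radii up to \<open>r\<close>. The explicit radius matters
  when the function is perturbed: the perturbed index is then computed on a circle that does not shrink.
\<close>

lemma isolated_zero_has_index:
  assumes X: "\<And>u. u \<in> S2 \<Longrightarrow> has_sphere_gradient f u (X u)" and cont: "continuous_on S2 X"
    and p: "p \<in> critical_points f" and r: "0 < r" "r < pi / 2"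
    and nz: "\<And>x. x \<in> S2 \<Longrightarrow> x \<noteq> p \<Longrightarrow> dist x p \<le> r \<Longrightarrow> X x \<noteq> 0"
  obtains k where "has_index f p k"
    "\<And>e1 e2 s. tangent_frame p e1 e2 \<Longrightarrow> 0 < s \<Longrightarrow> s \<le> r \<Longrightarrow>
       winding_number (gradient_loop f p e1 e2 s) 0 = of_int k"
proof -
  have pS: "p \<in> S2"
    using p by (simp add: critical_points_def has_sphere_gradient_def)
  then obtain e1 e2 where fr: "tangent_frame p e1 e2"
    using tangent_frame_exists[of p] by auto
  have hom: "homotopic_loops (-{0}) (gradient_loop f p e1 e2 r) (gradient_loop f p e1' e2' s)"
    if "tangent_frame p e1' e2'" "0 < s" "s \<le> r" for e1' e2' s
    by (rule homotopic_gradient_loops[OF fr that(1) X cont r(1) order_refl that(2,3) r(2) nz])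
  have "homotopic_loops (-{0}) (gradient_loop f p e1 e2 r) (gradient_loop f p e1 e2 r)"
    using hom[OF fr r(1)] by blast
  then have "winding_number (gradient_loop f p e1 e2 r) 0 \<in> \<int>"
    using homotopic_loops_imp_path homotopic_loops_imp_loop homotopic_loops_imp_subset
    by (intro integer_winding_number) (blast+)
  then obtain k where k: "winding_number (gradient_loop f p e1 e2 r) 0 = of_int k"
    by (auto elim: Ints_cases)
  have wn: "winding_number (gradient_loop f p e1' e2' s) 0 = of_int k"
    if "tangent_frame p e1' e2'" "0 < s" "s \<le> r" for e1' e2' s
    using winding_number_homotopic_loops[OF hom[OF that]] k by simp
  have "p isolated_in critical_points f"
    unfolding isolated_in_dist_Ex_iff
  proof (intro conjI exI[of _ r] ballI impI)
    fix y assume y: "y \<in> critical_points f" "dist p y < r"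
    then have "y \<in> S2"
      by (simp add: critical_points_def has_sphere_gradient_def)
    then show "y = p"
      using y nz[of y] critical_points_iff[OF X] by (force simp: dist_commute)
  qed (use p r in auto)
  moreover have "\<forall>\<^sub>F s in at_right 0. s < r" "\<forall>\<^sub>F s in at_right (0::real). s > 0"
    using r by (auto intro: eventually_at_right_less order_tendstoD[OF tendsto_ident_at])
  then have "\<forall>\<^sub>F s in at_right 0. winding_number (gradient_loop f p e1' e2' s) 0 = of_int k"
    if "tangent_frame p e1' e2'" for e1' e2'
    by eventually_elim (use wn[OF that] in auto)
  ultimately have "has_index f p k"
    by (auto simp: has_index_def)
  with wn show ?thesis
    using that by blast
qed

text \<open>
  The gradient of \<open>\<psi> \<circ> f\<close> is a positive multiple of that of \<open>f\<close>, and the segment between the two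
  gradient loops avoids \<open>0\<close>.
\<close>

lemma has_index_increasing_comp:
  assumes X: "\<And>u. u \<in> S2 \<Longrightarrow> has_sphere_gradient f u (X u)" and cont: "continuous_on S2 X"
    and r: "\<And>v. v \<in> S2 \<Longrightarrow> r v = \<psi> (f v)"
    and \<psi>: "\<And>v. v \<in> S2 \<Longrightarrow> (\<psi> has_real_derivative c v) (at (f v))"
    and c: "\<And>v. v \<in> S2 \<Longrightarrow> c v > 0" "continuous_on S2 c"
    and k: "has_index f p k"
  shows "has_index r p k"
proof -
  have R: "has_sphere_gradient r u (c u *\<^sub>R X u)" if "u \<in> S2" for u
    by (rule has_sphere_gradient_comp[OF r \<psi>[OF that] X[OF that]])
  have crit: "critical_points r = critical_points f"
  proof -
    have "u \<in> critical_points r \<longleftrightarrow> u \<in> critical_points f" for u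
    proof (cases "u \<in> S2")
      case True
      then show ?thesis
        using critical_points_iff[OF R] critical_points_iff[OF X] c(1)[of u] by auto
    qed (simp add: critical_points_def has_sphere_gradient_def)
    then show ?thesis by blast
  qed
  from k have iso: "p isolated_in critical_points f"
    and wn: "\<And>e1 e2. tangent_frame p e1 e2 \<Longrightarrow>
      \<forall>\<^sub>F s in at_right 0. winding_number (gradient_loop f p e1 e2 s) 0 = of_int k"
    by (auto simp: has_index_def)
  have "p \<in> S2"
    using iso by (auto simp: isolated_in_def critical_points_def has_sphere_gradient_def)
  obtain d where d: "d > 0" "\<And>y. y \<in> critical_points f \<Longrightarrow> dist p y < d \<Longrightarrow> y = p"
    using iso by (auto simp: isolated_in_dist_Ex_iff)
  show ?thesis
    unfolding has_index_def crit
  proof (intro conjI allI impI iso)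
    fix e1 e2 assume fr: "tangent_frame p e1 e2"
    have "\<forall>\<^sub>F s in at_right 0. s < min d (pi / 2)"
      by (rule order_tendstoD[OF tendsto_ident_at]) (use d in auto)
    moreover have "\<forall>\<^sub>F s in at_right (0::real). s > 0"
      by (rule eventually_at_right_less)
    ultimately show "\<forall>\<^sub>F s in at_right 0. winding_number (gradient_loop r p e1 e2 s) 0 = of_int k"
      using wn[OF fr]
    proof eventually_elim
      fix s assume s: "s < min d (pi / 2)" "0 < s" and 1: "winding_number (gradient_loop f p e1 e2
          s) 0 = of_int k"
      define x where "x t = frame_circle p e1 e2 s t" for t
      have xS: "x t \<in> S2" for t
        unfolding x_def by (rule frame_circle_S2[OF fr])
      have contx: "continuous_on {0..1} x"
        unfolding x_def by (intro continuous_intros)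
      have f: "gradient_loop f p e1 e2 s t = Complex (X (x t) \<bullet> e1) (X (x t) \<bullet> e2)" for t
        using sphere_gradient_eqI[OF X[OF xS]] by (simp add: gradient_loop_alt Let_def x_def)
      have rl: "gradient_loop r p e1 e2 s t = c (x t) *\<^sub>R gradient_loop f p e1 e2 s t" for t
        unfolding f using sphere_gradient_eqI[OF R[OF xS]]
        by (simp add: gradient_loop_alt Let_def x_def complex_eq_iff)
      have path: "path (gradient_loop f p e1 e2 s)"
        unfolding path_def f
        by (intro continuous_intros continuous_on_compose2[OF cont contx]) (use xS in auto)
      have "path (gradient_loop r p e1 e2 s)"
        unfolding path_def rl using path
        by (intro continuous_intros continuous_on_compose2[OF c(2) contx]) (use xS in \<open>auto simp: path_def\<close>)
      moreover have "0 \<notin> closed_segment (gradient_loop f p e1 e2 s t) (gradient_loop r p e1 e2 s t)" for t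
      proof
        assume "0 \<in> closed_segment (gradient_loop f p e1 e2 s t) (gradient_loop r p e1 e2 s t)"
        then obtain u where u: "0 \<le> u" "u \<le> 1" "((1 - u) + u * c (x t)) *\<^sub>R gradient_loop f p e1 e2 s t = 0"
          by (auto simp: in_segment rl scaleR_add_left)
        have "x t \<bullet> p < 1"
          using s cos_monotone_0_pi[of 0 s] by (simp add: x_def frame_circle_inner[OF fr])
        then have "x t \<noteq> p"
          using tangent_frame_orthonormal(1)[OF fr] by (auto simp: norm_eq_1)
        moreover have "dist (x t) p < d"
          using frame_circle_dist[OF fr, of s t] s by (simp add: x_def)
        ultimately have "X (x t) \<noteq> 0"
          using d(2)[of "x t"] critical_points_iff[OF X[OF xS]] by (auto simp: dist_commute)
        then have "gradient_loop f p e1 e2 s t \<noteq> 0"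
          using s by (intro gradient_loop_nonzero[OF fr _ _ X]) (auto simp: x_def)
        moreover have "(1 - u) + u * c (x t) > 0"
          using u c(1)[OF xS, of t] by (cases "u = 1") (auto intro: add_pos_nonneg)
        ultimately show False
          using u(3) by simp
      qed
      ultimately have "winding_number (gradient_loop r p e1 e2 s) 0 =
          winding_number (gradient_loop f p e1 e2 s) 0"
        using path by (intro winding_number_loops_linear_eq)
          (simp_all add: pathfinish_def pathstart_def gradient_loop_def)
      with 1 show "winding_number (gradient_loop r p e1 e2 s) 0 = of_int k" by simp
    qed
  qed
qed

section \<open>Correspondences of critical points\<close>

lemma critical_points_S2: "critical_points f \<subseteq> S2"
  by (auto simp: critical_points_def has_sphere_gradient_def)

text \<open>
  The same information as \<^const>\<open>equilibrium_correspondence\<close>, for two arbitrary functions. It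
  determines the saddles, as the critical points that are neither minima nor maxima.
\<close>

definition critical_correspondence ::
    "(real^3 \<Rightarrow> real) \<Rightarrow> (real^3 \<Rightarrow> real) \<Rightarrow> (real^3 \<Rightarrow> real^3) \<Rightarrow> bool"
  where "critical_correspondence f r F \<longleftrightarrow>
    bij_betw F (critical_points f) (critical_points r) \<and>
    (\<forall>p\<in>critical_points f.
      (local_min f p \<longleftrightarrow> local_min r (F p)) \<and> (local_max f p \<longleftrightarrow> local_max r (F p)) \<and>
      (\<exists>k. has_index f p k \<and> has_index r (F p) k))"

lemma equilibrium_correspondenceI:
  assumes "critical_correspondence g (sq_dist g \<epsilon>) F"
  shows "equilibrium_correspondence g \<epsilon> F"
proof -
  have "F p \<in> equilibria g \<epsilon>" if "p \<in> critical_points g" for p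
    using assms that by (auto simp: critical_correspondence_def equilibria_def bij_betw_def)
  then show ?thesis
    using assms
    by (auto simp: critical_correspondence_def equilibrium_correspondence_def equilibria_def saddle_def
        stable_equilibrium_def unstable_equilibrium_def saddle_equilibrium_def)
qed

lemma local_extrema_order_cong:
  assumes "\<And>u v. u \<in> S2 \<Longrightarrow> v \<in> S2 \<Longrightarrow> r u \<le> r v \<longleftrightarrow> f u \<le> f v"
  shows "local_min r p \<longleftrightarrow> local_min f p" "local_max r p \<longleftrightarrow> local_max f p"
proof -
  have "(\<forall>\<^sub>F x in at p within S2. r p \<le> r x) \<longleftrightarrow> (\<forall>\<^sub>F x in at p within S2. f p \<le> f x)"
    "(\<forall>\<^sub>F x in at p within S2. r x \<le> r p) \<longleftrightarrow> (\<forall>\<^sub>F x in at p within S2. f x \<le> f p)" if "p \<in> S2"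
    unfolding eventually_at_filter using assms that by (auto intro!: eventually_cong)
  then show "local_min r p \<longleftrightarrow> local_min f p" "local_max r p \<longleftrightarrow> local_max f p"
    by (auto simp: local_min_def local_max_def)
qed

text \<open>
  The values of \<open>f\<close> are relabelled by a map \<open>\<psi>\<close> that has positive derivative and is increasing on
  the range of \<open>f\<close>. Nothing that a correspondence records changes.
\<close>

locale increasing_recalibration =
  fixes f r :: "real^3 \<Rightarrow> real" and X :: "real^3 \<Rightarrow> real^3" and \<psi> :: "real \<Rightarrow> real" and c :: "real^3 \<Rightarrow> real"
  assumes gradient: "\<And>u. u \<in> S2 \<Longrightarrow> has_sphere_gradient f u (X u)"
    and continuous_gradient: "continuous_on S2 X"
    and eq: "\<And>u. u \<in> S2 \<Longrightarrow> r u = \<psi> (f u)"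
    and deriv: "\<And>u. u \<in> S2 \<Longrightarrow> (\<psi> has_real_derivative c u) (at (f u))"
    and pos: "\<And>u. u \<in> S2 \<Longrightarrow> c u > 0"
    and continuous_deriv: "continuous_on S2 c"
    and order: "\<And>u v. u \<in> S2 \<Longrightarrow> v \<in> S2 \<Longrightarrow> \<psi> (f u) \<le> \<psi> (f v) \<longleftrightarrow> f u \<le> f v"
begin

lemma same_index: "has_index f p k \<Longrightarrow> has_index r p k"
  by (rule has_index_increasing_comp[OF gradient continuous_gradient eq deriv pos continuous_deriv])

lemma same_critical_points: "critical_points r = critical_points f"
proof -
  have "u \<in> critical_points r \<longleftrightarrow> u \<in> critical_points f" for u
  proof (cases "u \<in> S2")
    case True
    then show ?thesis
      using critical_points_iff[OF has_sphere_gradient_comp[OF eq deriv gradient], of u]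
        critical_points_iff[OF gradient, of u] pos[of u] by auto
  next
    case False
    then show ?thesis
      using critical_points_S2[of r] critical_points_S2[of f] by blast
  qed
  then show ?thesis by blast
qed

lemma same_extrema: "local_min r p \<longleftrightarrow> local_min f p" "local_max r p \<longleftrightarrow> local_max f p"
  by (rule local_extrema_order_cong; simp add: eq order)+

lemma correspondence_right:
  assumes "critical_correspondence h f F"
  shows "critical_correspondence h r F"
  using assms same_index unfolding critical_correspondence_def same_critical_points same_extrema by blast

lemma correspondence_left:
  assumes "critical_correspondence f h F"
  shows "critical_correspondence r h F"
  using assms same_index unfolding critical_correspondence_def same_critical_points same_extrema by blast

end

lemma finite_critical_points_has_index:
  assumes X: "\<And>u. u \<in> S2 \<Longrightarrow> has_sphere_gradient f u (X u)" and cont: "continuous_on S2 X"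
    and fin: "finite (critical_points f)" and p: "p \<in> critical_points f"
  shows "\<exists>k. has_index f p k"
proof -
  obtain d where d: "d > 0" "\<And>y. y \<in> critical_points f \<Longrightarrow> y \<noteq> p \<Longrightarrow> d \<le> dist p y"
    using finite_set_avoid[OF fin, of p] by blast
  show ?thesis
  proof (rule isolated_zero_has_index[OF X cont p])
    show "0 < min (d / 2) 1" "min (d / 2) 1 < pi / 2"
      using d pi_gt3 by auto
    show "X x \<noteq> 0" if "x \<in> S2" "x \<noteq> p" "dist x p \<le> min (d / 2) 1" for x
      using d(1) d(2)[of x] that critical_points_iff[OF X[OF that(1)]] by (auto simp: dist_commute)
  qed auto
qed

lemma critical_correspondence_refl:
  assumes "\<And>u. u \<in> S2 \<Longrightarrow> has_sphere_gradient f u (X u)" and "continuous_on S2 X"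
    and "finite (critical_points f)"
  shows "critical_correspondence f f id"
  using finite_critical_points_has_index[OF assms] by (auto simp: critical_correspondence_def)

section \<open>Persistence of nondegenerate zeros\<close>

text \<open>
  The tube lemma, in the form that gives uniformity below: an open condition
  that holds over a compact set persists for nearby parameters.
\<close>

lemma eventually_nhds_compact:
  assumes "open W" "compact K" "\<And>y. y \<in> K \<Longrightarrow> (a, y) \<in> W"
  shows "\<forall>\<^sub>F x in nhds a. \<forall>y\<in>K. (x, y) \<in> W"
proof -
  have "{a} \<times> K \<subseteq> W"
    using assms(3) by auto
  from Elementary_Topology.tube_lemma[OF assms(2,1) this]
  obtain V where "a \<in> V" "open V" "V \<times> K \<subseteq> W"
    by auto
  then show ?thesis
    unfolding eventually_nhds by (intro exI[of _ V]) auto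
qed

lemma eventually_nhds_prod_cball:
  fixes q :: "'q :: topological_space" and p :: "'u :: metric_space"
  assumes "\<forall>\<^sub>F z in nhds (q, p). P z"
  obtains d where "d > 0" "\<forall>\<^sub>F q' in nhds q. \<forall>u\<in>cball p d. P (q', u)"
proof -
  obtain S where S: "open S" "(q, p) \<in> S" "\<And>z. z \<in> S \<Longrightarrow> P z"
    using assms by (auto simp: eventually_nhds)
  obtain Q U where QU: "open Q" "open U" "(q, p) \<in> Q \<times> U" "Q \<times> U \<subseteq> S"
    using open_prod_elim[OF S(1,2)] by blast
  obtain d where "d > 0" "cball p d \<subseteq> U"
    using QU(2,3) by (auto simp: open_contains_cball)
  moreover have "\<forall>\<^sub>F q' in nhds q. q' \<in> Q"
    using QU by (auto intro: eventually_nhds_in_open)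
  ultimately show ?thesis
    using QU(4) S(3) by (intro that[of d]) (auto elim!: eventually_mono)
qed

text \<open>
  Newton's iteration with the derivative kept equal to \<open>L = D q0 p\<close>, that is \<open>u \<mapsto> u - L\<inverse> (Z q u)\<close>, is a
  contraction by \<open>1/2\<close> of every small ball around \<open>p\<close>, provided \<open>q\<close> is close to \<open>q0\<close>. Its fixed
  points are the zeros. Nothing is differentiated with respect to the parameter, so \<open>q\<close> may range
  over any topological space; and the ball is fixed before \<open>q\<close>, which gives a neighbourhood of
  uniqueness that does not depend on \<open>q\<close>.
\<close>

lemma nondegenerate_zero_persists:
  fixes Z :: "'q :: topological_space \<Rightarrow> 'u :: euclidean_space \<Rightarrow> 'u"
  assumes der: "\<And>q u. (Z q has_derivative D q u) (at u)"
    and contZ: "continuous_on UNIV (\<lambda>q. Z q p)"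
    and contD: "continuous_on UNIV (\<lambda>z. D (fst (fst z)) (snd (fst z)) (snd z))"
    and zero: "Z q0 p = 0" and inj: "\<And>h. D q0 p h = 0 \<Longrightarrow> h = 0"
  obtains d0 where "d0 > 0"
    "\<And>d. 0 < d \<Longrightarrow> d \<le> d0 \<Longrightarrow> \<forall>\<^sub>F q in nhds q0. \<exists>!u. u \<in> cball p d \<and> Z q u = 0"
proof -
  define L where "L = D q0 p"
  have linD: "linear (D q u)" for q u
    using der has_derivative_linear by blast
  have "inj L"
    using inj linear_injective_0[OF linD] by (auto simp: L_def)
  then obtain M where M: "linear M" "\<And>h. M (L h) = h" "\<And>h. L (M h) = h"
    using linear_injective_isomorphism[OF linD] unfolding L_def by blast
  have bM: "bounded_linear M"
    using M(1) linear_conv_bounded_linear by blast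
  obtain K where K: "K > 0" "\<And>h. norm (M h) \<le> norm h * K"
    using bounded_linear.pos_bounded[OF bM] by blast
  define T where "T q u = u - M (Z q u)" for q u
  have fix_iff: "T q u = u \<longleftrightarrow> Z q u = 0" for q u
  proof -
    have "M (Z q u) = 0 \<longleftrightarrow> Z q u = 0"
      using linear_0[OF M(1)] M(3)[of "Z q u"] linear_0[OF linD[of q0 p]] by (auto simp: L_def)
    then show ?thesis by (simp add: T_def)
  qed
  have "\<forall>\<^sub>F z in nhds (q0, p). \<forall>h\<in>sphere 0 1.
      (z, h) \<in> {w. norm (D (fst (fst w)) (snd (fst w)) (snd w) - L (snd w)) < 1 / (2 * K)}"
  proof (rule eventually_nhds_compact)
    have contL: "continuous_on UNIV (\<lambda>w. L (snd w))"
      using linD[of q0 p] unfolding L_def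
      by (intro bounded_linear.continuous_on[OF _ continuous_on_snd[OF continuous_on_id]])
        (simp add: linear_conv_bounded_linear)
    show "open {w. norm (D (fst (fst w)) (snd (fst w)) (snd w) - L (snd w)) < 1 / (2 * K)}"
      by (intro open_Collect_less continuous_intros contD contL)
  qed (use K in \<open>auto simp: L_def\<close>)
  then obtain d0 where d0: "d0 > 0" "\<forall>\<^sub>F q in nhds q0. \<forall>u\<in>cball p d0. \<forall>h\<in>sphere 0 1.
      norm (D q u h - L h) < 1 / (2 * K)"
    by (rule eventually_nhds_prod_cball) (simp only: mem_Collect_eq fst_conv snd_conv)
  show ?thesis
  proof (rule that[OF d0(1)])
    fix d assume d: "0 < d" "d \<le> d0"
    have "((\<lambda>q. Z q p) \<longlongrightarrow> Z q0 p) (nhds q0)"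
      using contZ by (simp add: continuous_on_def tendsto_nhds_iff)
    then have "\<forall>\<^sub>F q in nhds q0. norm (Z q p) < d / (2 * K)"
      using d K zero by (intro order_tendstoD[of _ "norm (Z q0 p)"] tendsto_norm) auto
    with d0(2) show "\<forall>\<^sub>F q in nhds q0. \<exists>!u. u \<in> cball p d \<and> Z q u = 0"
    proof eventually_elim
      fix q assume D: "\<forall>u\<in>cball p d0. \<forall>h\<in>sphere 0 1. norm (D q u h - L h) < 1 / (2 * K)"
        and small: "norm (Z q p) < d / (2 * K)"
      have lip: "norm (T q x - T q y) \<le> 1 / 2 * norm (x - y)" if "x \<in> cball p d" "y \<in> cball p d" for x y
      proof (rule differentiable_bound[of "cball p d" "T q" "\<lambda>u h. h - M (D q u h)"])
        fix u assume u: "u \<in> cball p d"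
        show "(T q has_derivative (\<lambda>h. h - M (D q u h))) (at u within cball p d)"
          unfolding T_def
          by (intro has_derivative_diff has_derivative_ident bounded_linear.has_derivative[OF bM]
              has_derivative_at_withinI[OF der])
        show "onorm (\<lambda>h. h - M (D q u h)) \<le> 1 / 2"
        proof (rule onorm_le)
          fix h
          show "norm (h - M (D q u h)) \<le> 1 / 2 * norm h"
          proof (cases "h = 0")
            case True
            then show ?thesis
              using M(1) linD[of q u] by (simp add: linear_0)
          next
            case False
            have "h - M (D q u h) = M (L h - D q u h)"
              using M by (simp add: linear_diff)
            also have "norm \<dots> \<le> norm (L h - D q u h) * K"
              by (rule K(2))
            also have "L h - D q u h = norm h *\<^sub>R (L (sgn h) - D q u (sgn h))"
              using False linD[of q u] linD[of q0 p]
              by (simp add: sgn_div_norm linear_scale L_def scaleR_diff_right)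
            also have "norm \<dots> * K = norm h * (norm (D q u (sgn h) - L (sgn h)) * K)"
              by (simp add: norm_minus_commute)
            also have "norm h * (norm (D q u (sgn h) - L (sgn h)) * K) \<le> norm h * (1 / 2)"
            proof (intro mult_left_mono norm_ge_zero)
              have "u \<in> cball p d0" "sgn h \<in> sphere 0 1"
                using u d False by (auto simp: norm_sgn)
              then have "norm (D q u (sgn h) - L (sgn h)) < 1 / (2 * K)"
                using D by blast
              then show "norm (D q u (sgn h) - L (sgn h)) * K \<le> 1 / 2"
                using K(1) by (simp add: field_simps)
            qed
            finally show ?thesis
              by simp
          qed
        qed
      qed (use that in auto)
      have "\<exists>!u. u \<in> cball p d \<and> T q u = u"
      proof (rule Banach_fix[of "cball p d" "1/2" "T q"])
        show "T q ` cball p d \<subseteq> cball p d"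
        proof (rule image_subsetI)
          fix u assume u: "u \<in> cball p d"
          have "norm (T q u - p) \<le> norm (T q u - T q p) + norm (T q p - p)"
            using norm_triangle_ineq[of "T q u - T q p" "T q p - p"] by simp
          also have "norm (T q u - T q p) \<le> d / 2"
            using lip[OF u, of p] u d by (auto simp: dist_norm norm_minus_commute)
          also have "norm (T q p - p) \<le> d / 2"
            using K(2)[of "Z q p"] small K(1) by (simp add: T_def field_simps)
          finally show "T q u \<in> cball p d"
            by (simp add: dist_norm norm_minus_commute)
        qed
        show "dist (T q x) (T q y) \<le> 1 / 2 * dist x y" if "x \<in> cball p d" "y \<in> cball p d" for x y
          using lip[OF that] by (simp add: dist_norm)
      qed (use d in \<open>simp_all add: complete_eq_closed\<close>)
      then show "\<exists>!u. u \<in> cball p d \<and> Z q u = 0"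
        by (simp add: fix_iff)
    qed
  qed
qed

section \<open>Families of functions on the sphere\<close>

text \<open>
  A family of functions on space, restricted to the sphere, with gradient \<open>G\<close> and second derivative
  \<open>A\<close> jointly continuous in the parameter and the point.
\<close>

locale sphere_family =
  fixes f :: "'q :: t2_space \<Rightarrow> real^3 \<Rightarrow> real" and G :: "'q \<Rightarrow> real^3 \<Rightarrow> real^3"
    and A :: "'q \<Rightarrow> real^3 \<Rightarrow> real^3 \<Rightarrow> real^3"
  assumes gradient: "\<And>q u. GDERIV (f q) u :> G q u"
    and hessian: "\<And>q u. (G q has_derivative A q u) (at u)"
    and hessian_symmetric: "\<And>q u h k. A q u h \<bullet> k = h \<bullet> A q u k"
    and continuous_gradient: "continuous_on UNIV (\<lambda>z. G (fst z) (snd z))"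
    and continuous_hessian: "continuous_on UNIV (\<lambda>z. A (fst (fst z)) (snd (fst z)) (snd z))"
begin

lemma linear_hessian: "linear (A q u)"
  using hessian has_derivative_linear by blast

lemma continuous_G [continuous_intros]:
  assumes "continuous_on S a" "continuous_on S b"
  shows "continuous_on S (\<lambda>x. G (a x) (b x))"
  using continuous_on_compose2[OF continuous_gradient continuous_on_Pair[OF assms]] by simp

lemma continuous_A [continuous_intros]:
  assumes "continuous_on S a" "continuous_on S b" "continuous_on S c"
  shows "continuous_on S (\<lambda>x. A (a x) (b x) (c x))"
  using continuous_on_compose2[OF continuous_hessian
      continuous_on_Pair[OF continuous_on_Pair[OF assms(1,2)] assms(3)]] by simp

definition tangential_grad :: "'q \<Rightarrow> real^3 \<Rightarrow> real^3"
  where "tangential_grad q u = G q u - (G q u \<bullet> u) *\<^sub>R u"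

lemma continuous_tangential_grad [continuous_intros]:
  assumes "continuous_on S a" "continuous_on S b"
  shows "continuous_on S (\<lambda>x. tangential_grad (a x) (b x))"
  unfolding tangential_grad_def using assms by (intro continuous_intros)

lemma sphere_gradient: "u \<in> S2 \<Longrightarrow> has_sphere_gradient (f q) u (tangential_grad q u)"
  unfolding tangential_grad_def by (rule has_sphere_gradient_restrict[OF _ _ gradient]) auto

lemma critical_iff: "u \<in> critical_points (f q) \<longleftrightarrow> u \<in> S2 \<and> tangential_grad q u = 0"
  using critical_points_iff[OF sphere_gradient] critical_points_S2 by blast

text \<open>
  On vectors tangent at \<open>u\<close> this is the Riemannian Hessian of the restriction to the sphere, the
  second derivative along great circles through \<open>u\<close>. The correction term is due to
  \<open>\<gamma>'' = - \<gamma>\<close> for a unit speed great circle \<open>\<gamma>\<close>.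
\<close>

definition hess_form :: "'q \<Rightarrow> real^3 \<Rightarrow> real^3 \<Rightarrow> real"
  where "hess_form q u h = A q u h \<bullet> h - (G q u \<bullet> u) * (h \<bullet> h)"

lemma continuous_hess_form [continuous_intros]:
  assumes "continuous_on S a" "continuous_on S b" "continuous_on S c"
  shows "continuous_on S (\<lambda>x. hess_form (a x) (b x) (c x))"
  unfolding hess_form_def using assms by (intro continuous_intros)

text \<open>
  Injectivity of the Hessian, as an endomorphism of the tangent plane at \<open>p\<close>: its value is only
  determined up to multiples of \<open>p\<close>.
\<close>

definition nondegenerate :: "'q \<Rightarrow> real^3 \<Rightarrow> bool"
  where "nondegenerate q p \<longleftrightarrow>
    (\<forall>h c. h \<bullet> p = 0 \<longrightarrow> A q p h - (G q p \<bullet> p) *\<^sub>R h = c *\<^sub>R p \<longrightarrow> h = 0)"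

text \<open>
  Statements about maxima follow from those about minima for the opposite family.
\<close>

lemma uminus_family: "sphere_family (\<lambda>q u. - f q u) (\<lambda>q u. - G q u) (\<lambda>q u h. - A q u h)"
proof
  show "GDERIV (\<lambda>u. - f q u) u :> - G q u" for q u
    using has_derivative_minus[OF gradient[unfolded gderiv_def]] by (simp add: gderiv_def)
qed (auto intro!: has_derivative_minus hessian continuous_intros simp: hessian_symmetric)

subsection \<open>Persistence of critical points\<close>

text \<open>
  A vector field on space whose zeros away from the origin are the critical points on the sphere.
  The first two terms are tangent to the spheres around \<open>0\<close> and reduce to the gradient on the unit
  sphere; the last one is radial and vanishes only on the unit sphere. In this form
  critical points are zeros of a map between spaces of equal dimension, without charts.
\<close>

definition lifted_field :: "'q \<Rightarrow> real^3 \<Rightarrow> real^3"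
  where "lifted_field q u = (u \<bullet> u) *\<^sub>R G q u - (G q u \<bullet> u) *\<^sub>R u + (u \<bullet> u - 1) *\<^sub>R u"

lemma lifted_field_zero_iff:
  assumes "u \<noteq> 0"
  shows "lifted_field q u = 0 \<longleftrightarrow> u \<in> critical_points (f q)"
proof
  assume 0: "lifted_field q u = 0"
  have "lifted_field q u \<bullet> u = (u \<bullet> u - 1) * (u \<bullet> u)"
    by (simp add: lifted_field_def inner_diff_left inner_add_left)
  then have "u \<bullet> u = 1"
    using 0 assms by simp
  then show "u \<in> critical_points (f q)"
    using 0 by (simp add: critical_iff lifted_field_def tangential_grad_def norm_eq_1)
qed (auto simp: critical_iff lifted_field_def tangential_grad_def norm_eq_1)

text \<open>
  At a critical point \<open>p\<close> the derivative of the lifted field acts on the tangent plane as the Hessian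
  and has the normal component \<open>2 p \<bullet> h\<close>, so it is injective exactly when the Hessian is.
\<close>

lemma critical_point_persists:
  assumes p: "p \<in> critical_points (f q0)" and nd: "nondegenerate q0 p"
  obtains d0 where "d0 > 0" "\<And>d. 0 < d \<Longrightarrow> d \<le> d0 \<Longrightarrow>
    \<forall>\<^sub>F q in nhds q0. \<exists>!u. u \<in> cball p d \<and> u \<in> critical_points (f q)"
proof -
  define D where "D q u h = (2 * (u \<bullet> h)) *\<^sub>R G q u + (u \<bullet> u) *\<^sub>R A q u h
    - (A q u h \<bullet> u + G q u \<bullet> h) *\<^sub>R u - (G q u \<bullet> u) *\<^sub>R h
    + (2 * (u \<bullet> h)) *\<^sub>R u + (u \<bullet> u - 1) *\<^sub>R h" for q u h
  have pp: "p \<bullet> p = 1" and Gp: "G q0 p = (G q0 p \<bullet> p) *\<^sub>R p"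
    using p by (auto simp: critical_iff tangential_grad_def norm_eq_1)
  obtain d0 where d0: "d0 > 0" "\<And>d. 0 < d \<Longrightarrow> d \<le> d0 \<Longrightarrow>
    \<forall>\<^sub>F q in nhds q0. \<exists>!u. u \<in> cball p d \<and> lifted_field q u = 0"
  proof (rule nondegenerate_zero_persists)
    show "(lifted_field q has_derivative D q u) (at u)" for q u
    proof -
      have "((\<lambda>u. (u \<bullet> u) *\<^sub>R G q u - (G q u \<bullet> u) *\<^sub>R u + (u \<bullet> u - 1) *\<^sub>R u) has_derivative D q u) (at u)"
        by (rule derivative_eq_intros hessian refl)+
          (simp add: D_def[abs_def] fun_eq_iff algebra_simps inner_commute)
      then show ?thesis
        by (simp add: lifted_field_def[abs_def])
    qed
    show "continuous_on UNIV (\<lambda>q. lifted_field q p)"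
      unfolding lifted_field_def by (intro continuous_intros)
    show "continuous_on UNIV (\<lambda>z. D (fst (fst z)) (snd (fst z)) (snd z))"
      unfolding D_def by (intro continuous_intros)
    show "lifted_field q0 p = 0"
      using p pp lifted_field_zero_iff[of p q0] by fastforce
    fix h assume D0: "D q0 p h = 0"
    have "D q0 p h \<bullet> p = 2 * (p \<bullet> h)"
      unfolding D_def
      by (subst (1 3) Gp) (simp add: inner_add_left inner_diff_left pp inner_commute algebra_simps)
    then have ph: "p \<bullet> h = 0"
      using D0 by simp
    moreover have "G q0 p \<bullet> h = 0"
      by (subst Gp) (simp add: ph)
    ultimately have "A q0 p h - (G q0 p \<bullet> p) *\<^sub>R h = (A q0 p h \<bullet> p) *\<^sub>R p"
      using D0 by (simp add: D_def pp algebra_simps)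
    then show "h = 0"
      using nd ph by (simp add: nondegenerate_def inner_commute)
  qed auto
  show ?thesis
  proof (rule that[of "min d0 (1 / 2)"])
    fix d assume d: "0 < d" "d \<le> min d0 (1 / 2)"
    have "u \<noteq> 0" if "u \<in> cball p d" for u
      using that d pp by (auto simp: norm_eq_1[symmetric])
    then have "(u \<in> cball p d \<and> lifted_field q u = 0) \<longleftrightarrow> (u \<in> cball p d \<and> u \<in> critical_points (f q))" for q u
      using lifted_field_zero_iff by blast
    then show "\<forall>\<^sub>F q in nhds q0. \<exists>!u. u \<in> cball p d \<and> u \<in> critical_points (f q)"
      using d0(2)[of d] d by simp
  qed (use d0 in auto)
qed

subsection \<open>Persistence of types\<close>

text \<open>
  Along the great circle the function has derivative \<open>0\<close> at the start and positive second derivative,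
  the latter by the description of \<open>hess_form\<close>.
\<close>

lemma above_along_great_circle:
  assumes x: "x \<in> critical_points (f q)" and v: "norm v = 1" "v \<bullet> x = 0" and "0 < s"
    and pos: "\<And>t. 0 < t \<Longrightarrow> t < s \<Longrightarrow>
      hess_form q (cos t *\<^sub>R x + sin t *\<^sub>R v) (cos t *\<^sub>R v - sin t *\<^sub>R x) > 0"
  shows "f q x < f q (cos s *\<^sub>R x + sin s *\<^sub>R v)"
proof -
  define \<gamma> \<gamma>' where "\<gamma> t = cos t *\<^sub>R x + sin t *\<^sub>R v" and "\<gamma>' t = cos t *\<^sub>R v - sin t *\<^sub>R x" for t
  have D\<gamma>: "(\<gamma> has_derivative (\<lambda>a. a *\<^sub>R \<gamma>' t)) (at t)" for t
    unfolding \<gamma>_def[abs_def] \<gamma>'_def by (auto intro!: derivative_eq_intros simp: algebra_simps)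
  have D\<gamma>': "(\<gamma>' has_derivative (\<lambda>a. a *\<^sub>R - \<gamma> t)) (at t)" for t
    unfolding \<gamma>'_def[abs_def] \<gamma>_def by (auto intro!: derivative_eq_intros simp: algebra_simps)
  have xx: "x \<bullet> x = 1" "v \<bullet> v = 1" and Gx: "G q x = (G q x \<bullet> x) *\<^sub>R x"
    using x v by (auto simp: critical_iff tangential_grad_def norm_eq_1)
  have \<gamma>': "\<gamma>' t \<bullet> \<gamma>' t = 1" for t
    using xx v(2) sin_cos_squared_add[of t]
    by (simp add: \<gamma>'_def inner_diff_left inner_diff_right inner_commute power2_eq_square)
  define k k' where "k t = f q (\<gamma> t)" and "k' t = G q (\<gamma> t) \<bullet> \<gamma>' t" for t
  have Dk: "(k has_real_derivative k' t) (at t)" for t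
  proof -
    have "(k has_derivative (\<lambda>a. (a *\<^sub>R \<gamma>' t) \<bullet> G q (\<gamma> t))) (at t)"
      unfolding k_def[abs_def]
      by (rule has_derivative_compose[OF D\<gamma>]) (use gradient in \<open>simp add: gderiv_def\<close>)
    then show ?thesis
      by (simp add: has_field_derivative_def k'_def inner_commute mult.commute[of _ "_ \<bullet> _"]
          mult_commute_abs)
  qed
  have Dk': "(k' has_real_derivative hess_form q (\<gamma> t) (\<gamma>' t)) (at t)" for t
  proof -
    have "(k' has_derivative (\<lambda>a. G q (\<gamma> t) \<bullet> (a *\<^sub>R - \<gamma> t) + A q (\<gamma> t) (a *\<^sub>R \<gamma>' t) \<bullet> \<gamma>' t)) (at t)"
      unfolding k'_def[abs_def]
      by (rule has_derivative_inner[OF has_derivative_compose[OF D\<gamma> hessian] D\<gamma>'])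
    moreover have "(\<lambda>a. G q (\<gamma> t) \<bullet> (a *\<^sub>R - \<gamma> t) + A q (\<gamma> t) (a *\<^sub>R \<gamma>' t) \<bullet> \<gamma>' t)
        = (*) (hess_form q (\<gamma> t) (\<gamma>' t))"
      by (simp add: fun_eq_iff hess_form_def \<gamma>' linear_scale[OF linear_hessian] algebra_simps)
    ultimately show ?thesis
      by (simp add: has_field_derivative_def)
  qed
  have cont: "continuous_on S k" "continuous_on S k'" for S
    using Dk Dk' by (meson DERIV_isCont continuous_at_imp_continuous_on)+
  have "k' 0 = 0"
    unfolding k'_def by (simp add: \<gamma>_def \<gamma>'_def) (subst Gx, simp add: v inner_commute)
  have k'pos: "k' t > 0" if "0 < t" "t < s" for t
  proof -
    have "k' 0 < k' t"
      using pos that by (intro DERIV_pos_imp_increasing_open[OF that(1)] cont)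
        (force simp: \<gamma>_def \<gamma>'_def intro!: Dk')
    then show ?thesis
      using \<open>k' 0 = 0\<close> by simp
  qed
  have "k 0 < k s"
    using k'pos by (intro DERIV_pos_imp_increasing_open[OF \<open>0 < s\<close>] cont) (use Dk in blast)
  then show ?thesis
    by (simp add: k_def \<gamma>_def)
qed

lemma great_circle_derivative_orthogonal:
  assumes "norm x = 1" "norm v = 1" "v \<bullet> x = 0"
  shows "cos t *\<^sub>R x + sin t *\<^sub>R v \<in> S2" "norm (cos t *\<^sub>R v - sin t *\<^sub>R x) = 1"
    "(cos t *\<^sub>R v - sin t *\<^sub>R x) \<bullet> (cos t *\<^sub>R x + sin t *\<^sub>R v) = 0"
  using assms sin_cos_squared_add[of t]
  by (simp_all add: norm_eq_1 inner_diff_left inner_diff_right inner_add_left inner_add_right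
      inner_commute power2_eq_square)

lemma hess_form_scale: "hess_form q u (c *\<^sub>R h) = c\<^sup>2 * hess_form q u h"
  by (simp add: hess_form_def linear_scale[OF linear_hessian] power2_eq_square algebra_simps)

lemma not_local_max:
  assumes x: "x \<in> critical_points (f q)" and h: "h \<bullet> x = 0" "hess_form q x h > 0"
  shows "\<not> local_max (f q) x"
proof
  assume max: "local_max (f q) x"
  have "h \<noteq> 0"
    using h(2) by (auto simp: hess_form_def)
  define v where "v = sgn h"
  have v: "norm v = 1" "v \<bullet> x = 0"
    using \<open>h \<noteq> 0\<close> h(1) by (auto simp: v_def norm_sgn sgn_div_norm)
  have x1: "norm x = 1"
    using x critical_iff by auto
  have "hess_form q x v > 0"
    using h(2) \<open>h \<noteq> 0\<close> by (simp add: v_def sgn_div_norm hess_form_scale)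
  define \<gamma> where "\<gamma> t = cos t *\<^sub>R x + sin t *\<^sub>R v" for t
  have "open {t. hess_form q (\<gamma> t) (cos t *\<^sub>R v - sin t *\<^sub>R x) > 0}"
    unfolding \<gamma>_def by (intro open_Collect_less continuous_intros)
  then have "\<forall>\<^sub>F t in nhds 0. hess_form q (\<gamma> t) (cos t *\<^sub>R v - sin t *\<^sub>R x) > 0"
    using \<open>hess_form q x v > 0\<close> eventually_nhds_in_open[of "{t. hess_form q (\<gamma> t) (cos t *\<^sub>R v - sin
        t *\<^sub>R x) > 0}" 0]
    by (simp add: \<gamma>_def)
  then obtain d where d: "d > 0" "\<And>t. \<bar>t\<bar> < d \<Longrightarrow> hess_form q (\<gamma> t) (cos t *\<^sub>R v - sin t *\<^sub>R x) > 0"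
    by (auto simp: eventually_nhds_metric dist_real_def)
  have "\<forall>\<^sub>F t in at_right 0. t < min d 1"
    by (rule order_tendstoD[OF tendsto_ident_at]) (use d in auto)
  moreover have "\<forall>\<^sub>F t in at_right (0::real). t > 0"
    by (rule eventually_at_right_less)
  ultimately have less: "\<forall>\<^sub>F t in at_right 0. f q x < f q (\<gamma> t)"
  proof eventually_elim
    case (elim t)
    then show ?case
      unfolding \<gamma>_def by (intro above_along_great_circle x v) (use d(2) in \<open>auto simp: \<gamma>_def\<close>)
  qed
  have "filterlim \<gamma> (at x within S2) (at_right 0)"
    unfolding filterlim_at
  proof (intro conjI)
    have "(\<gamma> \<longlongrightarrow> cos 0 *\<^sub>R x + sin 0 *\<^sub>R v) (at_right 0)"
      unfolding \<gamma>_def by (intro tendsto_intros)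
    then show "(\<gamma> \<longlongrightarrow> x) (at_right 0)" by simp
    show "\<forall>\<^sub>F t in at_right 0. \<gamma> t \<in> S2 \<and> \<gamma> t \<noteq> x"
      using less by eventually_elim
        (use great_circle_derivative_orthogonal(1)[OF x1 v] in \<open>auto simp: \<gamma>_def\<close>)
  qed
  then have "\<forall>\<^sub>F t in at_right 0. f q (\<gamma> t) \<le> f q x"
    using max by (auto simp: local_max_def filterlim_iff)
  with less have "\<forall>\<^sub>F t in at_right (0::real). False"
    by eventually_elim auto
  then show False
    by simp
qed

text \<open>
  Every point near \<open>x\<close> lies on a great circle that starts at \<open>x\<close>. Positivity is required in a whole
  neighbourhood, not just at \<open>x\<close>, as this is the condition that is stable under perturbation.
\<close>

lemma local_min_if_hess_form_pos:
  assumes x: "x \<in> critical_points (f q)"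
    and pos: "\<forall>\<^sub>F y in nhds x. \<forall>h\<in>sphere 0 1. h \<bullet> y = 0 \<longrightarrow> y \<in> S2 \<longrightarrow> hess_form q y h > 0"
  shows "local_min (f q) x"
proof -
  obtain d where d: "d > 0" "\<And>y h. dist y x < d \<Longrightarrow> norm h = 1 \<Longrightarrow> h \<bullet> y = 0 \<Longrightarrow> y \<in> S2 \<Longrightarrow> hess_form q y h > 0"
    using pos by (auto simp: eventually_nhds_metric)
  have x1: "norm x = 1" "x \<bullet> x = 1"
    using x critical_iff by (auto simp: norm_eq_1)
  have "f q x \<le> f q y" if y: "y \<in> S2" "y \<noteq> x" "dist y x < min d 1" for y
  proof -
    have yy: "y \<bullet> y = 1"
      using y by (simp add: norm_eq_1)
    define w where "w = y - (y \<bullet> x) *\<^sub>R x"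
    have wx: "w \<bullet> x = 0"
      by (simp add: w_def inner_diff_left x1)
    have yw: "y = (y \<bullet> x) *\<^sub>R x + w"
      by (simp add: w_def)
    have dist2: "(dist y x)\<^sup>2 = 2 - 2 * (y \<bullet> x)"
      by (simp add: dist_norm power2_norm_eq_inner inner_diff_left inner_diff_right inner_commute x1 yy)
    have "(dist y x)\<^sup>2 < 1"
      using y(3) by (simp add: abs_square_less_1)
    then have c: "0 < y \<bullet> x" using dist2 by simp
    have c1: "y \<bullet> x < 1"
    proof -
      have "(dist y x)\<^sup>2 > 0"
        using y(2) by simp
      then show ?thesis
        using dist2 by simp
    qed
    define s where "s = arccos (y \<bullet> x)"
    have coss: "cos s = y \<bullet> x"
      using c c1 by (simp add: s_def)
    have s: "0 < s" "s \<le> pi"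
      using c c1 arccos_lt_bounded[of "y \<bullet> x"] by (auto simp: s_def)
    have ww: "(norm w)\<^sup>2 = (sin s)\<^sup>2"
    proof -
      have "w \<bullet> w = 1 - (y \<bullet> x)\<^sup>2"
        by (simp add: w_def inner_diff_left inner_diff_right inner_commute x1 yy power2_eq_square)
      then show ?thesis
        by (simp add: power2_norm_eq_inner sin_squared_eq coss)
    qed
    have sins: "sin s > 0"
      using s coss c1 c sin_gt_zero[of s] by (cases "s = pi") auto
    have norm_w: "norm w = sin s"
      using power2_eq_iff_nonneg[of "norm w" "sin s"] ww sins by simp
    define v where "v = w /\<^sub>R sin s"
    have v: "norm v = 1" "v \<bullet> x = 0"
      using norm_w sins wx by (simp_all add: v_def)
    have yeq: "y = cos s *\<^sub>R x + sin s *\<^sub>R v"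
      using yw sins by (simp add: v_def coss)
    have "f q x < f q (cos s *\<^sub>R x + sin s *\<^sub>R v)"
    proof (rule above_along_great_circle[OF x v s(1)])
      fix t assume t: "0 < t" "t < s"
      define z where "z = cos t *\<^sub>R x + sin t *\<^sub>R v"
      have zS: "z \<in> S2"
        unfolding z_def by (rule great_circle_derivative_orthogonal(1)[OF x1(1) v])
      have "z \<bullet> x = cos t"
        using v by (simp add: z_def inner_add_left x1)
      then have "(dist z x)\<^sup>2 = 2 - 2 * cos t"
        using zS by (simp add: dist_norm power2_norm_eq_inner inner_diff_left inner_diff_right
            inner_commute x1 norm_eq_1)
      also have "\<dots> < 2 - 2 * cos s"
        using cos_monotone_0_pi[of t s] t s by simp
      also have "\<dots> = (dist y x)\<^sup>2"
        by (simp add: dist2 coss)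
      finally have "dist z x < d"
        using y(3) power_less_imp_less_base[of "dist z x" 2 "dist y x"] by simp
      then show "hess_form q (cos t *\<^sub>R x + sin t *\<^sub>R v) (cos t *\<^sub>R v - sin t *\<^sub>R x) > 0"
        using d(2)[of z "cos t *\<^sub>R v - sin t *\<^sub>R x"] zS great_circle_derivative_orthogonal[OF x1(1) v]
        by (simp add: z_def)
    qed
    then show ?thesis
      using yeq by simp
  qed
  then have "\<forall>\<^sub>F y in at x within S2. f q x \<le> f q y"
    unfolding eventually_at using d(1) by (intro exI[of _ "min d 1"]) auto
  then show ?thesis
    using x critical_iff by (auto simp: local_min_def)
qed


text \<open>
  A null vector of a semidefinite form lies in its kernel: otherwise moving from \<open>h\<close> a little against
  the direction \<open>v\<close> of its image makes the form negative.
\<close>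

lemma nondegenerate_semidefinite:
  assumes nd: "nondegenerate q p" and p: "p \<in> S2"
    and semi: "\<And>h. h \<bullet> p = 0 \<Longrightarrow> hess_form q p h \<ge> 0" and h: "h \<bullet> p = 0" "h \<noteq> 0"
  shows "hess_form q p h > 0"
proof (rule ccontr)
  assume "\<not> hess_form q p h > 0"
  then have H0: "hess_form q p h = 0"
    using semi[OF h(1)] by simp
  define \<mu> where "\<mu> = G q p \<bullet> p"
  define w where "w = A q p h - \<mu> *\<^sub>R h"
  define v where "v = w - (w \<bullet> p) *\<^sub>R p"
  have pp: "p \<bullet> p = 1"
    using p by (simp add: norm_eq_1)
  have vp: "v \<bullet> p = 0"
    by (simp add: v_def inner_diff_left pp)
  have wv: "w \<bullet> v = v \<bullet> v"
    using vp by (simp add: v_def inner_diff_left inner_diff_right inner_commute)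
  have expand: "hess_form q p (h + t *\<^sub>R v) = 2 * t * (v \<bullet> v) + t\<^sup>2 * hess_form q p v" for t
  proof -
    have "hess_form q p (h + t *\<^sub>R v) = hess_form q p h + 2 * t * (w \<bullet> v) + t\<^sup>2 * hess_form q p v"
      using hessian_symmetric[of q p v h]
      by (simp add: hess_form_def w_def \<mu>_def linear_add[OF linear_hessian] linear_scale[OF linear_hessian]
          inner_add_left inner_add_right inner_diff_left inner_commute power2_eq_square algebra_simps)
    then show ?thesis
      by (simp add: H0 wv)
  qed
  have "v = 0"
  proof (rule ccontr)
    assume "v \<noteq> 0"
    then have vv: "v \<bullet> v > 0" by simp
    \<comment> \<open>small enough for the linear term in \<open>t\<close> to dominate the quadratic one\<close>
    define t where "t = (v \<bullet> v) / (1 + hess_form q p v)"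
    have Hv: "hess_form q p v \<ge> 0"
      using semi[OF vp] .
    have t: "t > 0" "t * (1 + hess_form q p v) = v \<bullet> v"
      using vv Hv by (auto simp: t_def)
    have "0 \<le> hess_form q p (h + (- t) *\<^sub>R v)"
      using h vp by (intro semi) (simp add: inner_add_left inner_diff_left)
    also have "\<dots> = - 2 * t * (t * (1 + hess_form q p v)) + t\<^sup>2 * hess_form q p v"
      unfolding expand t(2) by simp
    also have "\<dots> = - (t\<^sup>2 * (2 + hess_form q p v))"
      by (simp add: power2_eq_square algebra_simps)
    also have "\<dots> < 0"
      using t Hv by simp
    finally show False by simp
  qed
  then have "A q p h - (G q p \<bullet> p) *\<^sub>R h = (w \<bullet> p) *\<^sub>R p"
    by (simp add: v_def w_def \<mu>_def)
  then show False
    using nd h by (auto simp: nondegenerate_def)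
qed

lemma hess_form_pos_nearby:
  assumes "\<And>h. norm h = 1 \<Longrightarrow> h \<bullet> p = 0 \<Longrightarrow> hess_form q0 p h > 0"
  shows "\<forall>\<^sub>F z in nhds (q0, p). \<forall>\<^sub>F y in nhds (snd z). \<forall>h\<in>sphere 0 1. h \<bullet> y = 0 \<longrightarrow> y \<in> S2 \<longrightarrow>
      hess_form (fst z) y h > 0"
proof -
  have "\<forall>\<^sub>F z in nhds (q0, p). \<forall>h\<in>sphere 0 1.
      (z, h) \<in> {w. snd w \<bullet> snd (fst w) \<noteq> 0} \<union> {w. hess_form (fst (fst w)) (snd (fst w)) (snd w) > 0}"
    by (intro eventually_nhds_compact open_Un open_Collect_neq open_Collect_less continuous_intros)
      (use assms in auto)
  then have "\<forall>\<^sub>F z in nhds (q0, p). \<forall>\<^sub>F z' in nhds z. \<forall>h\<in>sphere 0 1. h \<bullet> snd z' = 0 \<longrightarrow>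
      hess_form (fst z') (snd z') h > 0"
    unfolding eventually_eventually by (rule eventually_mono) auto
  then show ?thesis
  proof (rule eventually_mono)
    fix z assume ev: "\<forall>\<^sub>F z' in nhds z. \<forall>h\<in>sphere 0 1. h \<bullet> snd z' = 0 \<longrightarrow> hess_form (fst z') (snd z') h > 0"
    have "filterlim (\<lambda>y. (fst z, y)) (nhds z) (nhds (snd z))"
      using tendsto_Pair[OF tendsto_const[of "fst z"] filterlim_ident[of "nhds (snd z)"]] by simp
    from this[unfolded filterlim_iff, rule_format, OF ev]
    have "\<forall>\<^sub>F y in nhds (snd z). \<forall>h\<in>sphere 0 1. h \<bullet> snd (fst z, y) = 0 \<longrightarrow> hess_form (fst (fst z,
        y)) (snd (fst z, y)) h > 0" .
    then show "\<forall>\<^sub>F y in nhds (snd z). \<forall>h\<in>sphere 0 1. h \<bullet> y = 0 \<longrightarrow> y \<in> S2 \<longrightarrow> hess_form (fst z) y h > 0"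
      by (auto elim: eventually_mono)
  qed
qed

lemma local_max_excluded_nearby:
  assumes "h \<bullet> p = 0" "hess_form q0 p h > 0"
  shows "\<forall>\<^sub>F z in nhds (q0, p). snd z \<in> critical_points (f (fst z)) \<longrightarrow> \<not> local_max (f (fst z)) (snd z)"
proof -
  have "open {z. hess_form (fst z) (snd z) (h - (h \<bullet> snd z) *\<^sub>R snd z) > 0}"
    by (intro open_Collect_less continuous_intros)
  then have "\<forall>\<^sub>F z in nhds (q0, p). hess_form (fst z) (snd z) (h - (h \<bullet> snd z) *\<^sub>R snd z) > 0"
    using assms eventually_nhds_in_open[of "{z. hess_form (fst z) (snd z) (h - (h \<bullet> snd z) *\<^sub>R snd
        z) > 0}" "(q0, p)"]
    by simp
  then show ?thesis
  proof (rule eventually_mono, intro impI)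
    fix z assume *: "hess_form (fst z) (snd z) (h - (h \<bullet> snd z) *\<^sub>R snd z) > 0" and z: "snd z \<in>
        critical_points (f (fst z))"
    have "snd z \<bullet> snd z = 1"
      using z by (simp add: critical_iff norm_eq_1)
    then show "\<not> local_max (f (fst z)) (snd z)"
      using * by (intro not_local_max[OF z, of "h - (h \<bullet> snd z) *\<^sub>R snd z"]) (auto simp: inner_diff_left)
  qed
qed

definition same_type :: "'q \<Rightarrow> real^3 \<Rightarrow> 'q \<Rightarrow> real^3 \<Rightarrow> bool"
  where "same_type q x q' x' \<longleftrightarrow>
    (local_min (f q) x \<longleftrightarrow> local_min (f q') x') \<and> (local_max (f q) x \<longleftrightarrow> local_max (f q') x')"

lemma type_of_minimum_persists:
  assumes p: "p \<in> critical_points (f q0)"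
    and pos: "\<And>h. norm h = 1 \<Longrightarrow> h \<bullet> p = 0 \<Longrightarrow> hess_form q0 p h > 0"
  shows "\<forall>\<^sub>F z in nhds (q0, p). snd z \<in> critical_points (f (fst z)) \<longrightarrow>
    local_min (f (fst z)) (snd z) \<and> \<not> local_max (f (fst z)) (snd z)"
proof -
  obtain e1 e2 where "tangent_frame p e1 e2"
    by (rule tangent_frame_exists[of p]) (use p critical_iff in auto)
  from tangent_frame_orthonormal[OF this] have "norm e1 = 1" "e1 \<bullet> p = 0"
    by (auto simp: norm_eq_1 inner_commute)
  then have "\<forall>\<^sub>F z in nhds (q0, p). snd z \<in> critical_points (f (fst z)) \<longrightarrow> \<not> local_max (f (fst z)) (snd z)"
    using pos by (intro local_max_excluded_nearby[of e1])
  moreover have "\<forall>\<^sub>F z in nhds (q0, p). \<forall>\<^sub>F y in nhds (snd z).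
      \<forall>h\<in>sphere 0 1. h \<bullet> y = 0 \<longrightarrow> y \<in> S2 \<longrightarrow> hess_form (fst z) y h > 0"
    by (rule hess_form_pos_nearby) (rule pos)
  ultimately show ?thesis
    by eventually_elim (use local_min_if_hess_form_pos in blast)
qed

text \<open>
  By nondegeneracy the Hessian at \<open>p\<close> is positive definite, negative definite or takes both signs.
  Each alternative is an open condition that determines the type.
\<close>

lemma type_persists:
  assumes p: "p \<in> critical_points (f q0)" and nd: "nondegenerate q0 p"
  shows "\<forall>\<^sub>F z in nhds (q0, p). snd z \<in> critical_points (f (fst z)) \<longrightarrow> same_type q0 p (fst z) (snd z)"
proof -
  interpret neg: sphere_family "\<lambda>q u. - f q u" "\<lambda>q u. - G q u" "\<lambda>q u h. - A q u h"
    by (rule uminus_family)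
  have neg_hess_form: "neg.hess_form q u h = - hess_form q u h" for q u h
    by (simp add: hess_form_def neg.hess_form_def)
  have negcrit: "critical_points (\<lambda>u. - f q u) = critical_points (f q)" for q
    by (auto simp: critical_iff neg.critical_iff tangential_grad_def neg.tangential_grad_def)
  have negext: "local_min (\<lambda>u. - f q u) x = local_max (f q) x"
    "local_max (\<lambda>u. - f q u) x = local_min (f q) x" for q x
    by (simp_all add: local_max_def local_min_def)
  have negnd: "neg.nondegenerate q0 p"
    unfolding neg.nondegenerate_def
  proof (intro allI impI)
    fix h c assume "h \<bullet> p = 0" "- A q0 p h - (- G q0 p \<bullet> p) *\<^sub>R h = c *\<^sub>R p"
    then have "h \<bullet> p = 0" "A q0 p h - (G q0 p \<bullet> p) *\<^sub>R h = (- c) *\<^sub>R p"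
      by (auto simp: algebra_simps)
    then show "h = 0"
      using nd unfolding nondegenerate_def by blast
  qed
  have pS: "p \<in> S2"
    using p critical_iff by blast
  consider (pos) "\<forall>h. norm h = 1 \<longrightarrow> h \<bullet> p = 0 \<longrightarrow> hess_form q0 p h > 0"
    | (neg) "\<forall>h. norm h = 1 \<longrightarrow> h \<bullet> p = 0 \<longrightarrow> hess_form q0 p h < 0"
    | (indef) h h' where "h \<bullet> p = 0" "hess_form q0 p h > 0" "h' \<bullet> p = 0" "hess_form q0 p h' < 0"
  proof (cases "\<exists>h. h \<bullet> p = 0 \<and> hess_form q0 p h < 0")
    case False
    then have "hess_form q0 p h > 0" if "norm h = 1" "h \<bullet> p = 0" for h
      using that by (intro nondegenerate_semidefinite[OF nd pS]) (auto simp: not_less)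
    then show ?thesis using that by blast
  next
    case True
    show ?thesis
    proof (cases "\<exists>h. h \<bullet> p = 0 \<and> hess_form q0 p h > 0")
      case False
      then have "neg.hess_form q0 p h > 0" if "norm h = 1" "h \<bullet> p = 0" for h
        using that by (intro neg.nondegenerate_semidefinite[OF negnd pS]) (auto simp: not_less
            neg_hess_form)
      then show ?thesis using that by (simp add: neg_hess_form)
    qed (use True that in blast)
  qed
  then show ?thesis
  proof cases
    case pos
    then have "\<forall>\<^sub>F z in nhds (q0, p). snd z \<in> critical_points (f (fst z)) \<longrightarrow>
        local_min (f (fst z)) (snd z) \<and> \<not> local_max (f (fst z)) (snd z)"
      by (intro type_of_minimum_persists p) auto
    from this eventually_nhds_x_imp_x[OF this] show ?thesis
      using p by (auto simp: same_type_def elim: eventually_mono)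
  next
    case neg
    then have "\<forall>\<^sub>F z in nhds (q0, p). snd z \<in> critical_points (\<lambda>u. - f (fst z) u) \<longrightarrow>
        local_min (\<lambda>u. - f (fst z) u) (snd z) \<and> \<not> local_max (\<lambda>u. - f (fst z) u) (snd z)"
      using p by (intro neg.type_of_minimum_persists) (auto simp: neg_hess_form negcrit)
    from this eventually_nhds_x_imp_x[OF this] show ?thesis
      using p by (auto simp: same_type_def negext negcrit elim: eventually_mono)
  next
    case indef
    have "\<forall>\<^sub>F z in nhds (q0, p). snd z \<in> critical_points (f (fst z)) \<longrightarrow> \<not> local_max (f (fst z)) (snd z)"
      using indef(1,2) by (rule local_max_excluded_nearby)
    moreover have "\<forall>\<^sub>F z in nhds (q0, p). snd z \<in> critical_points (\<lambda>u. - f (fst z) u) \<longrightarrow>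
        \<not> local_max (\<lambda>u. - f (fst z) u) (snd z)"
      using indef(3,4) by (intro neg.local_max_excluded_nearby[of h']) (auto simp: neg_hess_form)
    ultimately have "\<forall>\<^sub>F z in nhds (q0, p). snd z \<in> critical_points (f (fst z)) \<longrightarrow>
        \<not> local_max (f (fst z)) (snd z) \<and> \<not> local_min (f (fst z)) (snd z)"
      by eventually_elim (simp add: negext negcrit)
    from this eventually_nhds_x_imp_x[OF this] show ?thesis
      using p by (auto simp: same_type_def elim: eventually_mono)
  qed
qed

subsection \<open>Persistence of indices\<close>

text \<open>
  The index of a perturbed critical point \<open>u\<close> is computed along the circle of the fixed radius
  \<open>d / 2\<close> around \<open>u\<close>, in a frame at \<open>u\<close> that depends continuously on \<open>u\<close>. As \<open>(q, u)\<close> tends to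
  \<open>(q0, p)\<close> these loops converge uniformly to the loop for \<open>p\<close>, and close loops have equal winding
  numbers. If \<open>u\<close> lies within \<open>d / 2\<close> of \<open>p\<close>, the circle stays in \<open>cball p d\<close>, where \<open>u\<close> is the only
  critical point by assumption.
\<close>

lemma index_persists:
  assumes p: "p \<in> critical_points (f q0)" and d: "0 < d" "d \<le> 1"
    and unique: "\<And>y. y \<in> critical_points (f q0) \<Longrightarrow> y \<in> cball p d \<Longrightarrow> y = p"
  obtains k where "has_index (f q0) p k"
    "\<forall>\<^sub>F z in nhds (q0, p). snd z \<in> critical_points (f (fst z)) \<longrightarrow>
      (\<forall>y\<in>critical_points (f (fst z)). y \<in> cball p d \<longrightarrow> y = snd z) \<longrightarrow>
      has_index (f (fst z)) (snd z) k"
proof -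
  define s where "s = d / 2"
  have s: "0 < s" "s < pi / 2"
    using d pi_gt3 by (auto simp: s_def)
  have cX: "continuous_on S2 (tangential_grad q)" for q
    by (intro continuous_intros)
  have p1: "norm p = 1" "p \<bullet> p = 1"
    using p critical_iff by (auto simp: norm_eq_1)
  obtain k where k: "has_index (f q0) p k"
    "\<And>e1 e2 t. tangent_frame p e1 e2 \<Longrightarrow> 0 < t \<Longrightarrow> t \<le> s \<Longrightarrow>
       winding_number (gradient_loop (f q0) p e1 e2 t) 0 = of_int k"
  proof (rule isolated_zero_has_index[OF sphere_gradient cX p s])
    show "tangential_grad q0 x \<noteq> 0" if "x \<in> S2" "x \<noteq> p" "dist x p \<le> s" for x
      using unique[of x] that critical_iff[of x q0] d by (auto simp: s_def dist_commute)
  qed auto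
  obtain e e' where fr: "tangent_frame p e e'"
    using tangent_frame_exists[OF p1(1)] .
  from tangent_frame_orthonormal[OF this] have e: "norm e = 1" "e \<bullet> p = 0" "e \<bullet> e = 1"
    by (auto simp: norm_eq_1 inner_commute)
  \<comment> \<open>the frame at \<open>u\<close> comes from projecting \<open>e\<close> to the tangent plane at \<open>u\<close>\<close>
  define w where "w u = e - (e \<bullet> u) *\<^sub>R u" for u
  define E1 E2 where "E1 u = sgn (w u)" and "E2 u = cross3 u (E1 u)" for u
  have E: "E1 p = e" "E2 p = e'"
    using e tangent_frame_cross[OF fr] by (simp_all add: E1_def E2_def w_def sgn_div_norm)
  have frame: "tangent_frame u (E1 u) (E2 u)" if "norm u = 1" "w u \<noteq> 0" for u
    unfolding E2_def
  proof (rule tangent_frame_cross_exists[OF that(1)])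
    show "norm (E1 u) = 1"
      using that by (simp add: E1_def norm_sgn)
    have "u \<bullet> u = 1"
      using that by (simp add: norm_eq_1)
    then show "u \<bullet> E1 u = 0"
      by (simp add: E1_def sgn_div_norm w_def inner_diff_right inner_commute)
  qed
  define x where "x u t = frame_circle u (E1 u) (E2 u) s t" for u t
  define L where "L q u t = Complex (tangential_grad q (x u t) \<bullet> E1 u) (tangential_grad q (x u t) \<bullet>
      E2 u)" for q u t
  have loop: "gradient_loop (f q) u (E1 u) (E2 u) s = L q u" if "norm u = 1" "w u \<noteq> 0" for q u
  proof
    fix t
    have "x u t \<in> S2"
      unfolding x_def by (rule frame_circle_S2[OF frame[OF that]])
    then show "gradient_loop (f q) u (E1 u) (E2 u) s t = L q u t"
      using sphere_gradient_eqI[OF sphere_gradient] by (simp add: gradient_loop_alt Let_def x_def L_def)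
  qed
  have wp: "w p \<noteq> 0"
    using e by (auto simp: w_def)
  define R :: "(('q \<times> (real^3)) \<times> real) set" where "R = {z. w (snd (fst z)) \<noteq> 0}"
  have openR: "open R"
    unfolding R_def w_def by (intro open_Collect_neq continuous_intros)
  have contL: "continuous_on R (\<lambda>z. L (fst (fst z)) (snd (fst z)) (snd z))"
    unfolding L_def x_def E2_def E1_def w_def
    by (intro continuous_intros continuous_on_cross) (auto simp: R_def w_def)
  have contL0: "continuous_on S (L q u)" if "norm u = 1" "w u \<noteq> 0" for S q u
    unfolding L_def x_def by (intro continuous_intros)
  have nz: "L q0 p t \<noteq> 0" for t
    unfolding loop[OF p1(1) wp, symmetric]
  proof (rule gradient_loop_nonzero[OF frame[OF p1(1) wp] s sphere_gradient])
    note c = frame_circle_S2[OF frame[OF p1(1) wp], of s t]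
      frame_circle_dist[OF frame[OF p1(1) wp], of s t] frame_circle_inner[OF frame[OF p1(1) wp], of s t]
    have "cos s < 1"
      using cos_monotone_0_pi[of 0 s] s by simp
    then have "frame_circle p (E1 p) (E2 p) s t \<noteq> p"
      using c(3) p1 by auto
    then show "tangential_grad q0 (frame_circle p (E1 p) (E2 p) s t) \<noteq> 0"
      using unique[of "frame_circle p (E1 p) (E2 p) s t"] c(1,2) s d critical_iff[of "frame_circle p
          (E1 p) (E2 p) s t" q0]
      by (auto simp: dist_commute s_def)
  qed auto
  define W where "W = {z \<in> R. norm (L (fst (fst z)) (snd (fst z)) (snd z) - L q0 p (snd z)) < norm
      (L q0 p (snd z))}"
  have "open W"
  proof -
    have c0: "continuous_on R (\<lambda>z. L q0 p (snd z))"
      using contL0[OF p1(1) wp, of UNIV q0] by (rule continuous_on_compose2) (auto intro!: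
          continuous_intros)
    have "open (R \<inter> (\<lambda>z. norm (L q0 p (snd z)) - norm (L (fst (fst z)) (snd (fst z)) (snd z) - L q0
        p (snd z))) -` {0<..})"
      by (rule continuous_open_preimage[OF _ openR]) (intro continuous_intros contL c0, simp)
    moreover have "R \<inter> (\<lambda>z. norm (L q0 p (snd z)) - norm (L (fst (fst z)) (snd (fst z)) (snd z) - L
        q0 p (snd z))) -` {0<..} = W"
      by (auto simp: W_def)
    ultimately show ?thesis
      by simp
  qed
  then have "\<forall>\<^sub>F z in nhds (q0, p). \<forall>t\<in>{0..1}. (z, t) \<in> W"
    using nz wp by (intro eventually_nhds_compact) (auto simp: W_def R_def)
  moreover have "\<forall>\<^sub>F z in nhds (q0, p). snd z \<in> ball p (d / 2)"
  proof -
    have "filterlim snd (nhds p) (nhds (q0, p))"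
      using tendsto_snd[OF filterlim_ident[of "nhds (q0, p)"]] by simp
    from this[unfolded filterlim_iff, rule_format, OF eventually_nhds_in_open[of "ball p (d / 2)"]]
    show ?thesis
      using d by simp
  qed
  ultimately have "\<forall>\<^sub>F z in nhds (q0, p). snd z \<in> critical_points (f (fst z)) \<longrightarrow>
      (\<forall>y\<in>critical_points (f (fst z)). y \<in> cball p d \<longrightarrow> y = snd z) \<longrightarrow>
      has_index (f (fst z)) (snd z) k"
  proof eventually_elim
    case (elim z)
    show ?case
    proof (intro impI)
      obtain q u where z: "z = (q, u)" by (cases z)
      assume u: "snd z \<in> critical_points (f (fst z))"
        and uniq: "\<forall>y\<in>critical_points (f (fst z)). y \<in> cball p d \<longrightarrow> y = snd z"
      have u1: "norm u = 1"
        using u critical_iff z by auto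
      have wu: "w u \<noteq> 0"
        using bspec[OF elim(1), of 0] by (simp add: z W_def R_def)
      have uz: "u \<in> critical_points (f q)" using u z by simp
      obtain k' where k': "has_index (f q) u k'"
        "\<And>e1 e2 t. tangent_frame u e1 e2 \<Longrightarrow> 0 < t \<Longrightarrow> t \<le> s \<Longrightarrow>
           winding_number (gradient_loop (f q) u e1 e2 t) 0 = of_int k'"
      proof (rule isolated_zero_has_index[OF sphere_gradient cX uz s])
        show "tangential_grad q x \<noteq> 0" if "x \<in> S2" "x \<noteq> u" "dist x u \<le> s" for x
        proof
          assume "tangential_grad q x = 0"
          then have "x \<in> critical_points (f q)"
            using that critical_iff by blast
          moreover have "dist p x \<le> d"
            using that(3) elim(2) dist_triangle[of p x u] by (auto simp: z s_def dist_commute)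
          ultimately show False
            using uniq that(2) z by auto
        qed
      qed auto
      have "winding_number (L q u) 0 = winding_number (L q0 p) 0"
      proof (rule winding_number_nearby_loops_eq)
        show "path (L q0 p)" "path (L q u)"
          unfolding path_def by (intro contL0 p1 wp u1 wu)+
        show "pathfinish (L q0 p) = pathstart (L q0 p)" "pathfinish (L q u) = pathstart (L q u)"
          by (simp_all add: pathfinish_def pathstart_def L_def x_def frame_circle_def)
        show "norm (L q u t - L q0 p t) < norm (L q0 p t - 0)" if "t \<in> {0..1}" for t
          using elim(1) that by (auto simp: W_def z)
      qed
      then have "complex_of_int k' = of_int k"
        using k'(2)[OF frame[OF u1 wu] s(1)] k(2)[OF frame[OF p1(1) wp] s(1)]
        by (simp add: loop[OF u1 wu] loop[OF p1(1) wp])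
      then show "has_index (f (fst z)) (snd z) k"
        using k'(1) by (simp add: z)
    qed
  qed
  with k(1) show ?thesis
    by (rule that)
qed

subsection \<open>The correspondence\<close>

definition unique_partner :: "'q \<Rightarrow> real^3 \<Rightarrow> real \<Rightarrow> 'q \<Rightarrow> real^3 \<Rightarrow> bool"
  where "unique_partner q0 p d q u \<longleftrightarrow> u \<in> cball p d \<and> u \<in> critical_points (f q) \<and>
      (\<forall>y\<in>critical_points (f q). y \<in> cball p d \<longrightarrow> y = u) \<and>
      same_type q0 p q u \<and> (\<exists>k. has_index (f q0) p k \<and> has_index (f q) u k)"

text \<open>
  Uniqueness holds in two concentric balls, the given one and a smaller one in which type and index
  are known to persist; so the critical point in the given ball is the one in the smaller ball.
\<close>

lemma local_correspondence:
  assumes p: "p \<in> critical_points (f q0)" and nd: "nondegenerate q0 p"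
  shows "\<exists>d0. d0 > 0 \<and> (\<forall>d. 0 < d \<longrightarrow> d \<le> d0 \<longrightarrow> (\<forall>\<^sub>F q in nhds q0. \<exists>u. unique_partner q0 p d q u))"
proof -
  obtain d1 where d1: "d1 > 0" "\<And>d. 0 < d \<Longrightarrow> d \<le> d1 \<Longrightarrow>
    \<forall>\<^sub>F q in nhds q0. \<exists>!u. u \<in> cball p d \<and> u \<in> critical_points (f q)"
    using critical_point_persists[OF assms] by blast
  define d0 where "d0 = min d1 1"
  have d0: "0 < d0" "d0 \<le> 1" "d0 \<le> d1"
    using d1(1) by (auto simp: d0_def)
  note unique = d1(2)[OF _ order_trans[OF _ d0(3)]]
  have uniq0: "y = p" if "y \<in> critical_points (f q0)" "y \<in> cball p d0" for y
    using eventually_nhds_x_imp_x[OF unique[OF d0(1) order_refl]] that p d0 by auto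
  obtain k where k: "has_index (f q0) p k"
    and indx: "\<forall>\<^sub>F z in nhds (q0, p). snd z \<in> critical_points (f (fst z)) \<longrightarrow>
      (\<forall>y\<in>critical_points (f (fst z)). y \<in> cball p d0 \<longrightarrow> y = snd z) \<longrightarrow>
      has_index (f (fst z)) (snd z) k"
    using index_persists[OF p d0(1,2) uniq0] by blast
  define P where "P z \<longleftrightarrow> (snd z \<in> critical_points (f (fst z)) \<longrightarrow> same_type q0 p (fst z) (snd z)) \<and>
      (snd z \<in> critical_points (f (fst z)) \<longrightarrow>
      (\<forall>y\<in>critical_points (f (fst z)). y \<in> cball p d0 \<longrightarrow> y = snd z) \<longrightarrow>
      has_index (f (fst z)) (snd z) k)" for z
  have "\<forall>\<^sub>F z in nhds (q0, p). P z"
    unfolding P_def by (rule eventually_conj[OF type_persists[OF assms] indx])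
  then obtain \<delta> where "\<delta> > 0" "\<forall>\<^sub>F q in nhds q0. \<forall>u\<in>cball p \<delta>. P (q, u)"
    by (rule eventually_nhds_prod_cball)
  then have \<delta>: "\<delta> > 0" "\<forall>\<^sub>F q in nhds q0. \<forall>u\<in>cball p \<delta>. u \<in> critical_points (f q) \<longrightarrow>
      same_type q0 p q u \<and> ((\<forall>y\<in>critical_points (f q). y \<in> cball p d0 \<longrightarrow> y = u) \<longrightarrow> has_index (f q) u k)"
    by (auto simp: P_def elim!: eventually_mono)
  show ?thesis
  proof (intro exI[of _ d0] conjI allI impI d0(1))
    fix d assume d: "0 < d" "d \<le> d0"
    have "\<forall>\<^sub>F q in nhds q0. \<exists>!u. u \<in> cball p (min d \<delta>) \<and> u \<in> critical_points (f q)"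
      by (rule unique) (use d \<delta> in auto)
    with unique[OF d0(1) order_refl] \<delta>(2)
    show "\<forall>\<^sub>F q in nhds q0. \<exists>u. unique_partner q0 p d q u"
      unfolding unique_partner_def
    proof eventually_elim
      case (elim q)
      then obtain u where u: "u \<in> cball p (min d \<delta>)" "u \<in> critical_points (f q)"
        by blast
      have in_d0: "y \<in> cball p d0" if "y \<in> cball p d" for y
        using that d by auto
      have ud: "u \<in> cball p d" and u\<delta>: "u \<in> cball p \<delta>"
        using u by auto
      have uniq: "\<forall>y\<in>critical_points (f q). y \<in> cball p d0 \<longrightarrow> y = u"
        using elim(1) in_d0[OF ud] u(2) by blast
      have "same_type q0 p q u" "has_index (f q) u k"
        using bspec[OF elim(2) u\<delta>] u(2) uniq by simp_all
      moreover have "\<forall>y\<in>critical_points (f q). y \<in> cball p d \<longrightarrow> y = u"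
        using uniq in_d0 by blast
      ultimately show ?case
        using ud u(2) k by blast
    qed
  qed
qed

text \<open>
  The local partners are collected over disjoint balls around the critical points. Outside of these
  balls the unperturbed gradient has no zero, and by compactness neither has the perturbed one.
\<close>

theorem critical_correspondence_persists:
  assumes fin: "finite (critical_points (f q0))"
    and nd: "\<And>p. p \<in> critical_points (f q0) \<Longrightarrow> nondegenerate q0 p"
  shows "\<forall>\<^sub>F q in nhds q0. \<exists>F. critical_correspondence (f q0) (f q) F"
proof -
  define C where "C = critical_points (f q0)"
  have "\<forall>p\<in>C. \<exists>d0. d0 > 0 \<and> (\<forall>d. 0 < d \<longrightarrow> d \<le> d0 \<longrightarrow> (\<forall>\<^sub>F q in nhds q0. \<exists>u. unique_partner q0 p d q u))"
    unfolding C_def by (intro ballI local_correspondence nd)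
  from bchoice[OF this] obtain d0 where d0_all: "\<forall>p\<in>C. d0 p > 0 \<and>
      (\<forall>d. 0 < d \<longrightarrow> d \<le> d0 p \<longrightarrow> (\<forall>\<^sub>F q in nhds q0. \<exists>u. unique_partner q0 p d q u))" ..
  have d0: "d0 p > 0" "\<And>d. 0 < d \<Longrightarrow> d \<le> d0 p \<Longrightarrow> \<forall>\<^sub>F q in nhds q0. \<exists>u. unique_partner q0 p d q u"
    if "p \<in> C" for p
    using bspec[OF d0_all that] by simp_all
  have small: "\<forall>\<^sub>F d in at_right 0. d < e" if "e > 0" for e :: real
    by (rule order_tendstoD[OF tendsto_ident_at that])
  have "\<forall>\<^sub>F d in at_right 0. d < d0 p \<and> (\<forall>p'\<in>C. p' \<noteq> p \<longrightarrow> d < dist p p' / 2)" if "p \<in> C" for p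
  proof (intro eventually_conj small d0(1) that eventually_ball_finite ballI)
    show "finite C" using fin by (simp add: C_def)
    show "\<forall>\<^sub>F d in at_right 0. p' \<noteq> p \<longrightarrow> d < dist p p' / 2" for p'
      using small[of "dist p p' / 2"] by (cases "p' = p") simp_all
  qed
  then have "\<forall>\<^sub>F d in at_right 0. \<forall>p\<in>C. d < d0 p \<and> (\<forall>p'\<in>C. p' \<noteq> p \<longrightarrow> d < dist p p' / 2)"
    using fin by (intro eventually_ball_finite) (auto simp: C_def)
  then have "\<forall>\<^sub>F d in at_right 0. 0 < d \<and> (\<forall>p\<in>C. d < d0 p \<and> (\<forall>p'\<in>C. p' \<noteq> p \<longrightarrow> d < dist p p' / 2))"
    by (intro eventually_conj eventually_at_right_less)
  from eventually_happens'[OF trivial_limit_at_right_real this] obtain d :: real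
    where "0 < d \<and> (\<forall>p\<in>C. d < d0 p \<and> (\<forall>p'\<in>C. p' \<noteq> p \<longrightarrow> d < dist p p' / 2))" ..
  then have d: "0 < d"
    "\<And>p. p \<in> C \<Longrightarrow> d < d0 p" "\<And>p p'. p \<in> C \<Longrightarrow> p' \<in> C \<Longrightarrow> p' \<noteq> p \<Longrightarrow> d < dist p p' / 2"
    by simp_all
  have disjoint: "p = p'" if "p \<in> C" "p' \<in> C" "u \<in> cball p d" "u \<in> cball p' d" for p p' u
    using d(3)[of p p'] that dist_triangle[of p p' u] by (fastforce simp: dist_commute)
  have ev: "\<forall>\<^sub>F q in nhds q0. \<forall>p\<in>C. \<exists>u. unique_partner q0 p d q u"
    using fin d d0(2) by (intro eventually_ball_finite) (auto simp: C_def less_imp_le)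
  define K where "K = S2 - (\<Union>p\<in>C. ball p d)"
  have "compact K"
    unfolding K_def by (intro compact_diff) auto
  have far: "\<forall>\<^sub>F q in nhds q0. \<forall>u\<in>K. (q, u) \<in> {z. tangential_grad (fst z) (snd z) \<noteq> 0}"
  proof (rule eventually_nhds_compact[OF _ \<open>compact K\<close>])
    show "open {z. tangential_grad (fst z) (snd z) \<noteq> 0}"
      by (intro open_Collect_neq continuous_intros)
    show "(q0, u) \<in> {z. tangential_grad (fst z) (snd z) \<noteq> 0}" if "u \<in> K" for u
      using that critical_iff[of u q0] d(1) by (auto simp: K_def C_def)
  qed
  from ev far show ?thesis
  proof eventually_elim
    case (elim q)
    from bchoice[OF elim(1)] obtain F where F_all: "\<forall>p\<in>C. unique_partner q0 p d q (F p)" ..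
    have F: "unique_partner q0 p d q (F p)" if "p \<in> C" for p
      using F_all that by simp
    have "bij_betw F C (critical_points (f q))"
      unfolding bij_betw_def
    proof
      show "inj_on F C"
      proof (rule inj_onI)
        fix p p' assume "p \<in> C" "p' \<in> C" "F p = F p'"
        then show "p = p'"
          using F[of p] F[of p'] disjoint[of p p' "F p"] by (simp add: unique_partner_def)
      qed
      show "F ` C = critical_points (f q)"
      proof
        show "F ` C \<subseteq> critical_points (f q)"
          using F by (auto simp: unique_partner_def)
        show "critical_points (f q) \<subseteq> F ` C"
        proof
          fix u assume u: "u \<in> critical_points (f q)"
          then have "u \<in> S2" "tangential_grad q u = 0"
            using critical_iff by auto
          then have "u \<notin> K"
            using elim(2) by auto
          then obtain p where "p \<in> C" "u \<in> cball p d"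
            using \<open>u \<in> S2\<close> by (auto simp: K_def)
          then show "u \<in> F ` C"
            using F[of p] u by (auto simp: unique_partner_def)
        qed
      qed
    qed
    then show ?case
      using F by (intro exI[of _ F]) (auto simp: critical_correspondence_def C_def
          unique_partner_def same_type_def)
  qed
qed

end

section \<open>Spherical harmonics as polynomials\<close>

lemma S2_coordinates: "u \<in> S2 \<longleftrightarrow> (u$1)\<^sup>2 + (u$2)\<^sup>2 + (u$3)\<^sup>2 = 1"
  by (simp add: norm_vec_def L2_set_def sum_3)

definition horizontal :: "real^3 \<Rightarrow> complex"
  where "horizontal u = Complex (u$1) (u$2)"

lemma horizontal_simps [simp]: "Re (horizontal u) = u$1" "Im (horizontal u) = u$2"
  by (simp_all add: horizontal_def)

lemma bounded_linear_horizontal: "bounded_linear horizontal"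
proof (rule bounded_linear_intro[where K = 1])
  show "norm (horizontal u) \<le> norm u * 1" for u
    by (simp add: horizontal_def cmod_def norm_vec_def L2_set_def sum_3 real_sqrt_le_mono)
qed (simp_all add: horizontal_def complex_eq_iff)

lemma cmod_horizontal:
  assumes "u \<in> S2"
  shows "(cmod (horizontal u))\<^sup>2 = 1 - (u$3)\<^sup>2"
  using assms[unfolded S2_coordinates] by (simp add: horizontal_def cmod_def)

text \<open>
  A polynomial that restricts to the spherical harmonic on the unit sphere (it is not the homogeneous
  harmonic polynomial with that restriction).
\<close>

definition harmonic :: "nat \<Rightarrow> nat \<Rightarrow> real^3 \<Rightarrow> real"
  where "harmonic l m u = Re (horizontal u ^ m) * poly (legendre_deriv l m) (u$3)"

lemma sph_harm_eq_harmonic: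
  assumes "u \<in> S2" "1 \<le> m"
  shows "sph_harm l m u = harmonic l m u"
proof -
  define \<zeta> where "\<zeta> = horizontal u"
  have "\<bar>u$3\<bar> \<le> 1"
    using cmod_horizontal[OF assms(1)] zero_le_power2[of "cmod (horizontal u)"]
    by (simp add: abs_square_le_1)
  then have z: "cos (colatitude u) = u$3"
    by (simp add: colatitude_def cos_arccos_abs)
  have "(1 - (u$3)\<^sup>2) powr (real m / 2) = cmod \<zeta> ^ m"
  proof (cases "\<zeta> = 0")
    case False
    then have "(cmod \<zeta>)\<^sup>2 powr (real m / 2) = cmod \<zeta> powr (2 * (real m / 2))"
      by (simp add: powr_powr flip: powr_numeral)
    also have "\<dots> = cmod \<zeta> ^ m"
      using False by (simp add: powr_realpow)
    finally show ?thesis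
      using cmod_horizontal[OF assms(1)] by (simp add: \<zeta>_def)
  qed (use assms cmod_horizontal[OF assms(1)] in \<open>simp add: \<zeta>_def\<close>)
  moreover have "\<zeta> ^ m = rcis (cmod \<zeta> ^ m) (real m * Arg \<zeta>)"
    by (metis DeMoivre2 rcis_cmod_Arg)
  then have "Re (\<zeta> ^ m) = cmod \<zeta> ^ m * cos (real m * Arg \<zeta>)"
    by simp
  ultimately show ?thesis
    by (simp add: sph_harm_def assoc_legendre_def harmonic_def legendre_deriv_def longitude_def z
        \<zeta>_def horizontal_def)
qed

lemma has_derivative_poly_nth:
  "((\<lambda>u::real^3. poly p (u$i)) has_derivative (\<lambda>h. poly (pderiv p) (u$i) * h$i)) (at u)"
proof -
  have "(poly p has_derivative (*) (poly (pderiv p) (u$i))) (at (u$i))"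
    using poly_DERIV[of p] by (simp add: has_field_derivative_def)
  from has_derivative_compose[OF bounded_linear.has_derivative[OF bounded_linear_vec_nth
      has_derivative_ident] this]
  show ?thesis .
qed

lemma continuous_on_poly_comp [continuous_intros]:
  fixes p :: "real poly"
  assumes "continuous_on S u"
  shows "continuous_on S (\<lambda>x. poly p (u x))"
  by (rule continuous_on_compose2[OF continuous_on_poly[OF continuous_on_id] assms]) auto

definition harmonic_gradient :: "nat \<Rightarrow> nat \<Rightarrow> real^3 \<Rightarrow> real^3"
  where "harmonic_gradient l m u =
    (real m * Re (horizontal u ^ (m - 1)) * poly (legendre_deriv l m) (u$3)) *\<^sub>R axis 1 1
    + (- real m * Im (horizontal u ^ (m - 1)) * poly (legendre_deriv l m) (u$3)) *\<^sub>R axis 2 1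
    + (Re (horizontal u ^ m) * poly (legendre_deriv l (Suc m)) (u$3)) *\<^sub>R axis 3 1"

lemma gderiv_harmonic: "GDERIV (harmonic l m) u :> harmonic_gradient l m u"
proof -
  have "((\<lambda>u. Re (horizontal u ^ m) * poly (legendre_deriv l m) (u$3)) has_derivative
     (\<lambda>h. Re (horizontal u ^ m) * (poly (pderiv (legendre_deriv l m)) (u$3) * h$3)
        + Re (of_nat m * horizontal h * horizontal u ^ (m - 1)) * poly (legendre_deriv l m) (u$3))) (at u)"
    by (intro has_derivative_mult has_derivative_poly_nth bounded_linear.has_derivative[OF
        bounded_linear_Re]
        has_derivative_power bounded_linear.has_derivative[OF bounded_linear_horizontal]
            has_derivative_ident)
  moreover have "Re (of_nat m * horizontal h * horizontal u ^ (m - 1))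
      = real m * (h$1 * Re (horizontal u ^ (m - 1)) - h$2 * Im (horizontal u ^ (m - 1)))" for h
    by (simp add: horizontal_def[of h] algebra_simps)
  ultimately show ?thesis
    unfolding gderiv_def harmonic_def[abs_def] harmonic_gradient_def legendre_deriv_Suc
    by (simp add: inner_add_right inner_axis algebra_simps)
qed

definition sph_harm_gradient :: "nat \<Rightarrow> nat \<Rightarrow> real^3 \<Rightarrow> real^3"
  where "sph_harm_gradient l m u
    = harmonic_gradient l m u - (harmonic_gradient l m u \<bullet> u) *\<^sub>R u"

lemma sph_harm_has_gradient:
  assumes "u \<in> S2" "1 \<le> m"
  shows "has_sphere_gradient (sph_harm l m) u (sph_harm_gradient l m u)"
  unfolding sph_harm_gradient_def
  by (rule has_sphere_gradient_restrict[OF assms(1) sph_harm_eq_harmonic gderiv_harmonic])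
    (use assms in auto)

lemma continuous_on_horizontal [continuous_intros]: "continuous_on S horizontal"
  by (rule linear_continuous_on[OF bounded_linear_horizontal])

lemma continuous_on_sph_harm_gradient: "continuous_on S (sph_harm_gradient l m)"
  unfolding sph_harm_gradient_def harmonic_gradient_def
  by (intro continuous_intros)

lemma continuous_on_sph_harm: "1 \<le> m \<Longrightarrow> continuous_on S2 (sph_harm l m)"
proof -
  assume m: "1 \<le> m"
  have "continuous_on S2 (harmonic l m)"
    unfolding harmonic_def by (intro continuous_intros)
  then show ?thesis
    by (rule continuous_on_eq) (simp only: sph_harm_eq_harmonic[OF _ m])
qed

text \<open>
  Let \<open>\<zeta> = x + i y\<close> and \<open>\<zeta>^m = a + i b\<close>. Differentiating along the parallels gives \<open>b * Q z = 0\<close>, along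
  the meridians \<open>a * R z = 0\<close> for a polynomial \<open>R\<close> that is nonzero at the pole. Roots of \<open>Q\<close> inside
  \<open>(-1, 1)\<close> are simple, so \<open>Q\<close> and \<open>R\<close> have no common root there. Hence \<open>z\<close> is one of finitely many
  heights, and \<open>a = 0\<close> or \<open>b = 0\<close>, which leaves finitely many \<open>\<zeta>\<close> at each height.
\<close>

lemma finite_critical_points_sph_harm:
  assumes m: "1 \<le> m" "m \<le> l"
  shows "finite (critical_points (sph_harm l m))"
proof -
  define Q Q' where "Q = legendre_deriv l m" and "Q' = legendre_deriv l (Suc m)"
  define R where "R = smult (real m) ([:0, 1:] * Q) - [:1, 0, -1:] * Q'"
  have poly_R: "poly R z = real m * z * poly Q z - (1 - z\<^sup>2) * poly Q' z" for z
    by (simp add: R_def power2_eq_square algebra_simps)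
  have Q1: "poly Q 1 \<noteq> 0"
    unfolding Q_def by (rule legendre_deriv_at_pole) (use m in auto)
  then have "poly R 1 \<noteq> 0"
    using m by (simp add: poly_R)
  then have "Q \<noteq> 0" "R \<noteq> 0"
    using Q1 by auto
  define heights where "heights = {z. poly Q z = 0} \<union> {z. poly R z = 0} \<union> {1, -1}"
  have fin: "finite heights"
    unfolding heights_def using \<open>Q \<noteq> 0\<close> \<open>R \<noteq> 0\<close> by (simp add: poly_roots_finite)
  define roots where "roots z = {\<zeta> :: complex. \<zeta> ^ (2 * m) =
      of_real ((1 - z\<^sup>2) ^ m)} \<union> {\<zeta>. \<zeta> ^ (2 * m) = - of_real ((1 - z\<^sup>2) ^ m)}"
    for z :: real
  have "finite (roots z)" for z
    unfolding roots_def using m by (intro finite_UnI finite_nth_roots) auto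
  then have "finite ((\<lambda>(z, \<zeta>). vector [Re \<zeta>, Im \<zeta>, z] :: real^3) ` (SIGMA z:heights. roots z))"
    using fin by (intro finite_imageI finite_SigmaI) auto
  moreover have "critical_points (sph_harm l m) \<subseteq>
      (\<lambda>(z, \<zeta>). vector [Re \<zeta>, Im \<zeta>, z] :: real^3) ` (SIGMA z:heights. roots z)"
  proof
    fix u assume u: "u \<in> critical_points (sph_harm l m)"
    then have uS: "u \<in> S2"
      using critical_points_S2 by blast
    define \<zeta> z a b where "\<zeta> = horizontal u" and "z = u$3" and "a = Re (\<zeta> ^ m)" and "b = Im (\<zeta> ^ m)"
    define D where "D = harmonic_gradient l m u"
    have zm: "\<zeta> ^ m = \<zeta> * \<zeta> ^ (m - 1)"
      using m by (metis power_eq_if not_one_le_zero)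
    have "D = (D \<bullet> u) *\<^sub>R u"
      using u critical_points_iff[OF sph_harm_has_gradient[OF uS m(1)]]
          by (simp add: sph_harm_gradient_def D_def)
    then obtain k where k: "D = k *\<^sub>R u" ..
    have D: "D$1 = real m * Re (\<zeta> ^ (m - 1)) * poly Q z" "D$2 = - real m * Im (\<zeta> ^ (m - 1)) * poly Q z"
      "D$3 = a * poly Q' z"
      by (simp_all add: D_def harmonic_gradient_def axis_def \<zeta>_def z_def a_def Q_def Q'_def)
    have \<zeta>2: "u$1 * u$1 + u$2 * u$2 = 1 - z\<^sup>2"
      using uS[unfolded S2_coordinates] by (simp add: z_def power2_eq_square)
    have "0 = u$2 * D$1 - u$1 * D$2"
      by (simp add: k)
    also have "\<dots> = real m * b * poly Q z"
      unfolding D b_def zm by (simp add: \<zeta>_def horizontal_def algebra_simps)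
    finally have bQ: "b * poly Q z = 0"
      using m by simp
    have "0 = (u$1 * D$1 + u$2 * D$2) * z - (u$1 * u$1 + u$2 * u$2) * D$3"
      by (simp add: k z_def algebra_simps)
    also have "\<dots> = real m * a * poly Q z * z - (1 - z\<^sup>2) * (a * poly Q' z)"
      unfolding \<zeta>2 D(3) unfolding D a_def zm by (simp add: \<zeta>_def horizontal_def algebra_simps)
    also have "\<dots> = a * poly R z"
      by (simp add: poly_R algebra_simps)
    finally have aR: "a * poly R z = 0" by simp
    have abs: "a\<^sup>2 + b\<^sup>2 = (1 - z\<^sup>2) ^ m"
    proof -
      have "a\<^sup>2 + b\<^sup>2 = (cmod (\<zeta> ^ m))\<^sup>2"
        by (simp add: a_def b_def cmod_power2)
      also have "\<dots> = ((cmod \<zeta>)\<^sup>2) ^ m"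
        by (simp add: norm_power mult.commute flip: power_mult)
      finally show ?thesis
        using cmod_horizontal[OF uS] by (simp add: \<zeta>_def z_def)
    qed
    have ab: "a = 0 \<or> b = 0"
    proof (rule ccontr)
      assume "\<not> (a = 0 \<or> b = 0)"
      then have "poly Q z = 0" "poly R z = 0"
        using aR bQ by auto
      moreover have "1 - z\<^sup>2 \<noteq> 0"
      proof
        assume "1 - z\<^sup>2 = 0"
        then have "a\<^sup>2 + b\<^sup>2 = 0"
          using abs m by simp
        then show False
          using \<open>\<not> (a = 0 \<or> b = 0)\<close> by (simp add: sum_power2_eq_zero_iff)
      qed
      ultimately show False
        using legendre_deriv_simple_roots[of m l z] m by (simp add: poly_R Q_def Q'_def)
    qed
    have "z \<in> heights"
    proof (rule ccontr)
      assume "z \<notin> heights"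
      then have "a = 0" "b = 0" "z\<^sup>2 \<noteq> 1"
        using aR bQ by (auto simp: heights_def power2_eq_1_iff)
      then show False
        using abs by simp
    qed
    moreover have "\<zeta> \<in> roots z"
    proof -
      have "\<zeta> ^ (2 * m) = (\<zeta> ^ m)\<^sup>2"
        by (simp add: mult.commute flip: power_mult)
      also have "\<zeta> ^ m = Complex a b"
        by (simp add: a_def b_def)
      finally show ?thesis
        using ab abs by (auto simp: roots_def complex_eq_iff Re_power2 Im_power2)
    qed
    moreover have "u = vector [Re \<zeta>, Im \<zeta>, z]"
      by (simp add: vec_eq_iff forall_3 \<zeta>_def horizontal_def z_def)
    ultimately show "u \<in> (\<lambda>(z, \<zeta>). vector [Re \<zeta>, Im \<zeta>, z] :: real^3) ` (SIGMA z:heights. roots z)"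
      by (intro image_eqI[of _ _ "(z, \<zeta>)"]) auto
  qed
  ultimately show ?thesis
    using finite_subset by blast
qed

text \<open>
  Near the poles the harmonic vanishes to order \<open>m\<close>.
\<close>

lemma poles_critical:
  assumes "2 \<le> m"
  shows "{north_pole, south_pole} \<subseteq> critical_points (sph_harm l m)"
proof -
  have "u \<in> critical_points (sph_harm l m)" if "u \<in> S2" "horizontal u = 0" for u
  proof -
    have "harmonic_gradient l m u = 0"
      using assms that by (simp add: harmonic_gradient_def power_0_left)
    then show ?thesis
      using critical_points_iff[OF sph_harm_has_gradient[OF that(1)], of m l] assms
      by (simp add: sph_harm_gradient_def)
  qed
  moreover have "north_pole \<in> S2" "south_pole \<in> S2" "horizontal north_pole = 0" "horizontal south_pole = 0"
    unfolding S2_coordinates by (simp_all add: complex_eq_iff)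
  ultimately show ?thesis
    by blast
qed

section \<open>Symmetries of the body\<close>

lemma compact_body:
  assumes g: "continuous_on S2 g" and pos: "positive_radius g \<epsilon>"
  shows "compact (body g \<epsilon>)"
proof -
  have "body g \<epsilon> = (\<lambda>(u, t). (t * (1 + \<epsilon> * g u)) *\<^sub>R u) ` (S2 \<times> {0..1})"
  proof
    show "body g \<epsilon> \<subseteq> (\<lambda>(u, t). (t * (1 + \<epsilon> * g u)) *\<^sub>R u) ` (S2 \<times> {0..1})"
    proof
      fix x assume "x \<in> body g \<epsilon>"
      then obtain t u where x: "x = t *\<^sub>R u" "u \<in> S2" "0 \<le> t" "t \<le> 1 + \<epsilon> * g u"
        by (auto simp: body_def)
      then have r: "1 + \<epsilon> * g u > 0"
        using pos by (simp add: positive_radius_def)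
      then show "x \<in> (\<lambda>(u, t). (t * (1 + \<epsilon> * g u)) *\<^sub>R u) ` (S2 \<times> {0..1})"
        using x by (intro image_eqI[of _ _ "(u, t / (1 + \<epsilon> * g u))"]) (auto simp: divide_le_eq)
    qed
    show "(\<lambda>(u, t). (t * (1 + \<epsilon> * g u)) *\<^sub>R u) ` (S2 \<times> {0..1}) \<subseteq> body g \<epsilon>"
    proof (clarify)
      fix u :: "real^3" and t :: real assume *: "u \<in> S2" "t \<in> {0..1}"
      then have r: "1 + \<epsilon> * g u > 0"
        using pos by (simp add: positive_radius_def)
      have "t * (1 + \<epsilon> * g u) \<le> 1 + \<epsilon> * g u"
        using * r by (intro mult_left_le_one_le) auto
      then show "(t * (1 + \<epsilon> * g u)) *\<^sub>R u \<in> body g \<epsilon>"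
        unfolding body_def using * r by fastforce
    qed
  qed
  moreover have "compact \<dots>"
  proof (rule compact_continuous_image)
    have "continuous_on (S2 \<times> {0..1}) (\<lambda>z. g (fst z))"
      by (rule continuous_on_compose2[OF g continuous_on_fst[OF continuous_on_id]]) auto
    then show "continuous_on (S2 \<times> {0..1}) (\<lambda>(u, t). (t * (1 + \<epsilon> * g u)) *\<^sub>R u)"
      unfolding case_prod_beta by (intro continuous_intros)
    show "compact (S2 \<times> {0..1::real})"
      by (intro compact_Times) auto
  qed
  ultimately show ?thesis by simp
qed

lemma absolutely_integrable_id_compact:
  assumes "compact B"
  shows "(\<lambda>x::real^3. x) absolutely_integrable_on B"
    "(LINT x:B|lborel. x) = integral B (\<lambda>x. x)"
proof -
  have 1: "set_integrable lborel B (\<lambda>x::real^3. x)"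
    unfolding set_integrable_def by (rule borel_integrable_compact[OF assms continuous_on_id])
  then show "(LINT x:B|lborel. x) = integral B (\<lambda>x. x)"
    by (rule set_borel_integral_eq_integral)
  show "(\<lambda>x::real^3. x) absolutely_integrable_on B"
    using 1 unfolding set_integrable_def
    by (subst integrable_completion) (auto dest: borel_measurable_integrable)
qed

lemma centroid_fixed:
  assumes B: "compact B" and T: "orthogonal_transformation T" and sym: "T ` B = B"
  shows "T (centroid B) = centroid B"
proof -
  have lin: "linear T"
    using T by (rule orthogonal_transformation_linear)
  have bl: "bounded_linear T"
    using lin linear_conv_bounded_linear by blast
  have "integral (T ` B) (\<lambda>x. x) = \<bar>det (matrix T)\<bar> *\<^sub>R integral B ((\<lambda>x. x) \<circ> T)"
    using absolutely_integrable_id_compact(1)[OF B] sym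
    by (intro integral_change_of_variables_linear lin) auto
  then have "integral B (\<lambda>x. x) = integral B (T \<circ> (\<lambda>x. x))"
    using T by (simp add: sym o_def)
  also have "\<dots> = T (integral B (\<lambda>x. x))"
    using absolutely_integrable_id_compact(1)[OF B] set_lebesgue_integral_eq_integral(1)
    by (intro integral_linear bl) auto
  finally show ?thesis
    unfolding centroid_def absolutely_integrable_id_compact(2)[OF B]
    by (simp add: linear_scale[OF lin])
qed

lemma body_symmetric:
  assumes T: "orthogonal_transformation T" and g: "\<And>u. u \<in> S2 \<Longrightarrow> g (T u) = g u"
  shows "T ` body g \<epsilon> = body g \<epsilon>"
proof -
  have lin: "linear T"
    using T by (rule orthogonal_transformation_linear)
  have nT: "norm (T x) = norm x" for x
    using T by (simp add: orthogonal_transformation)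
  have "surj T"
    using T orthogonal_transformation_surj by blast
  show ?thesis
  proof
    show "T ` body g \<epsilon> \<subseteq> body g \<epsilon>"
    proof
      fix y assume "y \<in> T ` body g \<epsilon>"
      then obtain t u where tu: "y = T (t *\<^sub>R u)" "u \<in> S2" "0 \<le> t" "t \<le> 1 + \<epsilon> * g u"
        by (auto simp: body_def)
      then have "y = t *\<^sub>R T u" "T u \<in> S2" "t \<le> 1 + \<epsilon> * g (T u)"
        by (auto simp: linear_scale[OF lin] g nT)
      then show "y \<in> body g \<epsilon>"
        using tu(3) by (auto simp: body_def)
    qed
    show "body g \<epsilon> \<subseteq> T ` body g \<epsilon>"
    proof
      fix y assume "y \<in> body g \<epsilon>"
      then obtain t v where tv: "y = t *\<^sub>R v" "v \<in> S2" "0 \<le> t" "t \<le> 1 + \<epsilon> * g v"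
        by (auto simp: body_def)
      obtain u where u: "v = T u"
        using \<open>surj T\<close> by (auto simp: surj_def)
      then have "u \<in> S2" using tv nT[of u] by simp
      then have "t *\<^sub>R u \<in> body g \<epsilon>"
        using tv g u by (auto simp: body_def)
      then show "y \<in> T ` body g \<epsilon>"
        by (rule rev_image_eqI) (simp add: tv u linear_scale[OF lin])
    qed
  qed
qed

text \<open>
  In the uses below \<open>\<phi>\<close> is a rotation or a reflection of the plane and \<open>\<sigma>\<close> is \<open>1\<close> or \<open>-1\<close>.
\<close>

definition axial_isometry :: "(complex \<Rightarrow> complex) \<Rightarrow> real \<Rightarrow> real^3 \<Rightarrow> real^3"
  where "axial_isometry \<phi> \<sigma> u
    = vector [Re (\<phi> (horizontal u)), Im (\<phi> (horizontal u)), \<sigma> * u$3]"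

lemma axial_isometry_simps [simp]:
  "horizontal (axial_isometry \<phi> \<sigma> u) = \<phi> (horizontal u)" "axial_isometry \<phi> \<sigma> u $ 3 = \<sigma> * u$3"
  by (simp_all add: axial_isometry_def horizontal_def complex_eq_iff)

lemma horizontal_eqI:
  "horizontal u = horizontal v \<Longrightarrow> u$3 = v$3 \<Longrightarrow> u = v"
  by (simp add: vec_eq_iff forall_3 complex_eq_iff)

lemma orthogonal_axial_isometry:
  assumes \<phi>: "linear \<phi>" "\<And>\<zeta>. cmod (\<phi> \<zeta>) = cmod \<zeta>" and \<sigma>: "\<sigma>\<^sup>2 = 1"
  shows "orthogonal_transformation (axial_isometry \<phi> \<sigma>)"
proof -
  have hlin: "linear horizontal"
    using bounded_linear_horizontal linear_conv_bounded_linear by blast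
  have "(norm u)\<^sup>2 = (cmod (horizontal u))\<^sup>2 + (u$3)\<^sup>2" for u
    by (simp add: norm_vec_def L2_set_def sum_3 cmod_power2)
  then have "(norm (axial_isometry \<phi> \<sigma> u))\<^sup>2 = (norm u)\<^sup>2" for u
    by (simp add: \<phi>(2) \<sigma> power_mult_distrib)
  then have "norm (axial_isometry \<phi> \<sigma> u) = norm u" for u
    using power2_eq_iff_nonneg[of "norm (axial_isometry \<phi> \<sigma> u)" "norm u"] by simp
  moreover have "linear (axial_isometry \<phi> \<sigma>)"
  proof
    show "axial_isometry \<phi> \<sigma> (u + v) = axial_isometry \<phi> \<sigma> u + axial_isometry \<phi> \<sigma> v" for u v
      by (rule horizontal_eqI) (simp_all add: linear_add[OF hlin] linear_add[OF \<phi>(1)] distrib_left)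
    show "axial_isometry \<phi> \<sigma> (c *\<^sub>R u) = c *\<^sub>R axial_isometry \<phi> \<sigma> u" for c u
      by (rule horizontal_eqI) (simp_all add: linear_scale[OF hlin] linear_scale[OF \<phi>(1)])
  qed
  ultimately show ?thesis
    by (simp add: orthogonal_transformation)
qed

lemma centroid_body_fixed:
  assumes m: "1 \<le> m" and pos: "positive_radius (sph_harm l m) \<epsilon>"
    and \<phi>: "linear \<phi>" "\<And>\<zeta>. cmod (\<phi> \<zeta>) = cmod \<zeta>" and \<sigma>: "\<sigma>\<^sup>2 = 1"
    and sym: "\<And>\<zeta> z. Re (\<phi> \<zeta> ^ m) * poly (legendre_deriv l m) (\<sigma> * z) =
        Re (\<zeta> ^ m) * poly (legendre_deriv l m) z"
  defines "c \<equiv> centroid (body (sph_harm l m) \<epsilon>)"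
  shows "\<phi> (horizontal c) = horizontal c" "\<sigma> * c$3 = c$3"
proof -
  define T where "T = axial_isometry \<phi> \<sigma>"
  have T: "orthogonal_transformation T"
    unfolding T_def by (rule orthogonal_axial_isometry[OF \<phi> \<sigma>])
  have "T c = c"
    unfolding c_def
  proof (rule centroid_fixed[OF compact_body[OF continuous_on_sph_harm[OF m] pos] T body_symmetric[OF T]])
    fix u assume u: "u \<in> S2"
    then have "T u \<in> S2"
      using T by (simp add: orthogonal_transformation)
    then show "sph_harm l m (T u) = sph_harm l m u"
      using u m by (simp only: sph_harm_eq_harmonic) (simp add: harmonic_def T_def sym)
  qed
  then show "\<phi> (horizontal c) = horizontal c" "\<sigma> * c$3 = c$3"
    by (metis T_def axial_isometry_simps)+
qed

text \<open>
  The vertical component is killed by the reflection \<open>z \<mapsto> - z\<close> composed with the rotation by \<open>w\<close>,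
  where \<open>w^m\<close> is the sign \<open>(-1)^(l + m)\<close> by which the reflection changes the harmonic; the second
  one by \<open>y \<mapsto> - y\<close>; and, if \<open>m \<ge> 2\<close>, both horizontal ones by the nontrivial rotation by \<open>2 pi / m\<close>.
\<close>

lemma centroid_body_symmetry:
  assumes m: "1 \<le> m" and pos: "positive_radius (sph_harm l m) \<epsilon>"
  defines "c \<equiv> centroid (body (sph_harm l m) \<epsilon>)"
  shows "c$3 = 0" "c$2 = 0" "2 \<le> m \<Longrightarrow> c = 0"
proof -
  have lin_mult: "linear (\<lambda>\<zeta>. w * \<zeta>)" for w :: complex
    using bounded_linear_mult_right linear_conv_bounded_linear by blast
  note fixed = centroid_body_fixed[OF m pos, folded c_def]
  define w where "w = (if even (l + m) then 1 else cis (pi / m))"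
  have w: "cmod w = 1" "w ^ m = (-1) ^ (l + m)"
    using m by (auto simp: w_def Complex.DeMoivre)
  have "(-1) * c$3 = c$3"
  proof (rule fixed(2)[of "\<lambda>\<zeta>. w * \<zeta>"])
    show "Re ((w * \<zeta>) ^ m) * poly (legendre_deriv l m) (- 1 * z) =
        Re (\<zeta> ^ m) * poly (legendre_deriv l m) z" for \<zeta> z
      by (cases "even (l + m)") (simp_all add: power_mult_distrib w legendre_deriv_minus)
  qed (use w in \<open>auto simp: norm_mult lin_mult\<close>)
  then show c3: "c$3 = 0" by simp
  have "cnj (horizontal c) = horizontal c"
  proof (rule fixed(1)[of cnj 1])
    show "linear cnj"
      using bounded_linear_cnj linear_conv_bounded_linear by blast
  qed (simp_all flip: complex_cnj_power)
  then show "c$2 = 0"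
    by (simp add: complex_eq_iff)
  assume m2: "2 \<le> m"
  define v where "v = cis (2 * pi / m)"
  have v: "cmod v = 1" "v ^ m = 1"
    using m by (simp_all add: v_def Complex.DeMoivre)
  have "v \<noteq> 1"
  proof
    assume "v = 1"
    then have "cos (2 * pi / m) = 1"
      by (simp add: v_def complex_eq_iff)
    moreover have "cos (2 * pi / m) < cos 0"
      using m2 by (intro cos_monotone_0_pi) (auto simp: field_simps)
    ultimately show False by simp
  qed
  have "v * horizontal c = horizontal c"
    by (rule fixed(1)[of "\<lambda>\<zeta>. v * \<zeta>" 1]) (use v in \<open>auto simp: norm_mult lin_mult power_mult_distrib\<close>)
  then have "horizontal c = 0"
    using \<open>v \<noteq> 1\<close> by simp
  then show "c = 0"
    using c3 by (intro horizontal_eqI) (simp_all add: complex_eq_iff)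
qed

lemma correspondence_if_sq_dist_radial:
  assumes m: "1 \<le> m" "m \<le> l" and \<epsilon>: "\<epsilon> > 0" and pos: "positive_radius (sph_harm l m) \<epsilon>"
    and dist: "\<And>u. u \<in> S2 \<Longrightarrow> sq_dist (sph_harm l m) \<epsilon> u = (1 + \<epsilon> * sph_harm l m u)\<^sup>2"
  shows "critical_correspondence (sph_harm l m) (sq_dist (sph_harm l m) \<epsilon>) id"
proof -
  have pos': "1 + \<epsilon> * sph_harm l m u > 0" if "u \<in> S2" for u
    using pos that by (simp add: positive_radius_def)
  interpret increasing_recalibration "sph_harm l m" "sq_dist (sph_harm l m) \<epsilon>" "sph_harm_gradient l m"
    "\<lambda>t. (1 + \<epsilon> * t)\<^sup>2" "\<lambda>u. 2 * \<epsilon> * (1 + \<epsilon> * sph_harm l m u)"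
  proof
    show "continuous_on S2 (\<lambda>u. 2 * \<epsilon> * (1 + \<epsilon> * sph_harm l m u))"
      by (intro continuous_intros continuous_on_sph_harm m)
    show "((\<lambda>t. (1 + \<epsilon> * t)\<^sup>2) has_real_derivative 2 * \<epsilon> * (1 + \<epsilon> * sph_harm l m u)) (at (sph_harm l
        m u))" for u
      by (auto intro!: derivative_eq_intros)
    show "(1 + \<epsilon> * sph_harm l m u)\<^sup>2 \<le> (1 + \<epsilon> * sph_harm l m v)\<^sup>2 \<longleftrightarrow> sph_harm l m u \<le> sph_harm l m v"
      if "u \<in> S2" "v \<in> S2" for u v
      using pos'[OF that(1)] pos'[OF that(2)] \<epsilon> by (subst power_mono_iff) auto
  qed (use sph_harm_has_gradient m continuous_on_sph_harm_gradient dist pos' \<epsilon> in auto)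
  show ?thesis
    by (rule correspondence_right)
      (rule critical_correspondence_refl[OF sph_harm_has_gradient continuous_on_sph_harm_gradient
          finite_critical_points_sph_harm], use m in auto)
qed

section \<open>Integration over the sphere\<close>

abbreviation punctured_ball :: "(real^3) set"
  where "punctured_ball \<equiv> cball 0 1 - {0}"

lemma punctured_ball_lebesgue: "punctured_ball \<in> sets lebesgue"
  by (intro sets.Diff) auto

lemma punctured_ball_lmeasurable: "punctured_ball \<in> lmeasurable"
  using punctured_ball_lebesgue
  by (intro bounded_set_imp_lmeasurable bounded_subset[OF bounded_cball[of 0 1]]) auto

lemma continuous_on_sgn_comp:
  assumes "continuous_on S2 f"
  shows "continuous_on (- {0}) (\<lambda>v. f (sgn v))"
proof (rule continuous_on_compose2[OF assms])
  show "continuous_on (- {0}) (sgn :: real^3 \<Rightarrow> _)"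
    unfolding sgn_div_norm[abs_def] by (intro continuous_intros) auto
  show "sgn ` (- {0}) \<subseteq> S2"
    using sgn_in_S2 by blast
qed

lemma absolutely_integrable_ball_bounded:
  fixes f :: "real^3 \<Rightarrow> 'b :: euclidean_space"
  assumes "continuous_on punctured_ball f" "\<And>v. v \<in> punctured_ball \<Longrightarrow> norm (f v) \<le> K"
  shows "f absolutely_integrable_on punctured_ball"
proof (rule measurable_bounded_by_integrable_imp_absolutely_integrable)
  show "f \<in> borel_measurable (lebesgue_on punctured_ball)"
    by (rule continuous_imp_measurable_on_sets_lebesgue[OF assms(1) punctured_ball_lebesgue])
  show "(\<lambda>v. K) integrable_on punctured_ball"
    by (rule integrable_on_const[OF punctured_ball_lmeasurable])
qed (use assms(2) punctured_ball_lebesgue in auto)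

text \<open>
  The integral of \<open>\<phi>\<close> over the sphere, up to a constant factor, without a surface measure. The weight
  \<^const>\<open>norm\<close> makes the integrand homogeneous of degree one, like the coordinate functions whose
  integrals over the body are wanted.
\<close>

definition sphere_integral :: "(real^3 \<Rightarrow> real) \<Rightarrow> real"
  where "sphere_integral \<phi> = integral punctured_ball (\<lambda>v. norm v * \<phi> (sgn v))"

lemma S2_bounded:
  fixes \<phi> :: "real^3 \<Rightarrow> real"
  assumes "continuous_on S2 \<phi>"
  obtains K where "\<And>u. u \<in> S2 \<Longrightarrow> \<bar>\<phi> u\<bar> \<le> K"
proof -
  have "bounded (\<phi> ` S2)"
    by (intro compact_imp_bounded compact_continuous_image assms) auto
  then obtain K where "\<forall>x\<in>\<phi> ` S2. norm x \<le> K"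
    unfolding bounded_iff by blast
  then show ?thesis
    by (intro that[of K]) auto
qed

lemma sphere_integral_integrable:
  assumes "continuous_on S2 \<phi>"
  shows "(\<lambda>v. norm v * \<phi> (sgn v)) absolutely_integrable_on punctured_ball"
proof -
  obtain K where K: "\<And>u. u \<in> S2 \<Longrightarrow> \<bar>\<phi> u\<bar> \<le> K"
    using S2_bounded[OF assms] by blast
  show ?thesis
  proof (rule absolutely_integrable_ball_bounded)
    show "continuous_on punctured_ball (\<lambda>v. norm v * \<phi> (sgn v))"
      by (intro continuous_intros continuous_on_subset[OF continuous_on_sgn_comp[OF assms]]) auto
    show "norm (norm v * \<phi> (sgn v)) \<le> 1 * K" if "v \<in> punctured_ball" for v
      using that K[of "sgn v"] unfolding norm_mult
      by (intro mult_mono) (auto simp: norm_sgn)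
  qed
qed

lemma sphere_integral_cong: "(\<And>u. u \<in> S2 \<Longrightarrow> \<phi> u = \<psi> u) \<Longrightarrow> sphere_integral \<phi> = sphere_integral \<psi>"
  unfolding sphere_integral_def by (rule integral_cong) (simp add: norm_sgn)

lemma sphere_integral_add:
  assumes "continuous_on S2 \<phi>" "continuous_on S2 \<psi>"
  shows "sphere_integral (\<lambda>u. \<phi> u + \<psi> u) = sphere_integral \<phi> + sphere_integral \<psi>"
  unfolding sphere_integral_def distrib_left
  by (intro integral_add set_lebesgue_integral_eq_integral(1) sphere_integral_integrable assms)

lemma sphere_integral_scale: "sphere_integral (\<lambda>u. c * \<phi> u) = c * sphere_integral \<phi>"
  using integral_mult_right[of punctured_ball c "\<lambda>v. norm v * \<phi> (sgn v)"]
  by (simp add: sphere_integral_def algebra_simps)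

text \<open>
  Orthogonal maps preserve volume and commute with \<^const>\<open>sgn\<close>. The scalar integrand is placed in
  the first coordinate of a vector, as the change of variables formula is about such integrands.
\<close>

lemma sphere_integral_rotate:
  assumes T: "orthogonal_transformation T" and "continuous_on S2 \<phi>"
  shows "sphere_integral (\<lambda>u. \<phi> (T u)) = sphere_integral \<phi>"
proof -
  have lin: "linear T"
    using T by (rule orthogonal_transformation_linear)
  have nT: "norm (T x) = norm x" for x
    using T by (simp add: orthogonal_transformation)
  have sgnT: "sgn (T x) = T (sgn x)" for x
    by (simp add: sgn_div_norm nT linear_scale[OF lin])
  have "surj T"
    using T orthogonal_transformation_surj by blast
  have img: "T ` punctured_ball = punctured_ball"
  proof
    show "T ` punctured_ball \<subseteq> punctured_ball"
      by (auto simp: nT) (metis norm_eq_zero nT)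
    show "punctured_ball \<subseteq> T ` punctured_ball"
    proof
      fix y assume y: "y \<in> punctured_ball"
      obtain x where "y = T x"
        using \<open>surj T\<close> by (auto simp: surj_def)
      then show "y \<in> T ` punctured_ball"
        using y nT[of x] by (intro rev_image_eqI[of x]) auto
    qed
  qed
  define e :: "real \<Rightarrow> real^3" where "e r = r *\<^sub>R axis 1 1" for r
  have e: "bounded_linear e" "e r $ 1 = r" for r
    unfolding e_def by (auto intro: bounded_linear_scaleR_left simp: axis_def)
  define F where "F v = norm v * \<phi> (sgn v)" for v
  have F: "(e \<circ> F) absolutely_integrable_on punctured_ball"
    unfolding F_def[abs_def] using sphere_integral_integrable[OF assms(2)] e(1)
        by (rule absolutely_integrable_linear)
  have comp: "integral punctured_ball (e \<circ> G) $ 1 = integral punctured_ball G"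
      if "(e \<circ> G) integrable_on punctured_ball" for G
    using integral_component_eq_cart[OF that, of 1] by (simp add: e(2))
  have FT: "(e \<circ> F \<circ> T) absolutely_integrable_on punctured_ball"
    using absolutely_integrable_on_linear_image[OF lin, where f = "e \<circ> F" and S = punctured_ball] F
      orthogonal_transformation_det[OF T] unfolding img by auto
  have "integral punctured_ball (e \<circ> F) = integral punctured_ball (e \<circ> F \<circ> T)"
    using integral_change_of_variables_linear[OF lin, where f = "e \<circ> F" and S = punctured_ball] F
      orthogonal_transformation_det[OF T] unfolding img by simp
  then have "integral punctured_ball F = integral punctured_ball (F \<circ> T)"
    using comp[OF set_lebesgue_integral_eq_integral(1)[OF F]]
      comp[OF set_lebesgue_integral_eq_integral(1)[OF FT[unfolded comp_assoc]]]
    by (simp add: comp_assoc)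
  then show ?thesis
    by (simp add: sphere_integral_def F_def[abs_def] o_def nT sgnT)
qed

text \<open>
  Rotation about the second axis, which mixes the first coordinate with the height.
\<close>

definition turn :: "real \<Rightarrow> real^3 \<Rightarrow> real^3"
  where "turn t u = vector [cos t * u$1 - sin t * u$3, u$2, sin t * u$1 + cos t * u$3]"

lemma turn_simps [simp]:
  "turn t u $ 1 = cos t * u$1 - sin t * u$3" "turn t u $ 2 = u$2" "turn t u $ 3 = sin t * u$1 + cos t * u$3"
  by (simp_all add: turn_def)

lemma orthogonal_turn: "orthogonal_transformation (turn t)"
proof -
  have "linear (turn t)"
    by unfold_locales (simp_all add: vec_eq_iff forall_3 algebra_simps)
  moreover have "norm (turn t u) = norm u" for u
  proof -
    have "(cos t * a - sin t * b)\<^sup>2 + (sin t * a + cos t * b)\<^sup>2 =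
        ((sin t)\<^sup>2 + (cos t)\<^sup>2) * (a\<^sup>2 + b\<^sup>2)" for a b
      by algebra
    then have "(turn t u $ 1)\<^sup>2 + (turn t u $ 2)\<^sup>2 + (turn t u $ 3)\<^sup>2 = (u$1)\<^sup>2 + (u$2)\<^sup>2 + (u$3)\<^sup>2"
      by (simp add: sin_cos_squared_add)
    then show ?thesis
      by (simp add: norm_vec_def L2_set_def sum_3)
  qed
  ultimately show ?thesis
    by (simp add: orthogonal_transformation)
qed

lemma turn_S2: "u \<in> S2 \<Longrightarrow> turn t u \<in> S2"
  using orthogonal_turn by (simp add: orthogonal_transformation)

text \<open>
  The integral of \<open>x * W z\<close> over the rotated sphere is constant in the angle, and the integrand is the
  derivative of \<open>x * W z\<close> along the rotation. This replaces integration by parts on the sphere.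
\<close>

lemma sphere_integral_infinitesimal_rotation:
  fixes W :: "real poly"
  shows "sphere_integral (\<lambda>u. (u$1)\<^sup>2 * poly (pderiv W) (u$3) - u$3 * poly W (u$3)) = 0"
proof -
  define \<phi> \<psi> where "\<phi> u = u$1 * poly W (u$3)"
    and "\<psi> u = (u$1)\<^sup>2 * poly (pderiv W) (u$3) - u$3 * poly W (u$3)" for u :: "real^3"
  have cont: "continuous_on S \<phi>" "continuous_on S \<psi>" for S
    unfolding \<phi>_def \<psi>_def by (intro continuous_intros)+
  have D: "((\<lambda>t. \<phi> (turn t u)) has_real_derivative \<psi> (turn t u)) (at t)" for t u
  proof -
    have z: "((\<lambda>t. turn t u $ 3) has_real_derivative turn t u $ 1) (at t)"
      and x: "((\<lambda>t. turn t u $ 1) has_real_derivative - turn t u $ 3) (at t)"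
      by (auto intro!: derivative_eq_intros)
    have "((\<lambda>t. turn t u $ 1 * poly W (turn t u $ 3)) has_real_derivative
        - turn t u $ 3 * poly W (turn t u $ 3) + poly (pderiv W) (turn t u $ 3) * turn t u $ 1 *
            turn t u $ 1) (at t)"
      by (rule DERIV_mult'[OF x DERIV_chain2[OF poly_DERIV z], THEN DERIV_cong]) simp
    then show ?thesis
      by (simp add: \<phi>_def \<psi>_def power2_eq_square algebra_simps del: turn_simps)
  qed
  obtain K where K: "\<And>u. u \<in> S2 \<Longrightarrow> \<bar>\<psi> u\<bar> \<le> K"
    using S2_bounded[OF cont(2)] by blast
  define t :: "nat \<Rightarrow> real" where "t k = inverse (real (Suc k))" for k
  define F where "F k v = norm v * ((\<phi> (turn (t k) (sgn v)) - \<phi> (sgn v)) / t k)" for k v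
  have t0: "t k \<noteq> 0" "t k > 0" for k
    by (auto simp: t_def)
  have contT: "continuous_on S2 (\<lambda>u. \<phi> (turn s u))" for s
    unfolding \<phi>_def turn_simps by (intro continuous_intros)
  have zero: "integral punctured_ball (F k) = 0" for k
  proof -
    have "integral punctured_ball (F k) = sphere_integral (\<lambda>u. inverse (t k) * (\<phi> (turn (t k) u) +
        (-1) * \<phi> u))"
      unfolding sphere_integral_def F_def by (simp add: divide_inverse mult.commute)
    also have "\<dots> = inverse (t k) * (sphere_integral (\<lambda>u. \<phi> (turn (t k) u)) + (-1) * sphere_integral \<phi>)"
      unfolding sphere_integral_scale by (subst sphere_integral_add) (auto intro!: contT cont
          continuous_intros simp: sphere_integral_scale[of "-1", simplified])
    finally show ?thesis
      by (simp add: sphere_integral_rotate[OF orthogonal_turn cont(1)])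
  qed
  have "(\<lambda>k. integral punctured_ball (F k)) \<longlonglongrightarrow> integral punctured_ball (\<lambda>v. norm v * \<psi> (sgn v))"
  proof (rule dominated_convergence(2))
    show "F k integrable_on punctured_ball" for k
    proof -
      have "continuous_on S2 (\<lambda>u. (\<phi> (turn (t k) u) - \<phi> u) / t k)"
        by (intro continuous_intros contT cont) (use t0 in auto)
      from sphere_integral_integrable[OF this] show ?thesis
        unfolding F_def using set_lebesgue_integral_eq_integral(1) by blast
    qed
    show "(\<lambda>v::real^3. K) integrable_on punctured_ball"
      by (rule integrable_on_const[OF punctured_ball_lmeasurable])
    fix v assume v: "v \<in> punctured_ball"
    then have u: "sgn v \<in> S2"
      by (simp add: norm_sgn)
    show "norm (F k v) \<le> K" for k
    proof -
      have "\<exists>s. 0 < s \<and> s < t k \<and> \<phi> (turn (t k) (sgn v)) - \<phi> (turn 0 (sgn v)) =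
          (t k - 0) * \<psi> (turn s (sgn v))"
        by (rule MVT2[OF t0(2)]) (rule D)
      moreover have "turn 0 (sgn v) = sgn v"
        by (simp add: vec_eq_iff forall_3)
      ultimately obtain s where "(\<phi> (turn (t k) (sgn v)) - \<phi> (sgn v)) / t k = \<psi> (turn s (sgn v))"
        using t0 by (auto simp: field_simps)
      then have "F k v = norm v * \<psi> (turn s (sgn v))"
        by (simp add: F_def)
      also have "norm \<dots> \<le> 1 * K"
        unfolding norm_mult using v K[OF turn_S2[OF u, of s]] by (intro mult_mono) auto
      finally show ?thesis by simp
    qed
    have lim: "((\<lambda>s. (\<phi> (turn (0 + s) (sgn v)) - \<phi> (turn 0 (sgn v))) / s) \<longlongrightarrow> \<psi> (turn 0 (sgn v))) (at 0)"
      using D[of "sgn v" 0] by (simp only: DERIV_def)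
    have turn0: "turn 0 (sgn v) = sgn v"
      by (simp add: vec_eq_iff forall_3)
    have "filterlim t (at 0) sequentially"
      unfolding t_def filterlim_at using LIMSEQ_inverse_real_of_nat by auto
    from filterlim_compose[OF lim this]
    have "(\<lambda>k. (\<phi> (turn (0 + t k) (sgn v)) - \<phi> (sgn v)) / t k) \<longlonglongrightarrow> \<psi> (sgn v)"
      unfolding turn0 .
    then have "(\<lambda>k. (\<phi> (turn (t k) (sgn v)) - \<phi> (sgn v)) / t k) \<longlonglongrightarrow> \<psi> (sgn v)"
      by simp
    then show "(\<lambda>k. F k v) \<longlonglongrightarrow> norm v * \<psi> (sgn v)"
      unfolding F_def by (intro tendsto_intros)
  qed
  then have "integral punctured_ball (\<lambda>v. norm v * \<psi> (sgn v)) = 0"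
    unfolding zero using LIMSEQ_unique tendsto_const by blast
  then show ?thesis
    by (simp add: sphere_integral_def \<psi>_def)
qed

lemma sphere_integral_swap:
  assumes "continuous_on S2 \<phi>"
  shows "sphere_integral (\<lambda>u. \<phi> (vector [u$2, u$1, u$3])) = sphere_integral \<phi>"
proof (rule sphere_integral_rotate[OF _ assms])
  have "norm (vector [u$2, u$1, u$3] :: real^3) = norm u" for u :: "real^3"
    by (simp add: norm_vec_def L2_set_def sum_3 add.commute)
  moreover have "linear (\<lambda>u::real^3. vector [u$2, u$1, u$3] :: real^3)"
    by unfold_locales (simp_all add: vec_eq_iff forall_3)
  ultimately show "orthogonal_transformation (\<lambda>u::real^3. vector [u$2, u$1, u$3] :: real^3)"
    by (simp add: orthogonal_transformation)
qed

text \<open>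
  The second identity says that \<open>((1 - z\<^sup>2) W)'\<close> has integral zero. It is the first one added to its
  counterpart for \<open>y\<close>, by \<open>x\<^sup>2 + y\<^sup>2 = 1 - z\<^sup>2\<close>.
\<close>

lemma sphere_integral_zonal:
  fixes W :: "real poly"
  shows "sphere_integral (\<lambda>u. (u$1)\<^sup>2 * poly (pderiv W) (u$3)) = sphere_integral (\<lambda>u. u$3 * poly W (u$3))"
    "sphere_integral (\<lambda>u. (1 - (u$3)\<^sup>2) * poly (pderiv W) (u$3) + (-2) * (u$3 * poly W (u$3))) = 0"
proof -
  define a b c where "a u = (u$1)\<^sup>2 * poly (pderiv W) (u$3)" and "b u = (u$2)\<^sup>2 * poly (pderiv W) (u$3)"
    and "c u = u$3 * poly W (u$3)" for u :: "real^3"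
  have cont: "continuous_on S a" "continuous_on S b" "continuous_on S c" for S
    unfolding a_def b_def c_def by (intro continuous_intros)+
  have "sphere_integral (\<lambda>u. a u + (-1) * c u) = 0"
    using sphere_integral_infinitesimal_rotation[of W] by (simp add: a_def c_def)
  then have ac: "sphere_integral a = sphere_integral c"
    by (subst (asm) sphere_integral_add) (auto intro!: cont continuous_intros simp:
        sphere_integral_scale[of "-1", simplified])
  then show "sphere_integral (\<lambda>u. (u$1)\<^sup>2 * poly (pderiv W) (u$3)) =
      sphere_integral (\<lambda>u. u$3 * poly W (u$3))"
    by (simp add: a_def[abs_def] c_def[abs_def])
  have ba: "sphere_integral b = sphere_integral a"
    using sphere_integral_swap[OF cont(1)] by (simp add: a_def b_def[abs_def])
  have "sphere_integral (\<lambda>u. (1 - (u$3)\<^sup>2) * poly (pderiv W) (u$3) + (-2) * (u$3 * poly W (u$3))) =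
      sphere_integral (\<lambda>u. (a u + b u) + (-2) * c u)"
  proof (rule sphere_integral_cong)
    fix u assume "u \<in> S2"
    then have *: "1 - (u$3)\<^sup>2 = (u$1)\<^sup>2 + (u$2)\<^sup>2"
      unfolding S2_coordinates by simp
    show "(1 - (u$3)\<^sup>2) * poly (pderiv W) (u$3) + (-2) * (u$3 * poly W (u$3)) = (a u + b u) + (-2) * c u"
      unfolding * by (simp add: a_def b_def c_def algebra_simps)
  qed
  also have "\<dots> = sphere_integral a + sphere_integral b + (-2) * sphere_integral c"
    by (subst sphere_integral_add sphere_integral_scale | (intro continuous_intros cont)[1])+ simp
  finally show "sphere_integral (\<lambda>u. (1 - (u$3)\<^sup>2) * poly (pderiv W) (u$3) + (-2) * (u$3 * poly W
      (u$3))) = 0"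
    using ac ba by simp
qed

text \<open>
  With \<open>P\<close> the Legendre polynomial, the integral of \<open>x\<^sup>2 P' z\<close> equals that of \<open>z P z\<close>. The choice
  \<open>W = z P' - P\<close> turns \<open>((1 - z\<^sup>2) W)'\<close> into \<open>(2 - l (l + 1)) z P\<close> by the Legendre equation, and the
  factor is not zero for \<open>l \<ge> 2\<close>.
\<close>

lemma sph_harm_1_orthogonal:
  assumes "2 \<le> l"
  shows "sphere_integral (\<lambda>u. sph_harm l 1 u * u$1) = 0"
proof -
  define P where "P = legendre_deriv l 0"
  define \<Lambda> where "\<Lambda> = real l * (real l + 1)"
  have \<Lambda>: "\<Lambda> > 2"
    using assms mult_mono[of 2 "real l" 3 "real l + 1"] by (simp add: \<Lambda>_def)
  have P': "pderiv P = legendre_deriv l 1" "pderiv (pderiv P) = legendre_deriv l 2"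
    by (simp_all add: P_def numeral_2_eq_2 flip: legendre_deriv_Suc)
  have ode: "(1 - z\<^sup>2) * poly (pderiv (pderiv P)) z = 2 * z * poly (pderiv P) z - \<Lambda> * poly P z" for z
    using legendre_deriv_ode[of z l 0] unfolding P'(2) unfolding P'(1)
    by (simp add: P_def \<Lambda>_def numeral_2_eq_2 algebra_simps)
  define W where "W = [:0, 1:] * pderiv P - P"
  have W': "pderiv W = [:0, 1:] * pderiv (pderiv P)"
    by (simp add: W_def pderiv_diff pderiv_mult pderiv_pCons)
  have "0 = sphere_integral (\<lambda>u. (1 - (u$3)\<^sup>2) * poly (pderiv W) (u$3) + (-2) * (u$3 * poly W (u$3)))"
    by (rule sphere_integral_zonal(2)[symmetric])
  also have "\<dots> = sphere_integral (\<lambda>u. (2 - \<Lambda>) * (u$3 * poly P (u$3)))"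
  proof (rule sphere_integral_cong)
    fix u :: "real^3"
    define z where "z = u$3"
    have "(1 - z\<^sup>2) * poly (pderiv W) z = z * ((1 - z\<^sup>2) * poly (pderiv (pderiv P)) z)"
      by (simp add: W')
    also have "\<dots> = z * (2 * z * poly (pderiv P) z - \<Lambda> * poly P z)"
      unfolding ode ..
    finally have *: "(1 - z\<^sup>2) * poly (pderiv W) z = z * (2 * z * poly (pderiv P) z - \<Lambda> * poly P z)" .
    show "(1 - (u$3)\<^sup>2) * poly (pderiv W) (u$3) + (-2) * (u$3 * poly W (u$3)) =
        (2 - \<Lambda>) * (u$3 * poly P (u$3))"
      unfolding z_def[symmetric] * by (simp add: W_def algebra_simps)
  qed
  also have "\<dots> = (2 - \<Lambda>) * sphere_integral (\<lambda>u. u$3 * poly P (u$3))"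
    by (rule sphere_integral_scale)
  finally have "sphere_integral (\<lambda>u. u$3 * poly P (u$3)) = 0"
    using \<Lambda> by simp
  then have "sphere_integral (\<lambda>u. (u$1)\<^sup>2 * poly (pderiv P) (u$3)) = 0"
    by (simp add: sphere_integral_zonal(1))
  moreover have "sphere_integral (\<lambda>u. sph_harm l 1 u * u$1) =
      sphere_integral (\<lambda>u. (u$1)\<^sup>2 * poly (pderiv P) (u$3))"
    by (rule sphere_integral_cong) (simp only: sph_harm_eq_harmonic[OF _ order_refl],
        simp add: harmonic_def P' power2_eq_square)
  ultimately show ?thesis
    by simp
qed

section \<open>The centroid to second order\<close>

lemma has_derivative_along_rays:
  assumes X: "has_sphere_gradient g (sgn v) X" and "v \<noteq> 0"
  shows "((\<lambda>x. g (sgn x)) has_derivative (\<lambda>h. (X /\<^sub>R norm v) \<bullet> h)) (at v)"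
proof -
  have "((\<lambda>x. x /\<^sub>R norm v) has_derivative (\<lambda>h. h /\<^sub>R norm v)) (at v)"
    by (auto intro!: derivative_eq_intros)
  moreover have "((\<lambda>x. g (sgn x)) has_derivative (\<lambda>h. h \<bullet> X)) (at (v /\<^sub>R norm v))"
    using X by (simp add: has_sphere_gradient_def gderiv_def sgn_div_norm)
  ultimately have "((\<lambda>x. g (sgn (x /\<^sub>R norm v))) has_derivative (\<lambda>h. (h /\<^sub>R norm v) \<bullet> X)) (at v)"
    by (rule has_derivative_compose)
  moreover have "sgn (x /\<^sub>R norm v) = sgn x" for x :: "real^3"
    using assms(2) by (simp add: sgn_scaleR)
  ultimately show ?thesis
    by (simp add: inner_commute)
qed

text \<open>
  The matrix determinant lemma in dimension three.
\<close>

lemma det_scaling_plus_rank_one: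
  fixes v w :: "real^3"
  shows "det (matrix (\<lambda>h. s *\<^sub>R h + (w \<bullet> h) *\<^sub>R v)) = s ^ 3 + s\<^sup>2 * (w \<bullet> v)"
  by (simp add: det_3 matrix_def inner_axis axis_def inner_vec_def sum_3 power2_eq_square
      power3_eq_cube algebra_simps)

text \<open>
  The map \<open>v \<mapsto> (1 + \<epsilon> g (sgn v)) v\<close> takes the unit ball to the body. Its derivative is \<open>s\<close> times the
  identity, \<open>s\<close> being the factor \<open>1 + \<epsilon> g (sgn v)\<close>, plus a map of rank one with image spanned by \<open>v\<close>
  and with \<open>v\<close> in its kernel, since \<open>s\<close> is constant along rays. So the Jacobian is \<open>s^3\<close>, and one more
  factor \<open>s\<close> comes from the integrand. The origin is left out because \<^const>\<open>sgn\<close> is discontinuous there.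
\<close>

lemma integral_body_radial:
  assumes X: "\<And>u. u \<in> S2 \<Longrightarrow> has_sphere_gradient g u (X u)" and g: "continuous_on S2 g"
    and pos: "positive_radius g \<epsilon>"
  shows "integral (body g \<epsilon>) (\<lambda>x. x) = integral punctured_ball (\<lambda>v. (1 + \<epsilon> * g (sgn v)) ^ 4 *\<^sub>R v)"
proof -
  define s where "s v = 1 + \<epsilon> * g (sgn v)" for v
  have spos: "s v > 0" if "v \<noteq> 0" for v
    using pos sgn_in_S2[OF that] by (simp add: s_def positive_radius_def)
  define \<Phi> where "\<Phi> v = s v *\<^sub>R v" for v
  define w where "w v = \<epsilon> *\<^sub>R (X (sgn v) /\<^sub>R norm v)" for v
  have sgn\<Phi>: "sgn (\<Phi> v) = sgn v" if "v \<noteq> 0" for v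
    using spos[OF that] by (simp add: \<Phi>_def sgn_scaleR)
  have wv: "w v \<bullet> v = 0" if "v \<noteq> 0" for v
  proof -
    have "X (sgn v) \<bullet> sgn v = 0"
      by (rule has_sphere_gradient_orthogonal[OF X[OF sgn_in_S2[OF that]]])
    then show ?thesis
      using that by (simp add: w_def sgn_div_norm)
  qed
  have der: "(\<Phi> has_derivative (\<lambda>h. s v *\<^sub>R h + (w v \<bullet> h) *\<^sub>R v)) (at v within punctured_ball)"
    if "v \<in> punctured_ball" for v
  proof -
    have v0: "v \<noteq> 0" using that by auto
    have "(s has_derivative (\<lambda>h. w v \<bullet> h)) (at v)"
      unfolding s_def[abs_def] w_def
      by (auto intro!: derivative_eq_intros has_derivative_along_rays[OF X[OF sgn_in_S2[OF v0]] v0])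
    then have "(\<Phi> has_derivative (\<lambda>h. s v *\<^sub>R h + (w v \<bullet> h) *\<^sub>R v)) (at v)"
      unfolding \<Phi>_def[abs_def] by (auto intro!: derivative_eq_intros)
    then show ?thesis
      by (rule has_derivative_at_withinI)
  qed
  have inj: "inj_on \<Phi> punctured_ball"
  proof (rule inj_onI)
    fix x y assume xy: "x \<in> punctured_ball" "y \<in> punctured_ball" "\<Phi> x = \<Phi> y"
    then have "sgn x = sgn y"
      using sgn\<Phi>[of x] sgn\<Phi>[of y] by simp
    then have "s x = s y" by (simp add: s_def)
    then show "x = y"
      using xy spos[of x] by (simp add: \<Phi>_def)
  qed
  have image: "\<Phi> ` punctured_ball = body g \<epsilon> - {0}"
  proof
    show "\<Phi> ` punctured_ball \<subseteq> body g \<epsilon> - {0}"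
    proof
      fix y assume "y \<in> \<Phi> ` punctured_ball"
      then obtain v where "v \<in> punctured_ball" "y = \<Phi> v" by blast
      then have v: "y = \<Phi> v" "v \<noteq> 0" "norm v \<le> 1" by auto
      have "y = (s v * norm v) *\<^sub>R sgn v"
        using v by (simp add: \<Phi>_def sgn_div_norm)
      moreover have "s v * norm v \<le> 1 + \<epsilon> * g (sgn v)"
        using v spos[OF v(2)] mult_left_le[of "norm v" "s v"] by (simp add: s_def)
      moreover have "0 \<le> s v * norm v" "y \<noteq> 0"
        using v spos[OF v(2)] by (auto simp: \<Phi>_def)
      ultimately show "y \<in> body g \<epsilon> - {0}"
        using sgn_in_S2[OF v(2)] unfolding body_def by blast
    qed
    show "body g \<epsilon> - {0} \<subseteq> \<Phi> ` punctured_ball"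
    proof
      fix y assume "y \<in> body g \<epsilon> - {0}"
      then obtain t u where y: "y = t *\<^sub>R u" "u \<in> S2" "0 \<le> t" "t \<le> 1 + \<epsilon> * g u" "y \<noteq> 0"
        by (auto simp: body_def)
      then have t: "t > 0" by (cases "t = 0") auto
      have su: "sgn u = u" using y(2) by simp
      have r: "1 + \<epsilon> * g u > 0"
        using pos y(2) by (simp add: positive_radius_def)
      define v where "v = (t / (1 + \<epsilon> * g u)) *\<^sub>R u"
      have "sgn v = u"
        using t r su by (simp add: v_def sgn_scaleR)
      then have "\<Phi> v = y"
        using r by (simp add: \<Phi>_def s_def v_def y(1))
      moreover have "v \<in> punctured_ball"
        using y t r by (auto simp: v_def divide_le_eq)
      ultimately show "y \<in> \<Phi> ` punctured_ball" by blast
    qed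
  qed
  have "(\<lambda>x. x) absolutely_integrable_on (body g \<epsilon> - {0}) \<longleftrightarrow> (\<lambda>x. x) absolutely_integrable_on body g \<epsilon>"
    by (rule absolutely_integrable_spike_set_eq) (simp_all add: empty_iff[abs_def] set_diff_eq cong:
        conj_cong)
  then have abs: "(\<lambda>x. x) absolutely_integrable_on \<Phi> ` punctured_ball"
    using absolutely_integrable_id_compact(1)[OF compact_body[OF g pos]] by (simp add: image)
  have "integral (body g \<epsilon>) (\<lambda>x. x) = integral (\<Phi> ` punctured_ball) (\<lambda>x. x)"
    unfolding image by (rule integral_spike_set) (simp_all add: set_diff_eq cong: conj_cong)
  also have "\<dots> = integral punctured_ball (\<lambda>v. \<bar>det (matrix (\<lambda>h. s v *\<^sub>R h + (w v \<bullet> h) *\<^sub>R v))\<bar> *\<^sub>R \<Phi> v)"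
    using has_absolute_integral_change_of_variables[OF punctured_ball_lebesgue der inj, of "\<lambda>x. x"
        "integral (\<Phi> ` punctured_ball) (\<lambda>x. x)"] abs by simp
  also have "\<dots> = integral punctured_ball (\<lambda>v. (1 + \<epsilon> * g (sgn v)) ^ 4 *\<^sub>R v)"
  proof (rule integral_cong)
    fix v assume "v \<in> punctured_ball"
    then have v: "v \<noteq> 0" by auto
    show "\<bar>det (matrix (\<lambda>h. s v *\<^sub>R h + (w v \<bullet> h) *\<^sub>R v))\<bar> *\<^sub>R \<Phi> v = (1 + \<epsilon> * g (sgn v)) ^ 4 *\<^sub>R v"
      unfolding det_scaling_plus_rank_one using spos[OF v] wv[OF v]
      by (simp add: \<Phi>_def eval_nat_numeral flip: s_def)
  qed
  finally show ?thesis .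
qed

lemma sphere_integral_bound:
  assumes "continuous_on S2 \<phi>" "\<And>u. u \<in> S2 \<Longrightarrow> \<bar>\<phi> u\<bar> \<le> K"
  shows "\<bar>sphere_integral \<phi>\<bar> \<le> K * measure lebesgue punctured_ball"
proof -
  have "norm (sphere_integral \<phi>) \<le> integral punctured_ball (\<lambda>v. K)"
    unfolding sphere_integral_def
  proof (rule integral_norm_bound_integral)
    show "(\<lambda>v. norm v * \<phi> (sgn v)) integrable_on punctured_ball"
      by (rule set_lebesgue_integral_eq_integral(1)[OF sphere_integral_integrable[OF assms(1)]])
    show "(\<lambda>v::real^3. K) integrable_on punctured_ball"
      by (rule integrable_on_const[OF punctured_ball_lmeasurable])
    show "norm (norm v * \<phi> (sgn v)) \<le> K" if "v \<in> punctured_ball" for v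
      using mult_mono[of "norm v" 1 "\<bar>\<phi> (sgn v)\<bar>" K] assms(2)[OF sgn_in_S2, of v] that
      by (auto simp: abs_mult)
  qed
  also have "\<dots> = K * measure lebesgue punctured_ball"
    using lmeasure_integral[OF punctured_ball_lmeasurable] integral_mult_right[of punctured_ball K "\<lambda>_. 1"]
    by simp
  finally show ?thesis by simp
qed

lemma sphere_integral_coordinate: "sphere_integral (\<lambda>u. u$1) = 0"
proof -
  have "sphere_integral (\<lambda>u. (- u)$1) = sphere_integral (\<lambda>u. u$1)"
    by (rule sphere_integral_rotate[of uminus]) (auto simp: orthogonal_transformation linear_uminus
        intro!: continuous_intros)
  then show ?thesis
    using sphere_integral_scale[of "-1" "\<lambda>u. u$1"] by simp
qed

text \<open>
  In the expansion of the integral of \<open>(1 + \<epsilon> g)^4 x\<close>, the constant term vanishes by symmetry and the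
  linear one by orthogonality; \<open>q\<close> collects the rest. For small \<open>\<epsilon>\<close> the body contains the ball of
  radius \<open>1/2\<close>, which bounds its volume from below.
\<close>

lemma centroid_quadratic:
  assumes l: "2 \<le> l"
  shows "\<exists>\<delta>>0. \<exists>K\<ge>0. \<forall>\<epsilon>. \<bar>\<epsilon>\<bar> < \<delta> \<longrightarrow> positive_radius (sph_harm l 1) \<epsilon> \<and>
    \<bar>centroid (body (sph_harm l 1) \<epsilon>) $ 1\<bar> \<le> K * \<epsilon>\<^sup>2"
proof -
  define g where "g = sph_harm l 1"
  have contg: "continuous_on S2 g"
    unfolding g_def by (rule continuous_on_sph_harm) simp
  obtain M0 where M0: "\<And>u. u \<in> S2 \<Longrightarrow> \<bar>g u\<bar> \<le> M0"
    using S2_bounded[OF contg] by blast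
  define M where "M = max M0 1"
  have M: "M \<ge> 1" "\<And>u. u \<in> S2 \<Longrightarrow> \<bar>g u\<bar> \<le> M"
    using M0 by (auto simp: M_def intro: order_trans max.cobounded1)
  define \<delta> where "\<delta> = 1 / (2 * M)"
  define V where "V = measure lborel (ball (0::real^3) (1/2))"
  define K where "K = 11 * M\<^sup>2 * measure lebesgue punctured_ball / V"
  have V: "V > 0"
    unfolding V_def by (rule content_ball_pos) simp
  have \<epsilon>g: "\<bar>\<epsilon> * g u\<bar> \<le> 1 / 2" if "\<bar>\<epsilon>\<bar> < \<delta>" "u \<in> S2" for \<epsilon> u
  proof -
    have "\<bar>\<epsilon> * g u\<bar> \<le> \<delta> * M"
      unfolding abs_mult using that M by (intro mult_mono) (auto simp: \<delta>_def)
    then show ?thesis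
      using M(1) by (simp add: \<delta>_def)
  qed
  have pos: "positive_radius g \<epsilon>" if "\<bar>\<epsilon>\<bar> < \<delta>" for \<epsilon>
    unfolding positive_radius_def using \<epsilon>g[OF that] by (smt (verit) field_sum_of_halves)
  have bound: "\<bar>centroid (body g \<epsilon>) $ 1\<bar> \<le> K * \<epsilon>\<^sup>2" if \<epsilon>: "\<bar>\<epsilon>\<bar> < \<delta>" for \<epsilon>
  proof -
    define B where "B = body g \<epsilon>"
    have compB: "compact B"
      unfolding B_def by (rule compact_body[OF contg pos[OF \<epsilon>]])
    have "ball 0 (1/2) \<subseteq> B"
    proof
      fix x :: "real^3" assume x: "x \<in> ball 0 (1/2)"
      show "x \<in> B"
      proof (cases "x = 0")
        case True
        then show ?thesis
          using pos[OF \<epsilon>] by (auto simp: B_def body_def positive_radius_def intro!: exI[of _ 0]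
              exI[of _ "axis 1 1"] less_imp_le)
      next
        case False
        have "norm x \<le> 1 + \<epsilon> * g (sgn x)"
          using x \<epsilon>g[OF \<epsilon> sgn_in_S2[OF False]] by (auto simp: abs_le_iff)
        then show ?thesis
          using sgn_in_S2[OF False] False
          by (auto simp: B_def body_def sgn_div_norm intro!: exI[of _ "norm x"] exI[of _ "sgn x"])
      qed
    qed
    then have VB: "V \<le> measure lborel B"
      unfolding V_def using compB
      by (intro measure_mono_fmeasurable) (auto intro: fmeasurable_compact borel_compact)
    define q where "q u = (6 * (g u)\<^sup>2 + 4 * \<epsilon> * (g u) ^ 3 + \<epsilon>\<^sup>2 * (g u) ^ 4) * u$1" for u
    have contq: "continuous_on S2 q"
      unfolding q_def by (intro continuous_intros contg)
    have qbound: "\<bar>q u\<bar> \<le> 11 * M\<^sup>2" if "u \<in> S2" for u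
    proof -
      define a where "a = \<epsilon> * g u"
      have a: "\<bar>a\<bar> \<le> 1"
        using \<epsilon>g[OF \<epsilon> that] by (simp add: a_def)
      have "q u = (g u)\<^sup>2 * (6 + 4 * a + a\<^sup>2) * u$1"
        by (simp add: q_def a_def algebra_simps eval_nat_numeral)
      moreover have "\<bar>6 + 4 * a + a\<^sup>2\<bar> \<le> 11"
        using a abs_square_le_1[of a] zero_le_power2[of a] by (auto simp: abs_le_iff)
      moreover have "(g u)\<^sup>2 \<le> M\<^sup>2"
        using M(2)[OF that] M(1) by (simp add: abs_le_square_iff[symmetric])
      moreover have "\<bar>u$1\<bar> \<le> 1"
        using component_le_norm_cart[of u 1] that by simp
      ultimately show ?thesis
        using mult_mono[OF mult_mono[of "(g u)\<^sup>2" "M\<^sup>2" "\<bar>6 + 4 * a + a\<^sup>2\<bar>" 11], of "\<bar>u$1\<bar>" 1]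
        by (simp add: abs_mult mult.commute)
    qed
    have lin: "bounded_linear (\<lambda>x::real^3. x $ 1)"
      by (rule bounded_linear_vec_nth)
    have int4: "(\<lambda>v. (1 + \<epsilon> * g (sgn v)) ^ 4 *\<^sub>R v) integrable_on punctured_ball"
    proof (rule set_lebesgue_integral_eq_integral(1)[OF absolutely_integrable_ball_bounded])
      show "continuous_on punctured_ball (\<lambda>v. (1 + \<epsilon> * g (sgn v)) ^ 4 *\<^sub>R v)"
        by (intro continuous_intros continuous_on_subset[OF continuous_on_sgn_comp[OF contg]]) auto
      show "norm ((1 + \<epsilon> * g (sgn v)) ^ 4 *\<^sub>R v) \<le> 2 ^ 4 * 1" if "v \<in> punctured_ball" for v
      proof -
        have "\<bar>1 + \<epsilon> * g (sgn v)\<bar> \<le> 2"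
          using \<epsilon>g[OF \<epsilon> sgn_in_S2, of v] that by (auto simp: abs_le_iff)
        then have "\<bar>1 + \<epsilon> * g (sgn v)\<bar> ^ 4 \<le> 2 ^ 4"
          by (rule power_mono) simp
        then show ?thesis
          unfolding norm_scaleR real_norm_def power_abs using that by (intro mult_mono) auto
      qed
    qed
    have "integral B (\<lambda>x. x) $ 1 = integral punctured_ball (\<lambda>v. (1 + \<epsilon> * g (sgn v)) ^ 4 *\<^sub>R v) $ 1"
      unfolding B_def using pos[OF \<epsilon>] contg
      by (subst integral_body_radial[of g "sph_harm_gradient l 1"]) (auto simp: g_def intro!:
          sph_harm_has_gradient)
    also have "\<dots> = integral punctured_ball (\<lambda>v. (1 + \<epsilon> * g (sgn v)) ^ 4 * v$1)"
      using integral_component_eq_cart[OF int4, of 1] by simp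
    also have "\<dots> = sphere_integral (\<lambda>u. (1 + \<epsilon> * g u) ^ 4 * u$1)"
      unfolding sphere_integral_def by (rule integral_cong) (simp add: sgn_div_norm)
    also have "\<dots> = sphere_integral (\<lambda>u. (u$1 + (4 * \<epsilon>) * (g u * u$1)) + \<epsilon>\<^sup>2 * q u)"
      by (rule sphere_integral_cong) (simp add: q_def eval_nat_numeral algebra_simps)
    also have "\<dots> = sphere_integral (\<lambda>u. u$1) + (4 * \<epsilon>) * sphere_integral (\<lambda>u. g u * u$1) + \<epsilon>\<^sup>2 *
        sphere_integral q"
      by (subst sphere_integral_add sphere_integral_scale | (intro continuous_intros contg contq)[1])+ simp
    also have "\<dots> = \<epsilon>\<^sup>2 * sphere_integral q"
      using sph_harm_1_orthogonal[OF l] by (simp add: sphere_integral_coordinate g_def)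
    finally have "\<bar>integral B (\<lambda>x. x) $ 1\<bar> \<le> \<epsilon>\<^sup>2 * (11 * M\<^sup>2 * measure lebesgue punctured_ball)"
      using sphere_integral_bound[OF contq qbound] by (simp add: abs_mult mult_left_mono)
    then have "\<bar>integral B (\<lambda>x. x) $ 1\<bar> / measure lborel B \<le>
        \<epsilon>\<^sup>2 * (11 * M\<^sup>2 * measure lebesgue punctured_ball) / V"
      using V VB by (intro frac_le) auto
    moreover have "centroid B $ 1 = integral B (\<lambda>x. x) $ 1 / measure lborel B"
      by (simp add: centroid_def absolutely_integrable_id_compact(2)[OF compB])
    ultimately show ?thesis
      using V VB by (simp add: K_def B_def g_def abs_mult mult.commute)
  qed
  have "\<delta> > 0" "K \<ge> 0"
    using M V by (simp_all add: \<delta>_def K_def)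
  with pos bound show ?thesis
    unfolding g_def by blast
qed

section \<open>The harmonics of order one\<close>

lemma has_derivative_vec_nth_at: "((\<lambda>u::real^3. u $ i) has_derivative (\<lambda>h. h $ i)) (at u)"
  by (rule bounded_linear.has_derivative[OF bounded_linear_vec_nth has_derivative_ident])

text \<open>
  The squared distance from the centroid \<open>(a, 0, 0)\<close> is \<open>1 + a\<^sup>2 + 2 \<epsilon>\<close> times this function at the
  parameters \<open>(\<epsilon>, \<kappa>)\<close> with \<open>a = \<epsilon> \<kappa>\<close>. Dividing by \<open>\<epsilon>\<close> is what keeps the limit nondegenerate.
\<close>

definition perturbed :: "nat \<Rightarrow> real \<times> real \<Rightarrow> real^3 \<Rightarrow> real"
  where "perturbed l q u = (let \<epsilon> = fst q; \<kappa> = snd q; x = u$1; Q = poly (legendre_deriv l 1) (u$3) in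
    x * Q + \<epsilon> / 2 * (x * Q) * (x * Q) - \<kappa> * (1 + \<epsilon> * (x * Q)) * x)"

definition perturbed_grad :: "nat \<Rightarrow> real \<times> real \<Rightarrow> real^3 \<Rightarrow> real^3"
  where "perturbed_grad l q u = (let \<epsilon> = fst q; \<kappa> = snd q; x = u$1;
      Q = poly (legendre_deriv l 1) (u$3); Q' = poly (legendre_deriv l 2) (u$3) in
    (Q + \<epsilon> * x * Q * Q - \<kappa> - 2 * \<kappa> * \<epsilon> * x * Q) *\<^sub>R axis 1 1
    + (x * Q' * (1 + \<epsilon> * x * Q - \<kappa> * \<epsilon> * x)) *\<^sub>R axis 3 1)"

definition perturbed_hess :: "nat \<Rightarrow> real \<times> real \<Rightarrow> real^3 \<Rightarrow> real^3 \<Rightarrow> real^3"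
  where "perturbed_hess l q u h = (let \<epsilon> = fst q; \<kappa> = snd q; x = u$1;
      Q = poly (legendre_deriv l 1) (u$3); Q' = poly (legendre_deriv l 2) (u$3);
      Q'' = poly (legendre_deriv l 3) (u$3);
      xx = \<epsilon> * Q * Q - 2 * \<kappa> * \<epsilon> * Q; xz = Q' + 2 * \<epsilon> * x * Q * Q' - 2 * \<kappa> * \<epsilon> * x * Q';
      zz = x * Q'' + \<epsilon> * x * x * (Q' * Q' + Q * Q'') - \<kappa> * \<epsilon> * x * x * Q'' in
    (xx * h$1 + xz * h$3) *\<^sub>R axis 1 1 + (xz * h$1 + zz * h$3) *\<^sub>R axis 3 1)"

lemma perturbed_family: "sphere_family (perturbed l) (perturbed_grad l) (perturbed_hess l)"
proof
  define P1 P2 P3 where "P1 = legendre_deriv l 1" and "P2 = legendre_deriv l 2"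
      and "P3 = legendre_deriv l 3"
  note P = P1_def[symmetric] P2_def[symmetric] P3_def[symmetric]
  have "pderiv P1 = P2" "pderiv P2 = P3"
    by (simp_all add: P1_def P2_def P3_def numeral_2_eq_2 numeral_3_eq_3 flip: legendre_deriv_Suc)
  then have D1: "((\<lambda>u::real^3. poly P1 (u$3)) has_derivative (\<lambda>h. poly P2 (u$3) * h$3)) (at u)"
    and D2: "((\<lambda>u::real^3. poly P2 (u$3)) has_derivative (\<lambda>h. poly P3 (u$3) * h$3)) (at u)" for u
    using has_derivative_poly_nth[of P1 3 u] has_derivative_poly_nth[of P2 3 u] by simp_all
  show "GDERIV (perturbed l q) u :> perturbed_grad l q u" for q u
    unfolding gderiv_def perturbed_def[abs_def] perturbed_grad_def Let_def P
    by (auto intro!: derivative_eq_intros D1 has_derivative_vec_nth_at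
        simp: inner_add_right inner_axis algebra_simps)
  show "(perturbed_grad l q has_derivative perturbed_hess l q u) (at u)" for q u
    unfolding perturbed_grad_def[abs_def] perturbed_hess_def[abs_def] Let_def P
    by (auto intro!: derivative_eq_intros D1 D2 has_derivative_vec_nth_at
        simp: fun_eq_iff algebra_simps)
  show "perturbed_hess l q u h \<bullet> k = h \<bullet> perturbed_hess l q u k" for q u h k
    by (simp add: perturbed_hess_def Let_def inner_add_left inner_add_right inner_axis inner_axis'
        algebra_simps)
  show "continuous_on UNIV (\<lambda>z. perturbed_grad l (fst z) (snd z))"
    unfolding perturbed_grad_def Let_def by (intro continuous_intros)
  show "continuous_on UNIV (\<lambda>z. perturbed_hess l (fst (fst z)) (snd (fst z)) (snd z))"
    unfolding perturbed_hess_def Let_def by (intro continuous_intros)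
qed

lemma perturbed_0: "perturbed l (0, 0) u = harmonic l 1 u"
  by (simp add: perturbed_def harmonic_def)

text \<open>
  Let \<open>h\<close> be in the kernel of the Hessian at \<open>p = (x, y, z)\<close>, and \<open>\<mu>\<close> the normal component of the
  gradient. If \<open>y \<noteq> 0\<close>, then \<open>\<mu> = 0\<close>, \<open>Q z = 0\<close> and \<open>x = 0\<close>, and the Hessian is a nonzero multiple of
  the hyperbolic form \<open>h\<^sub>1 h\<^sub>3\<close>. If \<open>y = 0\<close>, the Hessian is diagonal: across the meridian it is
  \<open>- \<mu> \<noteq> 0\<close>, and along it \<open>\<mu> (1 - l (l + 1) (1 - z\<^sup>2))\<close> by the Legendre equation, which is not zero by
  the Sturm argument. The number \<open>\<eta>\<close> below is the component of \<open>h\<close> along the meridian.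
\<close>

lemma sph_harm_1_nondegenerate:
  assumes l: "2 \<le> l" and p: "p \<in> critical_points (perturbed l (0, 0))"
  shows "sphere_family.nondegenerate (perturbed_grad l) (perturbed_hess l) (0, 0) p"
proof -
  interpret sphere_family "perturbed l" "perturbed_grad l" "perturbed_hess l"
    by (rule perturbed_family)
  define x y z where "x = p$1" and "y = p$2" and "z = p$3"
  define Q Q' Q'' where "Q = poly (legendre_deriv l 1) z" and "Q' = poly (legendre_deriv l 2) z"
    and "Q'' = poly (legendre_deriv l 3) z"
  define \<Lambda> where "\<Lambda> = real l * (real l + 1)"
  define \<mu> where "\<mu> = perturbed_grad l (0, 0) p \<bullet> p"
  have norm: "x\<^sup>2 + y\<^sup>2 + z\<^sup>2 = 1"
    using p S2_coordinates[of p] unfolding critical_iff by (simp add: x_def y_def z_def)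
  have "perturbed_grad l (0, 0) p = \<mu> *\<^sub>R p"
    using p by (simp add: critical_iff tangential_grad_def \<mu>_def)
  moreover have "perturbed_grad l (0, 0) p = Q *\<^sub>R axis 1 1 + (x * Q') *\<^sub>R axis 3 1"
    by (simp add: perturbed_grad_def Q_def Q'_def x_def z_def)
  ultimately have "Q *\<^sub>R axis 1 1 + (x * Q') *\<^sub>R axis 3 1 = \<mu> *\<^sub>R p" by simp
  then have crit: "Q = \<mu> * x" "\<mu> * y = 0" "x * Q' = \<mu> * z"
    by (simp_all add: vec_eq_iff forall_3 axis_def x_def y_def z_def)
  have ode: "(1 - z\<^sup>2) * Q'' = 4 * z * Q' - (\<Lambda> - 2) * Q"
  proof -
    have "(z\<^sup>2 - 1) * poly (legendre_deriv l (1 + 2)) z + 2 * (real 1 + 1) * z * poly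
        (legendre_deriv l (1 + 1)) z
      = (real l - real 1) * (real l + real 1 + 1) * poly (legendre_deriv l 1) z"
      by (rule legendre_deriv_ode)
    moreover have three: "1 + 2 = (3::nat)" "1 + 1 = (2::nat)" by simp_all
    ultimately show ?thesis
      unfolding three by (simp add: Q_def Q'_def Q''_def \<Lambda>_def one_add_one algebra_simps)
  qed
  have pole: "Q \<noteq> 0" if "z\<^sup>2 = 1"
    unfolding Q_def by (rule legendre_deriv_at_pole) (use l that in auto)
  have simple: "Q' \<noteq> 0" if "z\<^sup>2 \<noteq> 1" "Q = 0"
    using legendre_deriv_simple_roots[of 1 l z] that l by (simp add: Q_def Q'_def numeral_2_eq_2)
  show ?thesis
    unfolding nondegenerate_def
  proof (intro allI impI)
    fix h :: "real^3" and c assume hp: "h \<bullet> p = 0"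
      and "perturbed_hess l (0, 0) p h - (perturbed_grad l (0, 0) p \<bullet> p) *\<^sub>R h = c *\<^sub>R p"
    then have "(Q' * h$3) *\<^sub>R axis 1 1 + (Q' * h$1 + x * Q'' * h$3) *\<^sub>R axis 3 1 - \<mu> *\<^sub>R h = c *\<^sub>R p"
      by (simp add: perturbed_hess_def Let_def Q_def Q'_def Q''_def x_def z_def \<mu>_def)
    then have eqs: "Q' * h$3 - \<mu> * h$1 = c * x" "- \<mu> * h$2 =
        c * y" "Q' * h$1 + x * Q'' * h$3 - \<mu> * h$3 = c * z"
      by (simp_all add: vec_eq_iff forall_3 axis_def x_def y_def z_def)
    have orth: "h$1 * x + h$2 * y + h$3 * z = 0"
      using hp by (simp add: inner_vec_def sum_3 x_def y_def z_def)
    show "h = 0"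
    proof (cases "y = 0")
      case False
      then have "\<mu> = 0" using crit(2) by simp
      then have "Q = 0" using crit by simp
      then have "z\<^sup>2 \<noteq> 1" using pole by blast
      then have "Q' \<noteq> 0" using simple \<open>Q = 0\<close> by blast
      then have "x = 0" using crit(3) \<open>\<mu> = 0\<close> by simp
      have "c = 0" using eqs(2) \<open>\<mu> = 0\<close> False by simp
      then have "h$3 = 0" "h$1 = 0"
        using eqs \<open>\<mu> = 0\<close> \<open>x = 0\<close> \<open>Q' \<noteq> 0\<close> by auto
      then show ?thesis
        using orth False by (simp add: vec_eq_iff forall_3)
    next
      case True
      have xz: "x\<^sup>2 = 1 - z\<^sup>2"
        using norm True by simp
      have "x \<noteq> 0"
      proof
        assume "x = 0"
        then show False
          using pole xz crit(1) by simp
      qed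
      have "\<mu> \<noteq> 0"
      proof
        assume "\<mu> = 0"
        then have "Q = 0" "Q' = 0"
          using crit \<open>x \<noteq> 0\<close> by auto
        then show False
          using pole simple by blast
      qed
      then have h2: "h$2 = 0"
        using eqs(2) True by simp
      define \<eta> where "\<eta> = z * h$1 - x * h$3"
      have h1: "h$1 = z * \<eta>"
      proof -
        have "z * \<eta> = h$1 * (x\<^sup>2 + z\<^sup>2) - x * (h$1 * x + h$2 * y + h$3 * z)"
          by (simp add: \<eta>_def True power2_eq_square algebra_simps)
        then show ?thesis
          using orth xz by simp
      qed
      have h3: "h$3 = - (x * \<eta>)"
      proof -
        have "- (x * \<eta>) = h$3 * (x\<^sup>2 + z\<^sup>2) - z * (h$1 * x + h$2 * y + h$3 * z)"
          by (simp add: \<eta>_def True power2_eq_square algebra_simps)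
        then show ?thesis
          using orth xz by simp
      qed
      have "0 = z * (c * x) - x * (c * z)"
        by simp
      also have "\<dots> = z * (Q' * h$3 - \<mu> * h$1) - x * (Q' * h$1 + x * Q'' * h$3 - \<mu> * h$3)"
        unfolding eqs ..
      also have "\<dots> = \<eta> * (x * (x\<^sup>2 * Q'') - 2 * z * (x * Q') - \<mu> * (x\<^sup>2 + z\<^sup>2))"
        unfolding h1 h3 by (simp add: power2_eq_square algebra_simps)
      also have "x\<^sup>2 * Q'' = 4 * z * Q' - (\<Lambda> - 2) * Q"
        unfolding xz by (rule ode)
      also have "x * (4 * z * Q' - (\<Lambda> - 2) * Q) - 2 * z * (x * Q') - \<mu> * (x\<^sup>2 + z\<^sup>2)
          = 2 * z * (x * Q') - (\<Lambda> - 2) * (x * Q) - \<mu> * (x\<^sup>2 + z\<^sup>2)"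
        by (simp add: algebra_simps)
      also have "\<dots> = \<mu> * (1 - \<Lambda> * (1 - z\<^sup>2))"
      proof -
        have "2 * z * (x * Q') - (\<Lambda> - 2) * (x * Q) - \<mu> * (x\<^sup>2 + z\<^sup>2)
            = \<mu> * (2 * z\<^sup>2 - (\<Lambda> - 2) * x\<^sup>2 - (x\<^sup>2 + z\<^sup>2))"
          unfolding crit(1,3) by (simp add: power2_eq_square algebra_simps)
        then show ?thesis
          unfolding xz by (simp add: algebra_simps)
      qed
      finally have "\<eta> = 0 \<or> (1 - z\<^sup>2) * \<Lambda> = 1"
        using \<open>\<mu> \<noteq> 0\<close> by (auto simp: mult.commute)
      moreover have "(1 - z\<^sup>2) * \<Lambda> \<noteq> 1"
      proof
        assume "(1 - z\<^sup>2) * \<Lambda> = 1"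
        then have "z * Q \<noteq> (1 - z\<^sup>2) * Q'"
          unfolding Q_def Q'_def \<Lambda>_def by (rule legendre_sturm[OF l])
        moreover have "(1 - z\<^sup>2) * Q' = x * (x * Q')"
          unfolding xz[symmetric] by (simp add: power2_eq_square)
        ultimately show False
          unfolding crit(1,3) by simp
      qed
      ultimately have "\<eta> = 0" by blast
      then show ?thesis
        using h1 h2 h3 by (simp add: vec_eq_iff forall_3)
    qed
  qed
qed

lemma sq_dist_horizontal_centroid:
  assumes u: "u \<in> S2" and c: "centroid (body g \<epsilon>) $ 2 = 0" "centroid (body g \<epsilon>) $ 3 = 0"
  defines "a \<equiv> centroid (body g \<epsilon>) $ 1"
  shows "sq_dist g \<epsilon> u = (1 + \<epsilon> * g u)\<^sup>2 - 2 * (1 + \<epsilon> * g u) * a * u$1 + a\<^sup>2"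
proof -
  define s where "s = 1 + \<epsilon> * g u"
  have "sq_dist g \<epsilon> u = (s * u$1 - a)\<^sup>2 + (s * u$2)\<^sup>2 + (s * u$3)\<^sup>2"
    unfolding sq_dist_def power2_norm_eq_inner
    using c by (simp add: s_def a_def inner_vec_def sum_3 power2_eq_square)
  also have "\<dots> = s\<^sup>2 * ((u$1)\<^sup>2 + (u$2)\<^sup>2 + (u$3)\<^sup>2) - 2 * s * a * u$1 + a\<^sup>2"
    by (simp add: power2_eq_square algebra_simps)
  also have "(u$1)\<^sup>2 + (u$2)\<^sup>2 + (u$3)\<^sup>2 = 1"
    using u unfolding S2_coordinates .
  finally show ?thesis by (simp add: s_def)
qed

lemma sph_harm_1_expansion:
  assumes l: "2 \<le> l"
  shows "\<exists>C. \<forall>\<^sub>F \<epsilon> in at 0. \<forall>u\<in>S2. \<bar>sq_dist (sph_harm l 1) \<epsilon> u - (1 + 2 * \<epsilon> * sph_harm l 1 u)\<bar> \<le> C * \<epsilon>\<^sup>2"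
proof -
  define g where "g = sph_harm l 1"
  have "\<exists>\<delta>>0. \<exists>K\<ge>0. \<forall>\<epsilon>. \<bar>\<epsilon>\<bar> < \<delta> \<longrightarrow> positive_radius g \<epsilon> \<and> \<bar>centroid (body g \<epsilon>) $ 1\<bar> \<le> K * \<epsilon>\<^sup>2"
    unfolding g_def by (rule centroid_quadratic[OF l])
  then obtain \<delta> K where "\<delta> > 0" "K \<ge> 0"
    and "\<forall>\<epsilon>. \<bar>\<epsilon>\<bar> < \<delta> \<longrightarrow> positive_radius g \<epsilon> \<and> \<bar>centroid (body g \<epsilon>) $ 1\<bar> \<le> K * \<epsilon>\<^sup>2"
    by blast
  then have K: "\<delta> > 0" "K \<ge> 0" "\<And>\<epsilon>. \<bar>\<epsilon>\<bar> < \<delta> \<Longrightarrow> positive_radius g \<epsilon>"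
    "\<And>\<epsilon>. \<bar>\<epsilon>\<bar> < \<delta> \<Longrightarrow> \<bar>centroid (body g \<epsilon>) $ 1\<bar> \<le> K * \<epsilon>\<^sup>2"
    by simp_all
  obtain M where M: "\<And>u. u \<in> S2 \<Longrightarrow> \<bar>g u\<bar> \<le> M"
    using S2_bounded[OF continuous_on_sph_harm[of 1 l]] by (auto simp: g_def)
  have M0: "M \<ge> 0"
    using M[of "axis 1 1"] by simp
  have "\<bar>sq_dist g \<epsilon> u - (1 + 2 * \<epsilon> * g u)\<bar> \<le> (M\<^sup>2 + 2 * (1 + M) * K + K\<^sup>2) * \<epsilon>\<^sup>2"
    if \<epsilon>: "\<bar>\<epsilon>\<bar> < min \<delta> 1" and u: "u \<in> S2" for \<epsilon> u
  proof -
    define a where "a = centroid (body g \<epsilon>) $ 1"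
    have a: "\<bar>a\<bar> \<le> K * \<epsilon>\<^sup>2"
      using K(4) \<epsilon> by (simp add: a_def)
    have "positive_radius g \<epsilon>"
      using K(3) \<epsilon> by simp
    then have "sq_dist g \<epsilon> u = (1 + \<epsilon> * g u)\<^sup>2 - 2 * (1 + \<epsilon> * g u) * a * u$1 + a\<^sup>2"
      unfolding a_def g_def by (intro sq_dist_horizontal_centroid u centroid_body_symmetry) auto
    then have "sq_dist g \<epsilon> u - (1 + 2 * \<epsilon> * g u) = (g u)\<^sup>2 * \<epsilon>\<^sup>2 - 2 * (1 + \<epsilon> * g u) * a * u$1 + a\<^sup>2"
      by (simp add: power2_eq_square algebra_simps)
    also have "\<bar>\<dots>\<bar> \<le> \<bar>(g u)\<^sup>2 * \<epsilon>\<^sup>2\<bar> + \<bar>2 * (1 + \<epsilon> * g u) * a * u$1\<bar> + \<bar>a\<^sup>2\<bar>"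
      by linarith
    also have "\<dots> \<le> M\<^sup>2 * \<epsilon>\<^sup>2 + 2 * (1 + M) * (K * \<epsilon>\<^sup>2) * 1 + K\<^sup>2 * \<epsilon>\<^sup>2"
    proof (intro add_mono)
      have "(g u)\<^sup>2 \<le> M\<^sup>2"
        using M[OF u] M0 by (simp add: abs_le_square_iff[symmetric])
      then show "\<bar>(g u)\<^sup>2 * \<epsilon>\<^sup>2\<bar> \<le> M\<^sup>2 * \<epsilon>\<^sup>2"
        by (simp add: abs_mult mult_right_mono)
      have "\<bar>\<epsilon> * g u\<bar> \<le> 1 * M"
        unfolding abs_mult using \<epsilon> M[OF u] by (intro mult_mono) auto
      then have "\<bar>1 + \<epsilon> * g u\<bar> \<le> 1 + M" by linarith
      moreover have "\<bar>u$1\<bar> \<le> 1"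
        using component_le_norm_cart[of u 1] u by simp
      ultimately show "\<bar>2 * (1 + \<epsilon> * g u) * a * u$1\<bar> \<le> 2 * (1 + M) * (K * \<epsilon>\<^sup>2) * 1"
        unfolding abs_mult using a M0 K(2) by (intro mult_mono) auto
      have "\<bar>a\<bar> \<le> K * \<bar>\<epsilon>\<bar>"
      proof -
        have "\<epsilon>\<^sup>2 \<le> \<bar>\<epsilon>\<bar>"
          using \<epsilon> mult_left_le[of "\<bar>\<epsilon>\<bar>" "\<bar>\<epsilon>\<bar>"] by (simp add: power2_eq_square)
        then show ?thesis
          using a K(2) mult_left_mono[of "\<epsilon>\<^sup>2" "\<bar>\<epsilon>\<bar>" K] by linarith
      qed
      then have "\<bar>a\<bar>\<^sup>2 \<le> (K * \<bar>\<epsilon>\<bar>)\<^sup>2"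
        by (rule power_mono) simp
      then show "\<bar>a\<^sup>2\<bar> \<le> K\<^sup>2 * \<epsilon>\<^sup>2"
        by (simp add: power_mult_distrib)
    qed
    also have "\<dots> = (M\<^sup>2 + 2 * (1 + M) * K + K\<^sup>2) * \<epsilon>\<^sup>2"
      by (simp add: algebra_simps)
    finally show ?thesis .
  qed
  moreover have "\<forall>\<^sub>F \<epsilon> in at (0::real). \<bar>\<epsilon>\<bar> < min \<delta> 1"
    using K(1) by (auto simp: eventually_at intro!: exI[of _ "min \<delta> 1"])
  ultimately have "\<forall>\<^sub>F \<epsilon> in at 0. \<forall>u\<in>S2. \<bar>sq_dist g \<epsilon> u - (1 + 2 * \<epsilon> * g u)\<bar> \<le>
      (M\<^sup>2 + 2 * (1 + M) * K + K\<^sup>2) * \<epsilon>\<^sup>2"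
    by (auto elim!: eventually_mono)
  then show ?thesis
    by (auto simp: g_def)
qed

lemma sph_harm_1_correspondence:
  assumes l: "2 \<le> l"
  shows "\<forall>\<^sub>F \<epsilon> in at_right 0. positive_radius (sph_harm l 1) \<epsilon> \<and>
    (\<exists>F. critical_correspondence (sph_harm l 1) (sq_dist (sph_harm l 1) \<epsilon>) F)"
proof -
  interpret fam: sphere_family "perturbed l" "perturbed_grad l" "perturbed_hess l"
    by (rule perturbed_family)
  define g where "g = sph_harm l 1"
  have contX: "continuous_on S2 (fam.tangential_grad q)" for q
    by (intro fam.continuous_tangential_grad continuous_intros)
  have g0: "g u = perturbed l (0, 0) u" if "u \<in> S2" for u
    using sph_harm_eq_harmonic[OF that, of 1] by (simp add: g_def perturbed_0)
  interpret at0: increasing_recalibration "perturbed l (0, 0)" g "fam.tangential_grad (0,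
      0)" "\<lambda>t. t" "\<lambda>u. 1"
    by unfold_locales (auto intro: fam.sphere_gradient contX g0)
  have fin: "finite (critical_points (perturbed l (0, 0)))"
    using finite_critical_points_sph_harm[of 1 l] l at0.same_critical_points by (simp add: g_def)
  have ev: "\<forall>\<^sub>F q in nhds (0, 0). \<exists>F. critical_correspondence (perturbed l (0, 0)) (perturbed l q) F"
    by (rule fam.critical_correspondence_persists[OF fin sph_harm_1_nondegenerate[OF l]])
  have "\<exists>\<delta>>0. \<exists>K\<ge>0. \<forall>\<epsilon>. \<bar>\<epsilon>\<bar> < \<delta> \<longrightarrow> positive_radius g \<epsilon> \<and> \<bar>centroid (body g \<epsilon>) $ 1\<bar> \<le> K * \<epsilon>\<^sup>2"
    unfolding g_def by (rule centroid_quadratic[OF l])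
  then obtain \<delta> K where "\<delta> > 0" "K \<ge> 0"
    and "\<forall>\<epsilon>. \<bar>\<epsilon>\<bar> < \<delta> \<longrightarrow> positive_radius g \<epsilon> \<and> \<bar>centroid (body g \<epsilon>) $ 1\<bar> \<le> K * \<epsilon>\<^sup>2"
    by blast
  then have K: "\<delta> > 0" "K \<ge> 0" "\<And>\<epsilon>. \<bar>\<epsilon>\<bar> < \<delta> \<Longrightarrow> positive_radius g \<epsilon>"
    "\<And>\<epsilon>. \<bar>\<epsilon>\<bar> < \<delta> \<Longrightarrow> \<bar>centroid (body g \<epsilon>) $ 1\<bar> \<le> K * \<epsilon>\<^sup>2"
    by simp_all
  define \<kappa> where "\<kappa> \<epsilon> = centroid (body g \<epsilon>) $ 1 / \<epsilon>" for \<epsilon>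
  have small: "\<forall>\<^sub>F \<epsilon> in at_right 0. \<epsilon> < \<delta>"
    by (rule order_tendstoD[OF tendsto_ident_at K(1)])
  have pos: "\<forall>\<^sub>F \<epsilon> in at_right (0::real). \<epsilon> > 0"
    by (rule eventually_at_right_less)
  have "(\<kappa> \<longlongrightarrow> 0) (at_right 0)"
  proof (rule Lim_null_comparison)
    show "\<forall>\<^sub>F \<epsilon> in at_right 0. norm (\<kappa> \<epsilon>) \<le> K * \<epsilon>"
      using small pos
    proof eventually_elim
      case (elim \<epsilon>)
      then show ?case
        using K(4)[of \<epsilon>] by (simp add: \<kappa>_def divide_le_eq power2_eq_square mult.assoc)
    qed
    have "((\<lambda>\<epsilon>. K * \<epsilon>) \<longlongrightarrow> K * 0) (at_right 0)"
      by (intro tendsto_intros)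
    then show "((\<lambda>\<epsilon>. K * \<epsilon>) \<longlongrightarrow> 0) (at_right 0)" by simp
  qed
  then have "((\<lambda>\<epsilon>. (\<epsilon>, \<kappa> \<epsilon>)) \<longlongrightarrow> (0, 0)) (at_right 0)"
    by (intro tendsto_Pair tendsto_ident_at)
  from this[unfolded filterlim_iff, rule_format, OF ev]
  have "\<forall>\<^sub>F \<epsilon> in at_right 0. \<exists>F. critical_correspondence (perturbed l (0, 0)) (perturbed l (\<epsilon>, \<kappa> \<epsilon>)) F" .
  from this small pos show ?thesis
    unfolding g_def[symmetric]
  proof eventually_elim
    case (elim \<epsilon>)
    then obtain F where F: "critical_correspondence (perturbed l (0, 0)) (perturbed l (\<epsilon>, \<kappa> \<epsilon>)) F"
      by blast
    define a where "a = centroid (body g \<epsilon>) $ 1"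
    have pr: "positive_radius g \<epsilon>"
      using K(3) elim by simp
    interpret at_eps: increasing_recalibration "perturbed l (\<epsilon>,
        \<kappa> \<epsilon>)" "sq_dist g \<epsilon>" "fam.tangential_grad (\<epsilon>, \<kappa> \<epsilon>)"
      "\<lambda>t. 1 + a\<^sup>2 + 2 * \<epsilon> * t" "\<lambda>u. 2 * \<epsilon>"
    proof
      show "sq_dist g \<epsilon> u = 1 + a\<^sup>2 + 2 * \<epsilon> * perturbed l (\<epsilon>, \<kappa> \<epsilon>) u" if u: "u \<in> S2" for u
      proof -
        have "sq_dist g \<epsilon> u = (1 + \<epsilon> * g u)\<^sup>2 - 2 * (1 + \<epsilon> * g u) * a * u$1 + a\<^sup>2"
          using pr unfolding a_def g_def by (intro sq_dist_horizontal_centroid u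
              centroid_body_symmetry) auto
        moreover have "g u = u$1 * poly (legendre_deriv l 1) (u$3)"
          using g0[OF u] by (simp add: perturbed_0 harmonic_def)
        moreover have "a = \<epsilon> * \<kappa> \<epsilon>"
          using elim by (simp add: a_def \<kappa>_def)
        ultimately show ?thesis
          by (simp add: perturbed_def Let_def power2_eq_square algebra_simps)
      qed
      show "((\<lambda>t. 1 + a\<^sup>2 + 2 * \<epsilon> * t) has_real_derivative 2 * \<epsilon>) (at (perturbed l (\<epsilon>, \<kappa> \<epsilon>) u))" for u
        by (auto intro!: derivative_eq_intros)
    qed (use elim fam.sphere_gradient contX in auto)
    show ?case
      using pr at_eps.correspondence_right[OF at0.correspondence_left[OF F]] by blast
  qed
qed

theorem lemma2:
  fixes l m :: nat
  assumes "2 \<le> l" and "1 \<le> m" and "m \<le> l"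
  shows "(2 \<le> m \<longrightarrow>
           (\<forall>\<epsilon>. positive_radius (sph_harm l m) \<epsilon> \<longrightarrow>
             (\<forall>u\<in>S2. sq_dist (sph_harm l m) \<epsilon> u = (1 + \<epsilon> * sph_harm l m u)\<^sup>2)) \<and>
           {north_pole, south_pole} \<subseteq> critical_points (sph_harm l m) \<and>
           (\<forall>\<epsilon>\<in>convex_range (sph_harm l m).
             \<exists>F. equilibrium_correspondence (sph_harm l m) \<epsilon> F)) \<and>
         (m = 1 \<longrightarrow>
           (\<exists>C. \<forall>\<^sub>F \<epsilon> in at 0. \<forall>u\<in>S2.
             \<bar>sq_dist (sph_harm l m) \<epsilon> u - (1 + 2 * \<epsilon> * sph_harm l m u)\<bar> \<le> C * \<epsilon>\<^sup>2) \<and>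
           (\<exists>\<epsilon>\<^sub>0>0. \<forall>\<epsilon>. 0 < \<epsilon> \<and> \<epsilon> < \<epsilon>\<^sub>0 \<longrightarrow>
             positive_radius (sph_harm l m) \<epsilon> \<and>
             (\<exists>F. equilibrium_correspondence (sph_harm l m) \<epsilon> F)))"
proof (intro conjI impI)
  have dist: "sq_dist (sph_harm l m) \<epsilon> u = (1 + \<epsilon> * sph_harm l m u)\<^sup>2"
    if "2 \<le> m" "positive_radius (sph_harm l m) \<epsilon>" "u \<in> S2" for \<epsilon> u
    using centroid_body_symmetry(3)[OF assms(2) that(2,1)] that(3)
    by (simp add: sq_dist_def power_mult_distrib)
  then show "\<forall>\<epsilon>. positive_radius (sph_harm l m) \<epsilon> \<longrightarrow>
      (\<forall>u\<in>S2. sq_dist (sph_harm l m) \<epsilon> u = (1 + \<epsilon> * sph_harm l m u)\<^sup>2)" if "2 \<le> m"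
    using that by blast
  show "{north_pole, south_pole} \<subseteq> critical_points (sph_harm l m)" if "2 \<le> m"
    by (rule poles_critical[OF that])
  show "\<forall>\<epsilon>\<in>convex_range (sph_harm l m). \<exists>F. equilibrium_correspondence (sph_harm l m) \<epsilon> F" if "2 \<le> m"
  proof
    fix \<epsilon> assume "\<epsilon> \<in> convex_range (sph_harm l m)"
    then have \<epsilon>: "\<epsilon> > 0" "positive_radius (sph_harm l m) \<epsilon>"
      by (auto simp: convex_range_def)
    show "\<exists>F. equilibrium_correspondence (sph_harm l m) \<epsilon> F"
      using equilibrium_correspondenceI[OF correspondence_if_sq_dist_radial[OF assms(2,3) \<epsilon> dist[OF
          that \<epsilon>(2)]]]
      by blast
  qed
  assume m1: "m = 1"
  show "\<exists>C. \<forall>\<^sub>F \<epsilon> in at 0. \<forall>u\<in>S2. \<bar>sq_dist (sph_harm l m) \<epsilon> u - (1 + 2 * \<epsilon> * sph_harm l m u)\<bar> \<le> C * \<epsilon>\<^sup>2"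
    unfolding m1 by (rule sph_harm_1_expansion[OF assms(1)])
  obtain b where "b > 0" "\<And>\<epsilon>. 0 < \<epsilon> \<Longrightarrow> \<epsilon> < b \<Longrightarrow> positive_radius (sph_harm l 1) \<epsilon> \<and>
      (\<exists>F. critical_correspondence (sph_harm l 1) (sq_dist (sph_harm l 1) \<epsilon>) F)"
    using sph_harm_1_correspondence[OF assms(1)] unfolding eventually_at_right_field by auto
  then show "\<exists>\<epsilon>\<^sub>0>0. \<forall>\<epsilon>. 0 < \<epsilon> \<and> \<epsilon> < \<epsilon>\<^sub>0 \<longrightarrow> positive_radius (sph_harm l m) \<epsilon> \<and>
      (\<exists>F. equilibrium_correspondence (sph_harm l m) \<epsilon> F)"
    unfolding m1 using equilibrium_correspondenceI by blast
qed

end
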